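(* Fix the demand distribution $F_D$ and the unit holding cost $h\ge 0$. For every $p\ge 0$ let $\xi_p \in \arg\min_{\xi\ge 0}\lim_{L\to\infty}\mathcal{C}(P_\xi\mid p,L)$ and $r_p\in\arg\min_{r\in[0,\mu_D)}\lim_{L\to\infty}\mathcal{C}(C_r\mid p,L)$. Then: 1. There exists a constant $0\le M<\infty$ such that for all $p\ge 0$, $$\lim_{L\to\infty}\bigl(\mathcal{C}(P_{\xi_p}\mid p,L)-\mathcal{C}(C_{r_p}\mid p,L)\bigr)=\lim_{L\to\infty}\bigl(\mathcal{C}(P_{\xi_p}\mid p,L)-\mathcal{C}^*(p,L)\bigr)<M .$$ 2. $$\lim_{p\to\infty}\lim_{L\to\infty}\frac{\mathcal{C}(P_{\xi_p}\mid p,L)}{\mathcal{C}^*(p,L)}=1 .$$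
   Context: Lost sales inventory system. Demands $\{D_t\}_{t\in\mathbb{N}_0}$ ($\mathbb{N}_0=\mathbb{N}\cup\{0\}$) are i.i.d. non-negative random variables, distributed as $D$, with distribution function $F_D$ supported on $[0,\infty)$, $F_D(0)=0$, finite mean $\mu_D=\mathbb{E}[D]$ and variance $\sigma_D^2=\mathrm{Var}[D]\in(0,\infty)$. The leadtime is a deterministic $L\in\mathbb{N}_0$, the unit holding cost is $h\ge 0$ and the unit lost sales penalty cost is $p\ge 0$. Write $(x)^+=\max(x,0)$. $J_t$ is the inventory level at the start of period $t$ before receiving the order $q_t\ge 0$, which was placed in period $t-L$. The state is $\mathbf{x}_t=(J_t,q_t,q_{t+1},\dots,q_{t+L-1})\in\mathbb{R}_+^{L+1}$; $\mathbf{x}_0$ is fixed and known, with $J_0=0$. In each period $t$: the state $\mathbf{x}_t$ is observed and the order $q_{t+L}$ is placed; the order $q_t$ is received; the demand $D_t$ is realized (demand exceeding $J_t+q_t$ is lost); and the cost $c_t=h(J_t+q_t-D_t)^++p(D_t-J_t-q_t)^+$ is incurred. The dynamics are $J_{t+1}=(J_t+q_t-D_t)^+$. A policy $\pi$ is a collection of maps $\{\pi_t:\mathbb{R}_+^{L+1}\to\mathbb{R}_+\}_{t\in\mathbb{N}_0}$, with $q_{t+L}=\pi_t(\mathbf{x}_t)$; $\Pi$ is the set of admissible policies; $J_t(\pi),q_t(\pi),c_t(\pi)$ denote the quantities under $\pi$. The cost-rate is $$\mathcal{C}(\pi)=\mathcal{C}(\pi\mid p,L)=\limsup_{T\to\infty}\mathbb{E}\left[\frac{\sum_{t=L}^{T}c_t(\pi)}{T-L+1}\right],$$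 and $\mathcal{C}^*(p,L)=\inf_{\pi\in\Pi}\mathcal{C}(\pi\mid p,L)$. The constant order policy $C_r$, $r\in[0,\mu_D)$, is $C_r(\mathbf{x}_t)=r$. The projected inventory level (PIL) policy $P_\xi$, $\xi\ge0$, is $P_\xi(\mathbf{x}_t)=(\xi-\mathbb{E}[J_{t+L}\mid\mathbf{x}_t])^+$. *)

theory Defs
  imports "HOL-Probability.Probability"
begin

text \<open>
  A state \<open>(J\<^sub>t, q\<^sub>t, \<dots>, q\<^sub>t\<^sub>+\<^sub>L\<^sub>-\<^sub>1)\<close> is a function \<open>x\<close> on the index set \<open>{..L}\<close>
  (and \<open>undefined\<close> elsewhere) with \<open>x 0 = J\<^sub>t\<close> and \<open>x (Suc k) = q\<^sub>t\<^sub>+\<^sub>k\<close> for \<open>k < L\<close>.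
\<close>

definition state_space :: "nat \<Rightarrow> (nat \<Rightarrow> real) measure" where
  "state_space L = PiM {..L} (\<lambda>_. restrict_space borel {0..})"

type_synonym policy = "nat \<Rightarrow> (nat \<Rightarrow> real) \<Rightarrow> real"

definition policies :: "nat \<Rightarrow> policy set" where
  "policies L = {\<pi>. \<forall>t. \<pi> t \<in> measurable (state_space L) (restrict_space borel {0..})}"

text \<open>
  Putting the new order \<open>q\<^sub>t\<^sub>+\<^sub>L\<close> at index \<open>Suc L\<close> makes index \<open>1\<close> hold the order \<open>q\<^sub>t\<close>
  received in period \<open>t\<close> for every leadtime, including \<open>L = 0\<close>, where the order
  just placed is received at once.
\<close>

definition place_order :: "nat \<Rightarrow> (nat \<Rightarrow> real) \<Rightarrow> real \<Rightarrow> nat \<Rightarrow> real" where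
  "place_order L x q = x(Suc L := q)"

definition next_state :: "nat \<Rightarrow> (nat \<Rightarrow> real) \<Rightarrow> real \<Rightarrow> real \<Rightarrow> nat \<Rightarrow> real" where
  "next_state L x q d = (let y = place_order L x q in
     (\<lambda>i\<in>{..L}. if i = 0 then max (y 0 + y 1 - d) 0 else y (Suc i)))"

text \<open>The arguments \<open>x0\<close> and \<open>d\<close> are the initial state and the realized demand sequence.\<close>

primrec state :: "nat \<Rightarrow> policy \<Rightarrow> (nat \<Rightarrow> real) \<Rightarrow> (nat \<Rightarrow> real) \<Rightarrow> nat \<Rightarrow> (nat \<Rightarrow> real)" where
  "state L \<pi> x0 d 0 = x0"
| "state L \<pi> x0 d (Suc t) = next_state L (state L \<pi> x0 d t) (\<pi> t (state L \<pi> x0 d t)) (d t)"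

definition inventory :: "nat \<Rightarrow> policy \<Rightarrow> (nat \<Rightarrow> real) \<Rightarrow> (nat \<Rightarrow> real) \<Rightarrow> nat \<Rightarrow> real" where
  "inventory L \<pi> x0 d t = state L \<pi> x0 d t 0"

definition received_order :: "nat \<Rightarrow> policy \<Rightarrow> (nat \<Rightarrow> real) \<Rightarrow> (nat \<Rightarrow> real) \<Rightarrow> nat \<Rightarrow> real" where
  "received_order L \<pi> x0 d t =
     place_order L (state L \<pi> x0 d t) (\<pi> t (state L \<pi> x0 d t)) 1"

definition period_cost ::
  "real \<Rightarrow> real \<Rightarrow> nat \<Rightarrow> policy \<Rightarrow> (nat \<Rightarrow> real) \<Rightarrow> (nat \<Rightarrow> real) \<Rightarrow> nat \<Rightarrow> real" where
  "period_cost h p L \<pi> x0 d t =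
     (let J = inventory L \<pi> x0 d t; q = received_order L \<pi> x0 d t in
        h * max (J + q - d t) 0 + p * max (d t - J - q) 0)"

text \<open>
  The costs are nonnegative but need not be integrable for an arbitrary policy, so the
  expectation is taken as a nonnegative integral and the cost-rate may be \<open>\<infinity>\<close>.
  It is \<open>ereal\<close>-valued since subtraction on \<open>ennreal\<close> is truncated at \<open>0\<close>.
  The terms with \<open>T < L\<close> do not affect the upper limit.
\<close>

definition cost_rate ::
  "'a measure \<Rightarrow> (nat \<Rightarrow> 'a \<Rightarrow> real) \<Rightarrow> real \<Rightarrow> (nat \<Rightarrow> real) \<Rightarrow> real \<Rightarrow> nat \<Rightarrow> policy \<Rightarrow> ereal" where
  "cost_rate M D h x0 p L \<pi> =
     limsup (\<lambda>T. enn2ereal (\<integral>\<^sup>+ \<omega>. ennreal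
       ((\<Sum>t=L..T. period_cost h p L \<pi> x0 (\<lambda>s. D s \<omega>) t) / (real T - real L + 1)) \<partial>M))"

definition optimal_cost_rate ::
  "'a measure \<Rightarrow> (nat \<Rightarrow> 'a \<Rightarrow> real) \<Rightarrow> real \<Rightarrow> (nat \<Rightarrow> real) \<Rightarrow> real \<Rightarrow> nat \<Rightarrow> ereal" where
  "optimal_cost_rate M D h x0 p L = (INF \<pi>\<in>policies L. cost_rate M D h x0 p L \<pi>)"

definition const_policy :: "real \<Rightarrow> policy" where
  "const_policy r t x = r"

text \<open>
  The inventory level \<open>k \<le> L\<close> periods after a period with state \<open>x\<close>, when the demands from
  that period on are \<open>d 0, d 1, \<dots>\<close>. Every order received in between is already in \<open>x\<close>, so no
  policy is involved; see \<open>inventory_eq_pipeline_inventory\<close> below.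
\<close>

primrec pipeline_inventory :: "(nat \<Rightarrow> real) \<Rightarrow> (nat \<Rightarrow> real) \<Rightarrow> nat \<Rightarrow> real" where
  "pipeline_inventory x d 0 = x 0"
| "pipeline_inventory x d (Suc k) = max (pipeline_inventory x d k + x (Suc k) - d k) 0"

text \<open>
  \<open>E[J\<^sub>t\<^sub>+\<^sub>L | x\<^sub>t = x]\<close>: since \<open>x\<^sub>t\<close> is a function of \<open>D\<^sub>0, \<dots>, D\<^sub>t\<^sub>-\<^sub>1\<close> and hence independent of
  \<open>D\<^sub>t, \<dots>, D\<^sub>t\<^sub>+\<^sub>L\<^sub>-\<^sub>1\<close>, conditioning amounts to fixing the state and integrating over the latter.
\<close>

definition projected_inventory ::
  "'a measure \<Rightarrow> (nat \<Rightarrow> 'a \<Rightarrow> real) \<Rightarrow> nat \<Rightarrow> nat \<Rightarrow> (nat \<Rightarrow> real) \<Rightarrow> real" where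
  "projected_inventory M D L t x = (\<integral>\<omega>. pipeline_inventory x (\<lambda>k. D (t + k) \<omega>) L \<partial>M)"

definition pil_policy :: "'a measure \<Rightarrow> (nat \<Rightarrow> 'a \<Rightarrow> real) \<Rightarrow> nat \<Rightarrow> real \<Rightarrow> policy" where
  "pil_policy M D L \<xi> t x = max (\<xi> - projected_inventory M D L t x) 0"

lemma state_shift_order:
  "k < i \<Longrightarrow> i \<le> L \<Longrightarrow> state L \<pi> x0 d (t + k) (i - k) = state L \<pi> x0 d t i"
proof (induction k)
  case (Suc k)
  then show ?case
    by (auto simp: next_state_def place_order_def Let_def Suc_diff_Suc)
qed simp

lemma inventory_eq_pipeline_inventory_aux:
  "k \<le> L \<Longrightarrow> state L \<pi> x0 d (t + k) 0 =
     pipeline_inventory (state L \<pi> x0 d t) (\<lambda>k. d (t + k)) k"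
proof (induction k)
  case (Suc k)
  have "state L \<pi> x0 d (t + k) (Suc 0) = state L \<pi> x0 d t (Suc k)"
    using state_shift_order[of k "Suc k" L \<pi> x0 d t] Suc.prems by simp
  with Suc show ?case
    by (auto simp: next_state_def place_order_def Let_def)
qed simp

lemma inventory_eq_pipeline_inventory:
  "inventory L \<pi> x0 d (t + L) =
     pipeline_inventory (state L \<pi> x0 d t) (\<lambda>k. d (t + k)) L"
  by (simp add: inventory_def inventory_eq_pipeline_inventory_aux)

end

theory Submission
  imports Defs
begin

text \<open>
  As the leadtime grows, the cost-rate of the PIL policy with level \<open>\<xi>\<close> converges to that of the
  constant order policy with the order \<open>r\<close> for which \<open>r + E[J\<^sub>\<infinity>(r)] = \<xi>\<close>. To see this, couple both systems through the demands and let \<open>\<Delta>\<^sub>t\<close> be the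
  difference of their levels after the order of period \<open>t\<close> is received. After the demand, the
  difference is \<open>V\<^sub>t\<close> with \<open>V\<^sub>t\<^sup>2 \<le> \<Delta>\<^sub>t\<^sup>2 - b\<^sub>t\<close>, where \<open>b\<^sub>t\<close> is the squared difference of the sales. The
  PIL policy orders the projected deficit, so the new difference is \<open>V\<^sub>t\<close> minus its conditional mean
  \<open>L\<close> periods earlier, plus a term that vanishes for large \<open>L\<close> because the constant order system forgets
  its past. Centring is a contraction in mean square, so the \<open>b\<^sub>t\<close> are small on average: the
  sales, and hence the costs, of both systems agree in the limit.

  Constant order policies are asymptotically optimal: a subgradient of the inventory level with
  respect to the orders in the pipeline shows that every policy costs, per period, at least the
  minimum over \<open>\<rho>\<close> of the cost of ordering \<open>\<rho>\<close> in a system that is empty \<open>L\<close> periods earlier, and these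
  minima converge by compactness. Therefore the three cost-rates have the same limit, the
  differences tend to \<open>0\<close> and the ratio tends to \<open>1\<close> for every \<open>p > 0\<close>.
\<close>

section \<open>Inventory paths\<close>

text \<open>The order of the limits shapes the proof. For each leadtime, time tends to infinity
  first, so every effect of the initial state, which may vary freely with \<open>L\<close>, is gone
  before \<open>L\<close> grows; the estimates that have to be small for large \<open>L\<close> must
  in turn be uniform in time. The demands have only two moments, but the increments
  \<open>r - d n\<close> of the constant order system are bounded above, so for
  \<open>r < \<mu>\<close> its level has all the moments needed. At \<open>r = \<mu>\<close> the
  mean level diverges, and this is used twice: it lets \<open>r + limit_inventory r\<close> attain
  every nonnegative value, so that each PIL level has a constant order to be coupled with, and it
  closes the compactness argument at the end point \<mu>, which is not itself an admissible order.
  The contraction in mean square controls the squared sales differences only after summation over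
  time. The costs are therefore compared as Cesaro means, with the mean square gap as a telescoping
  potential, and not period by period.\<close>

definition const_inventory :: "real \<Rightarrow> real \<Rightarrow> (nat \<Rightarrow> real) \<Rightarrow> nat \<Rightarrow> real" where
  "const_inventory r j = pipeline_inventory (\<lambda>i. if i = 0 then j else r)"

lemma const_inventory_0 [simp]: "const_inventory r j d 0 = j"
  by (simp add: const_inventory_def)

lemma const_inventory_Suc [simp]:
  "const_inventory r j d (Suc n) = max (const_inventory r j d n + r - d n) 0"
  by (simp add: const_inventory_def)

lemma const_inventory_add:
  "const_inventory r j d (m + n) = const_inventory r (const_inventory r j d m) (\<lambda>k. d (m + k)) n"
  by (induction n) simp_all

lemma const_inventory_nonneg: "0 \<le> j \<Longrightarrow> 0 \<le> const_inventory r j d n"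
  by (cases n) simp_all

lemma const_inventory_mono:
  "r \<le> r' \<Longrightarrow> j \<le> j' \<Longrightarrow> const_inventory r j d n \<le> const_inventory r' j' d n"
  by (induction n) auto

text \<open>Each of the \<open>n\<close> orders received by then adds at most \<open>r' - r\<close>.
  The growth of the constant with \<open>n\<close> does no harm, because the bound is only applied
  at a fixed horizon.\<close>

lemma const_inventory_Lipschitz:
  assumes "r \<le> r'"
  shows "const_inventory r' j d n \<le> const_inventory r j d n + real n * (r' - r)"
proof (induction n)
  case (Suc n)
  have "0 \<le> real n * (r' - r)" using assms by simp
  with Suc assms have "const_inventory r' j d (Suc n)
      \<le> const_inventory r j d (Suc n) + (real n * (r' - r) + (r' - r))"
    by auto
  then show ?case by (simp add: algebra_simps)
qed simp

text \<open>Every step of the recursion is convex in level and order together and nondecreasing in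
  the level, so convexity propagates. It is the source of the continuity of
  \<open>limit_inventory\<close>.\<close>

lemma const_inventory_convex:
  assumes "0 \<le> u" "0 \<le> v" "u + v = 1"
  shows "const_inventory (u * r + v * r') j d n
    \<le> u * const_inventory r j d n + v * const_inventory r' j d n"
proof (induction n)
  case 0
  then show ?case using assms by (simp flip: distrib_right)
next
  case (Suc n)
  have "d n = u * d n + v * d n" using assms by (simp flip: distrib_right)
  moreover have "u * (const_inventory r j d n + r - d n)
      \<le> u * max (const_inventory r j d n + r - d n) 0"
    "v * (const_inventory r' j d n + r' - d n)
      \<le> v * max (const_inventory r' j d n + r' - d n) 0"
    using assms by (auto intro!: mult_left_mono)
  ultimately have "const_inventory (u * r + v * r') j d n + (u * r + v * r') - d n
    \<le> u * max (const_inventory r j d n + r - d n) 0 + v * max (const_inventory r' j d n + r' - d n) 0"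
    using Suc by (simp add: algebra_simps)
  then show ?case using assms by simp
qed

lemma const_inventory_upper:
  assumes "0 \<le> r" "0 \<le> j" and d: "\<And>k. 0 \<le> d k"
  shows "const_inventory r j d n \<le> j + real n * r"
proof (induction n)
  case (Suc n)
  have "0 \<le> real n * r" using assms by simp
  with Suc d[of n] assms(1,2) have "const_inventory r j d (Suc n) \<le> j + (real n * r + r)"
    unfolding const_inventory_Suc by linarith
  then show ?case by (simp add: algebra_simps)
qed simp

lemma const_inventory_0_0: "(\<And>k. 0 \<le> d k) \<Longrightarrow> const_inventory 0 0 d n = 0"
  using const_inventory_upper[of 0 0 d n] const_inventory_nonneg[of 0 0 d n] by simp

lemma const_inventory_lower: "j + (\<Sum>i<n. r - d i) \<le> const_inventory r j d n"
  by (induction n) auto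

text \<open>Until the system started at \<open>j\<close> is first cut off at 0 it is the free random
  walk, which dominates the level from an empty start. From then on both systems coincide and
  dominate the walk.\<close>

lemma const_inventory_initial:
  "0 \<le> j \<Longrightarrow> const_inventory r j d n = max (const_inventory r 0 d n) (j + (\<Sum>i<n. r - d i))"
proof (induction n)
  case (Suc n)
  then show ?case by (auto simp: max_def)
qed simp

lemma pipeline_inventory_nonneg: "0 \<le> x 0 \<Longrightarrow> 0 \<le> pipeline_inventory x d n"
  by (cases n) simp_all

lemma pipeline_inventory_upper:
  assumes "\<And>i. i \<le> n \<Longrightarrow> 0 \<le> x i" "\<And>k. 0 \<le> d k"
  shows "pipeline_inventory x d n \<le> (\<Sum>i\<le>n. x i)"
  using assms(1)
proof (induction n)
  case (Suc n)
  have "0 \<le> d n" by (rule assms(2))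
  moreover have "0 \<le> (\<Sum>i\<le>n. x i)" by (rule sum_nonneg) (simp add: Suc.prems)
  ultimately show ?case using Suc by (auto simp: algebra_simps)
qed simp

lemma pipeline_inventory_cong:
  "(\<And>i. i \<le> n \<Longrightarrow> x i = x' i) \<Longrightarrow> (\<And>i. i < n \<Longrightarrow> d i = d' i) \<Longrightarrow>
    pipeline_inventory x d n = pipeline_inventory x' d' n"
  by (induction n) auto

text \<open>
  As functions of \<open>i\<close>, the indicators form a subgradient of the inventory level at time \<open>n\<close>, a
  convex function of the orders, at the constant order \<open>r\<close>.
\<close>

definition no_stockout :: "real \<Rightarrow> (nat \<Rightarrow> real) \<Rightarrow> nat \<Rightarrow> nat \<Rightarrow> bool" where
  "no_stockout r d i n = (\<forall>k\<in>{i<..n}. 0 < const_inventory r 0 d k)"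

text \<open>A marginal unit of order \<open>i\<close> is still in stock at time \<open>n\<close> if
  the system has not been emptied in between. When the level is positive at the next time, the old
  indicators keep their values and the newest order gets weight 1; when it is 0, all indicators
  vanish and only nonnegativity is claimed.\<close>

lemma pipeline_inventory_subgradient:
  assumes "0 \<le> x 0"
  shows "const_inventory r 0 d n + (\<Sum>i<n. (x (Suc i) - r) * of_bool (no_stockout r d i n))
    \<le> pipeline_inventory x d n"
proof (induction n)
  case (Suc n)
  show ?case
  proof (cases "0 < const_inventory r 0 d (Suc n)")
    case True
    have eq: "no_stockout r d i (Suc n) = no_stockout r d i n" if "i < n" for i
    proof -
      have "{i<..Suc n} = insert (Suc n) {i<..n}" using that by auto
      with True show ?thesis by (simp add: no_stockout_def del: const_inventory_Suc)
    qed
    have "{n<..Suc n} = {Suc n}" by auto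
    then have "no_stockout r d n (Suc n)"
      using True by (simp add: no_stockout_def del: const_inventory_Suc)
    then have "(\<Sum>i<Suc n. (x (Suc i) - r) * of_bool (no_stockout r d i (Suc n)))
      = (\<Sum>i<n. (x (Suc i) - r) * of_bool (no_stockout r d i n)) + (x (Suc n) - r)"
      by (simp add: eq)
    with Suc True show ?thesis by (simp add: max_def split: if_splits)
  next
    case False
    then have "no_stockout r d i (Suc n) = False" if "i < Suc n" for i
      using that unfolding no_stockout_def
      by (metis greaterThanAtMost_iff order_refl)
    moreover have "const_inventory r 0 d (Suc n) = 0"
      using False const_inventory_nonneg[of 0 r d "Suc n"] by simp
    ultimately have "const_inventory r 0 d (Suc n)
        + (\<Sum>i<Suc n. (x (Suc i) - r) * of_bool (no_stockout r d i (Suc n))) = 0"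
      by (simp del: const_inventory_Suc sum.lessThan_Suc)
    then show ?thesis
      using pipeline_inventory_nonneg[of x d "Suc n"] assms by linarith
  qed
qed (use assms in simp)

section \<open>Levels, orders and costs under an arbitrary policy\<close>

lemma state_cong:
  "(\<And>i. i < t \<Longrightarrow> d i = d' i) \<Longrightarrow> state L \<pi> x0 d t = state L \<pi> x0 d' t"
  by (induction t) auto

abbreviation "echelon L \<pi> x0 d t \<equiv> inventory L \<pi> x0 d t + received_order L \<pi> x0 d t"

lemma inventory_Suc:
  "inventory L \<pi> x0 d (Suc t) = max (echelon L \<pi> x0 d t - d t) 0"
  by (auto simp: inventory_def received_order_def next_state_def place_order_def Let_def)

text \<open>Lost sales are demand minus available stock plus leftover stock. In this form the cost
  is affine in levels, order and demand, so its mean is determined by their means.\<close>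

lemma period_cost_eq:
  "period_cost h p L \<pi> x0 d t = h * inventory L \<pi> x0 d (Suc t)
     + p * (d t - echelon L \<pi> x0 d t + inventory L \<pi> x0 d (Suc t))"
  by (auto simp: inventory_Suc period_cost_def Let_def max_def algebra_simps)

lemma received_order_add:
  "received_order L \<pi> x0 d (t + L) = \<pi> t (state L \<pi> x0 d t)"
proof (cases L)
  case 0
  then show ?thesis by (simp add: received_order_def place_order_def)
next
  case (Suc l)
  \<comment> \<open>A new order becomes part of the state one period later, at index
    \<open>L\<close>; the remaining \<open>l = L - 1\<close> shifts bring it to index 1.\<close>
  have "received_order L \<pi> x0 d (t + L) = state L \<pi> x0 d (Suc t + l) (L - l)"
    using Suc by (simp add: received_order_def place_order_def del: state.simps)
  also have "\<dots> = state L \<pi> x0 d (Suc t) L"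
    by (rule state_shift_order) (auto simp: Suc)
  also have "\<dots> = \<pi> t (state L \<pi> x0 d t)"
    using Suc by (simp add: next_state_def place_order_def Let_def)
  finally show ?thesis .
qed

lemma received_order_pipeline:
  assumes "i < L"
  shows "received_order L \<pi> x0 d (t + i) = state L \<pi> x0 d t (Suc i)"
  using state_shift_order[of i "Suc i" L \<pi> x0 d t] assms
  by (simp add: received_order_def place_order_def)

text \<open>
  Receiving the orders one period earlier, against the same demands, can only lose fewer sales.
\<close>

lemma pipeline_inventory_next_state:
  assumes "\<And>i. i \<le> L \<Longrightarrow> 0 \<le> x i" "0 \<le> q" "0 \<le> d0"
  shows "pipeline_inventory (next_state L x q d0) d L \<le> pipeline_inventory x d L + q"
proof -
  define y where "y = place_order L x q"
  have y: "0 \<le> y i" if "i \<le> Suc L" for i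
    using assms that by (auto simp: y_def place_order_def le_Suc_eq)
  \<comment> \<open>Invariant of the comparison: after \<open>k\<close> periods the advanced system
    is ahead by at most the one order that the other system is about to receive. It holds at the
    start because the demand \<open>d0\<close> only lowers the advanced level.\<close>
  have "pipeline_inventory (next_state L x q d0) d k \<le> pipeline_inventory y d k + y (Suc k)"
    if "k \<le> L" for k
    using that
  proof (induction k)
    case 0
    then show ?case using y[of 0] y[of 1] assms
      by (auto simp: next_state_def Let_def y_def[symmetric])
  next
    case (Suc k)
    then have "next_state L x q d0 (Suc k) = y (Suc (Suc k))"
      by (simp add: next_state_def Let_def y_def)
    with Suc y[of "Suc (Suc k)"] show ?case by auto
  qed
  from this[of L] have "pipeline_inventory (next_state L x q d0) d L \<le> pipeline_inventory y d L + q"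
    by (simp add: y_def place_order_def)
  also have "pipeline_inventory y d L = pipeline_inventory x d L"
    by (rule pipeline_inventory_cong) (auto simp: y_def place_order_def)
  finally show ?thesis .
qed

section \<open>The space of demand sequences\<close>

text \<open>Canonical model for the demands. The law lives on the half-line as a subspace, so demand
  sequences in its product space are nonnegative everywhere and not just almost everywhere; bounds
  on levels and membership in the state space can then be shown path by path.\<close>

locale demand_process = prob_space F for F :: "real measure" +
  fixes \<mu> :: real
  assumes sets_F: "sets F = sets (restrict_space borel {0..})"
    and integrable_F: "integrable F (\<lambda>x. x)"
    and mean_F: "(\<integral>x. x \<partial>F) = \<mu>"
    and integrable_F_sq: "integrable F (\<lambda>x. x\<^sup>2)"
    and mean_pos: "0 < \<mu>"
    and variance_pos: "0 < (\<integral>x. (x - \<mu>)\<^sup>2 \<partial>F)"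
begin

sublocale sequence_space F
  by unfold_locales

lemma space_F: "space F = {0..}"
  using sets_eq_imp_space_eq[OF sets_F] by (simp add: space_restrict_space)

lemma measurable_F: "(\<lambda>x. x) \<in> borel_measurable F"
  by (subst measurable_cong_sets[OF sets_F refl]) (rule measurable_restrict_space1, simp)

lemma measurable_F_I:
  assumes "f \<in> borel_measurable N" "\<And>x. x \<in> space N \<Longrightarrow> 0 \<le> f x"
  shows "f \<in> measurable N F"
  by (subst measurable_cong_sets[OF refl sets_F]) (rule measurable_restrict_space2, use assms in auto)

lemma space_S: "d \<in> space S \<longleftrightarrow> (\<forall>k. 0 \<le> d k)"
  by (auto simp: space_PiM space_F PiE_iff)

lemma S_nonneg: "d \<in> space S \<Longrightarrow> 0 \<le> d k"
  by (simp add: space_S)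

lemma measurable_coordinate [measurable (raw)]: "(\<lambda>d. d k) \<in> borel_measurable S"
proof -
  have "(\<lambda>d. d k) \<in> measurable S F" by (rule measurable_component_singleton) simp
  from measurable_compose[OF this measurable_F] show ?thesis .
qed

lemma measurable_S_I:
  assumes "\<And>k. (\<lambda>x. f x k) \<in> borel_measurable N" "\<And>k x. x \<in> space N \<Longrightarrow> 0 \<le> f x k"
  shows "f \<in> measurable N S"
  by (rule measurable_PiM_single') (auto intro!: measurable_F_I assms simp: space_F)

lemma measurable_shift [measurable (raw)]: "(\<lambda>d k. d (t + k)) \<in> measurable S S"
  by (rule measurable_S_I) (auto simp: space_S)

section \<open>Splitting the demands into past and future\<close>

lemma comb_seq_shift [simp]: "comb_seq t d d' (t + k) = d' k"
  by (simp add: comb_seq_def)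

text \<open>Splicing the first \<open>t\<close> demands of \<open>d\<close> with an independent
  sequence \<open>d'\<close> preserves the product measure, so this is Fubini's theorem. The inner
  integral plays the role of the conditional expectation given the first \<open>t\<close> demands,
  and no conditional expectation operator is needed.\<close>

lemma nn_integral_split:
  assumes [measurable]: "f \<in> borel_measurable S"
  shows "(\<integral>\<^sup>+d. f d \<partial>S) = (\<integral>\<^sup>+d. \<integral>\<^sup>+d'. f (comb_seq t d d') \<partial>S \<partial>S)"
proof -
  have "(\<integral>\<^sup>+d. f d \<partial>S) = (\<integral>\<^sup>+d. f d \<partial>distr (S \<Otimes>\<^sub>M S) S (\<lambda>(\<omega>, \<omega>'). comb_seq t \<omega> \<omega>'))"
    by (simp add: PiM_comb_seq)
  also have "\<dots> = (\<integral>\<^sup>+p. f (comb_seq t (fst p) (snd p)) \<partial>(S \<Otimes>\<^sub>M S))"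
    by (subst nn_integral_distr) (auto simp: case_prod_beta)
  also have "\<dots> = (\<integral>\<^sup>+d. \<integral>\<^sup>+d'. f (comb_seq t d d') \<partial>S \<partial>S)"
    by (subst P.nn_integral_fst[symmetric]) auto
  finally show ?thesis .
qed

lemma
  fixes f :: "(nat \<Rightarrow> real) \<Rightarrow> real"
  assumes f: "integrable S f"
  shows integral_split: "(\<integral>d. f d \<partial>S) = (\<integral>d. \<integral>d'. f (comb_seq t d d') \<partial>S \<partial>S)"
    and integrable_split: "integrable S (\<lambda>d. \<integral>d'. f (comb_seq t d d') \<partial>S)"
proof -
  note [measurable] = borel_measurable_integrable[OF f]
  have PP: "pair_sigma_finite S S"
    by (simp add: pair_sigma_finite_def P.sigma_finite_measure_axioms)
  have 1: "integrable (S \<Otimes>\<^sub>M S) (\<lambda>(d, d'). f (comb_seq t d d'))"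
  proof -
    have "integrable (distr (S \<Otimes>\<^sub>M S) S (\<lambda>(\<omega>, \<omega>'). comb_seq t \<omega> \<omega>')) f"
      using f by (simp add: PiM_comb_seq)
    from integrable_distr[OF _ this] show ?thesis
      by (simp add: case_prod_beta')
  qed
  have "(\<integral>d. \<integral>d'. f (comb_seq t d d') \<partial>S \<partial>S)
      = (\<integral>p. (\<lambda>(d, d'). f (comb_seq t d d')) p \<partial>(S \<Otimes>\<^sub>M S))"
    using pair_sigma_finite.integral_fst'[OF PP 1] unfolding prod.case .
  also have "\<dots> = (\<integral>d. f d \<partial>distr (S \<Otimes>\<^sub>M S) S (\<lambda>(\<omega>, \<omega>'). comb_seq t \<omega> \<omega>'))"
    using integral_distr[OF measurable_comb_seq borel_measurable_integrable[OF f], of t]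
    unfolding case_prod_beta' by (rule sym)
  also have "\<dots> = (\<integral>d. f d \<partial>S)"
    by (simp add: PiM_comb_seq)
  finally show "(\<integral>d. f d \<partial>S) = (\<integral>d. \<integral>d'. f (comb_seq t d d') \<partial>S \<partial>S)" ..
  show "integrable S (\<lambda>d. \<integral>d'. f (comb_seq t d d') \<partial>S)"
    using pair_sigma_finite.integrable_fst'[OF PP 1] unfolding prod.case .
qed

lemma nn_integral_indep:
  assumes [measurable]: "f \<in> borel_measurable S" "g \<in> borel_measurable S"
    and f: "\<And>d d'. (\<And>i. i < t \<Longrightarrow> d i = d' i) \<Longrightarrow> f d = f d'"
  shows "(\<integral>\<^sup>+d. f d * g (\<lambda>k. d (t + k)) \<partial>S) = (\<integral>\<^sup>+d. f d \<partial>S) * (\<integral>\<^sup>+d. g d \<partial>S)"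
proof -
  have "f (comb_seq t d d') = f d" for d d' by (rule f) (simp add: comb_seq_def)
  then have "(\<integral>\<^sup>+d. f d * g (\<lambda>k. d (t + k)) \<partial>S) = (\<integral>\<^sup>+d. \<integral>\<^sup>+d'. f d * g d' \<partial>S \<partial>S)"
    by (subst nn_integral_split[of _ t]) simp_all
  also have "\<dots> = (\<integral>\<^sup>+d. f d \<partial>S) * (\<integral>\<^sup>+d. g d \<partial>S)"
    by (simp add: nn_integral_cmult nn_integral_multc)
  finally show ?thesis .
qed

text \<open>Stationarity is independence with the constant 1 as the function of the first
  \<open>t\<close> demands.\<close>

lemma distr_shift: "distr S S (\<lambda>d k. d (t + k)) = S"
proof (rule measure_eqI)
  fix A assume "A \<in> sets (distr S S (\<lambda>d k. d (t + k)))"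
  then have [measurable]: "A \<in> sets S" by simp
  have "emeasure (distr S S (\<lambda>d k. d (t + k))) A
      = (\<integral>\<^sup>+d. indicator A d \<partial>distr S S (\<lambda>d k. d (t + k)))"
    by simp
  also have "\<dots> = (\<integral>\<^sup>+d. 1 * indicator A (\<lambda>k. d (t + k)) \<partial>S)"
    by (subst nn_integral_distr) auto
  also have "\<dots> = emeasure S A"
    by (subst nn_integral_indep) (auto simp: P.emeasure_space_1)
  finally show "emeasure (distr S S (\<lambda>d k. d (t + k))) A = emeasure S A" .
qed simp

lemma integral_shift:
  fixes f :: "(nat \<Rightarrow> real) \<Rightarrow> real"
  assumes "f \<in> borel_measurable S"
  shows "(\<integral>d. f (\<lambda>k. d (t + k)) \<partial>S) = (\<integral>d. f d \<partial>S)"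
  using integral_distr[OF measurable_shift assms, of t] by (simp add: distr_shift)

lemma integrable_shift:
  fixes f :: "(nat \<Rightarrow> real) \<Rightarrow> real"
  assumes "integrable S f"
  shows "integrable S (\<lambda>d. f (\<lambda>k. d (t + k)))"
  using integrable_distr_eq[OF measurable_shift borel_measurable_integrable[OF assms], of t] assms
  by (simp add: distr_shift)

lemma distr_coordinate: "distr S F (\<lambda>d. d k) = F"
  by (rule PiM_component) simp

lemma
  fixes f :: "real \<Rightarrow> real"
  assumes "f \<in> borel_measurable borel"
  shows integral_coordinate: "(\<integral>d. f (d k) \<partial>S) = (\<integral>x. f x \<partial>F)"
    and integrable_coordinate: "integrable S (\<lambda>d. f (d k)) \<longleftrightarrow> integrable F f"
proof -
  have f: "f \<in> borel_measurable F"
    using measurable_compose[OF measurable_F assms] .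
  have m: "(\<lambda>d. d k) \<in> measurable S F"
    by (rule measurable_component_singleton) simp
  show "(\<integral>d. f (d k) \<partial>S) = (\<integral>x. f x \<partial>F)"
    using integral_distr[OF m f, unfolded distr_coordinate] by (rule sym)
  show "integrable S (\<lambda>d. f (d k)) \<longleftrightarrow> integrable F f"
    using integrable_distr_eq[OF m f, unfolded distr_coordinate] by (rule sym)
qed

lemma integrable_bounded:
  fixes f :: "(nat \<Rightarrow> real) \<Rightarrow> real"
  assumes "f \<in> borel_measurable S" "\<And>d. d \<in> space S \<Longrightarrow> \<bar>f d\<bar> \<le> c"
  shows "integrable S f"
proof (rule P.integrable_const_bound[of _ c])
  show "AE d in S. norm (f d) \<le> c" by (rule AE_I2) (simp add: assms(2))
qed fact

end

section \<open>The constant order system\<close>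

lemma measurable_const_inventory [measurable (raw)]:
  assumes [measurable]: "j \<in> borel_measurable N" "\<And>k. (\<lambda>\<omega>. g \<omega> k) \<in> borel_measurable N"
  shows "(\<lambda>\<omega>. const_inventory r (j \<omega>) (g \<omega>) n) \<in> borel_measurable N"
  by (induction n) simp_all

lemma measurable_pipeline_inventory:
  assumes [measurable]: "\<And>i. i \<le> n \<Longrightarrow> (\<lambda>\<omega>. x \<omega> i) \<in> borel_measurable N"
    "\<And>k. (\<lambda>\<omega>. g \<omega> k) \<in> borel_measurable N"
  shows "(\<lambda>\<omega>. pipeline_inventory (x \<omega>) (g \<omega>) n) \<in> borel_measurable N"
  using assms(1)
proof (induction n)
  case (Suc n)
  from Suc.prems[of "Suc n"] have [measurable]: "(\<lambda>\<omega>. x \<omega> (Suc n)) \<in> borel_measurable N" by simp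
  from Suc have [measurable]: "(\<lambda>\<omega>. pipeline_inventory (x \<omega>) (g \<omega>) n) \<in> borel_measurable N" by simp
  show ?case by simp
qed simp

lemma const_inventory_abs_le:
  assumes d: "\<And>k. 0 \<le> d k"
  shows "\<bar>const_inventory r j d n\<bar> \<le> \<bar>j\<bar> + real n * \<bar>r\<bar>"
proof (cases "n = 0")
  case False
  then obtain m where "n = Suc m" by (cases n) auto
  then have "0 \<le> const_inventory r j d n" by simp
  moreover have "const_inventory r j d n \<le> const_inventory \<bar>r\<bar> \<bar>j\<bar> d n"
    by (rule const_inventory_mono) auto
  moreover have "\<dots> \<le> \<bar>j\<bar> + real n * \<bar>r\<bar>"
    using d by (intro const_inventory_upper) auto
  ultimately show ?thesis by linarith
qed simp

text \<open>For negative \<open>y\<close>, multiply by \<open>1 - y\<close>: the left side becomes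
  at most 1 since \<open>1 - y \<le> exp (- y)\<close>, and the right side becomes 1 - y^3. That
  \<open>y\<close> may be arbitrarily negative is essential, as it stands for minus a demand with
  only two moments.\<close>

lemma exp_le_quadratic:
  fixes y :: real
  assumes "y \<le> 1"
  shows "exp y \<le> 1 + y + y\<^sup>2"
proof (cases "0 \<le> y")
  case True
  then show ?thesis using assms exp_bound by blast
next
  case False
  have "exp y * exp (- y) = 1" by (simp flip: exp_add)
  moreover have "exp y * (1 - y) \<le> exp y * exp (- y)"
    using exp_ge_add_one_self[of "-y"] by (intro mult_left_mono) auto
  moreover have "1 \<le> (1 + y + y\<^sup>2) * (1 - y)"
  proof -
    have "y ^ 3 \<le> 0" using False by (simp add: power_le_zero_eq)
    then show ?thesis by (simp add: algebra_simps power2_eq_square power3_eq_cube)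
  qed
  ultimately have "exp y * (1 - y) \<le> (1 + y + y\<^sup>2) * (1 - y)" by linarith
  then show ?thesis using False by (simp add: mult_le_cancel_right)
qed

lemma cube_le_exp:
  fixes y :: real
  assumes "0 \<le> y"
  shows "y ^ 3 \<le> 27 * exp y"
proof -
  have "(y / 3) ^ 3 \<le> exp (y / 3) ^ 3"
    using assms exp_ge_add_one_self[of "y / 3"] by (intro power_mono) linarith+
  also have "exp (y / 3) ^ 3 = exp y" by (simp flip: exp_of_nat_mult)
  finally show ?thesis by (simp add: power_divide)
qed

context demand_process
begin

lemma integral_indep:
  fixes f g :: "(nat \<Rightarrow> real) \<Rightarrow> real"
  assumes "integrable S (\<lambda>d. f d * g (\<lambda>k. d (t + k)))"
    and f: "\<And>d d'. (\<And>i. i < t \<Longrightarrow> d i = d' i) \<Longrightarrow> f d = f d'"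
  shows "(\<integral>d. f d * g (\<lambda>k. d (t + k)) \<partial>S) = (\<integral>d. f d \<partial>S) * (\<integral>d. g d \<partial>S)"
proof -
  have "f (comb_seq t d d') = f d" for d d' by (rule f) (simp add: comb_seq_def)
  then show ?thesis by (subst integral_split[OF assms(1), of t]) simp
qed

lemma prob_space_S [simp]: "measure S (space S) = 1"
  by (rule P.prob_space)

lemma integrable_sq_bounded:
  fixes f :: "(nat \<Rightarrow> real) \<Rightarrow> real"
  assumes [measurable]: "f \<in> borel_measurable S" and "\<And>d. d \<in> space S \<Longrightarrow> \<bar>f d\<bar> \<le> c"
  shows "integrable S (\<lambda>d. (f d)\<^sup>2)"
proof (rule integrable_bounded)
  show "\<bar>(f d)\<^sup>2\<bar> \<le> c\<^sup>2" if "d \<in> space S" for d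
    using power_mono[OF assms(2)[OF that], of 2] by simp
qed measurable

definition mean_inventory :: "real \<Rightarrow> real \<Rightarrow> nat \<Rightarrow> real" where
  "mean_inventory r j n = (\<integral>d. const_inventory r j d n \<partial>S)"

lemma integrable_const_inventory [simp]: "integrable S (\<lambda>d. const_inventory r j d n)"
proof (rule integrable_bounded)
  show "\<bar>const_inventory r j d n\<bar> \<le> \<bar>j\<bar> + real n * \<bar>r\<bar>" if "d \<in> space S" for d
    by (rule const_inventory_abs_le) (rule S_nonneg[OF that])
qed measurable

lemma integrable_coord [simp]: "integrable S (\<lambda>d. d k)"
  by (rule integrable_coordinate[of "\<lambda>x. x" k, THEN iffD2]) (simp, rule integrable_F)

lemma integral_coord [simp]: "(\<integral>d. d k \<partial>S) = \<mu>"
  by (rule trans[OF integral_coordinate[of "\<lambda>x. x" k] mean_F]) simp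

lemma mean_inventory_nonneg: "0 \<le> j \<Longrightarrow> 0 \<le> mean_inventory r j n"
  unfolding mean_inventory_def by (rule Bochner_Integration.integral_nonneg) (simp add: const_inventory_nonneg)

lemma mean_inventory_mono:
  "r \<le> r' \<Longrightarrow> j \<le> j' \<Longrightarrow> mean_inventory r j n \<le> mean_inventory r' j' n"
  unfolding mean_inventory_def by (intro integral_mono const_inventory_mono) simp_all

lemma mean_inventory_shift:
  "(\<integral>d. const_inventory r j (\<lambda>k. d (t + k)) n \<partial>S) = mean_inventory r j n"
  unfolding mean_inventory_def by (rule integral_shift) measurable

lemma integrable_const_inventory_shift [simp]:
  "integrable S (\<lambda>d. const_inventory r j (\<lambda>k. d (t + k)) n)"
  by (rule integrable_shift) simp

text \<open>Loynes' argument: by stationarity the shorter run may start one period late. At that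
  moment the longer run has a nonnegative level, and monotonicity in the initial level preserves the
  order.\<close>

lemma mean_inventory_Suc: "mean_inventory r 0 n \<le> mean_inventory r 0 (Suc n)"
proof -
  have "mean_inventory r 0 n = (\<integral>d. const_inventory r 0 (\<lambda>k. d (1 + k)) n \<partial>S)"
    by (rule mean_inventory_shift[symmetric])
  also have "\<dots> \<le> (\<integral>d. const_inventory r 0 d (1 + n) \<partial>S)"
  proof (rule integral_mono)
    fix d
    show "const_inventory r 0 (\<lambda>k. d (1 + k)) n \<le> const_inventory r 0 d (1 + n)"
      unfolding const_inventory_add by (rule const_inventory_mono) simp_all
  qed (rule integrable_const_inventory_shift integrable_const_inventory)+
  finally show ?thesis by (simp add: mean_inventory_def)
qed

lemma incseq_mean_inventory: "incseq (mean_inventory r 0)"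
  by (rule incseq_SucI) (rule mean_inventory_Suc)

lemma mean_inventory_Lipschitz:
  assumes "r \<le> r'"
  shows "mean_inventory r' j n \<le> mean_inventory r j n + real n * (r' - r)"
proof -
  have "mean_inventory r' j n \<le> (\<integral>d. const_inventory r j d n + real n * (r' - r) \<partial>S)"
    unfolding mean_inventory_def
    by (intro integral_mono const_inventory_Lipschitz assms) simp_all
  then show ?thesis by (simp add: mean_inventory_def)
qed

lemma mean_inventory_0_0: "mean_inventory 0 0 n = 0"
proof -
  have "mean_inventory 0 0 n = (\<integral>d. 0 \<partial>S)"
    unfolding mean_inventory_def
    by (intro Bochner_Integration.integral_cong const_inventory_0_0 refl) (rule S_nonneg)
  then show ?thesis by simp
qed

lemma mean_inventory_lower: "real n * (r - \<mu>) \<le> mean_inventory r 0 n"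
proof -
  have "(\<integral>d. 0 + (\<Sum>i<n. r - d i) \<partial>S) \<le> mean_inventory r 0 n"
    unfolding mean_inventory_def
    by (intro integral_mono const_inventory_lower) simp_all
  then show ?thesis by simp
qed

section \<open>Exponential moments below the critical rate\<close>

lemma exponential_drift:
  assumes "r < \<mu>"
  obtains \<theta> \<rho> where "0 < \<theta>" "0 \<le> \<rho>" "\<rho> < 1" "(\<integral>d. exp (\<theta> * (r - d 0)) \<partial>S) \<le> \<rho>"
proof -
  have int2: "integrable F (\<lambda>x. (r - x)\<^sup>2)"
  proof -
    have "(\<lambda>x. (r - x)\<^sup>2) = (\<lambda>x. r\<^sup>2 - 2 * r * x + x\<^sup>2)"
      by (auto simp: power2_diff)
    then show ?thesis using integrable_F integrable_F_sq by simp
  qed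
  define Q where "Q = (\<integral>x. (r - x)\<^sup>2 \<partial>F)"
  have Q: "0 \<le> Q" unfolding Q_def by (rule Bochner_Integration.integral_nonneg) simp
  \<comment> \<open>The first bound keeps \<open>\<theta> * (r - d 0)\<close> at most 1, the range
    of the quadratic estimate. The second makes the quadratic term
    \<open>\<theta>\<^sup>2 * Q\<close> at most half of the drift
    \<open>\<theta> * (\<mu> - r)\<close>; the other half is the gap between \<rho> and 1.\<close>
  define \<theta> where "\<theta> = min (1 / (\<bar>r\<bar> + 1)) ((\<mu> - r) / (2 * (Q + 1)))"
  have \<theta>: "0 < \<theta>" using assms Q by (auto simp: \<theta>_def intro!: divide_pos_pos)
  define \<rho> where "\<rho> = 1 - \<theta> * (\<mu> - r) / 2"
  have "\<theta> * Q \<le> (\<mu> - r) / 2"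
  proof -
    have "\<theta> * Q \<le> (\<mu> - r) / (2 * (Q + 1)) * Q"
      using Q by (intro mult_right_mono) (auto simp: \<theta>_def)
    also have "\<dots> \<le> (\<mu> - r) / 2"
      using Q assms by (simp add: field_simps)
    finally show ?thesis .
  qed
  then have \<theta>Q: "\<theta> * (\<theta> * Q) \<le> \<theta> * ((\<mu> - r) / 2)"
    using \<theta> by (intro mult_left_mono) auto
  have int1: "integrable S (\<lambda>d. exp (\<theta> * (r - d 0)))"
  proof (rule integrable_bounded)
    fix d assume "d \<in> space S"
    then have "0 \<le> d 0" by (rule S_nonneg)
    then show "\<bar>exp (\<theta> * (r - d 0))\<bar> \<le> exp (\<theta> * r)" using \<theta> by simp
  qed measurable
  have int3: "integrable S (\<lambda>d. (r - d 0)\<^sup>2)"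
    by (rule integrable_coordinate[of "\<lambda>x. (r - x)\<^sup>2", THEN iffD2]) (simp, rule int2)
  have "(\<integral>d. exp (\<theta> * (r - d 0)) \<partial>S) \<le> (\<integral>d. 1 + \<theta> * (r - d 0) + \<theta>\<^sup>2 * (r - d 0)\<^sup>2 \<partial>S)"
  proof (rule integral_mono)
    fix d assume d: "d \<in> space S"
    have "\<theta> * (r - d 0) \<le> 1"
    proof (cases "0 \<le> r - d 0")
      case True
      have "\<theta> * (r - d 0) \<le> 1 / (\<bar>r\<bar> + 1) * (\<bar>r\<bar> + 1)"
        using True S_nonneg[OF d, of 0] by (intro mult_mono) (auto simp: \<theta>_def)
      then show ?thesis by (simp split: if_splits)
    next
      case False
      then have "\<theta> * (r - d 0) \<le> 0" using \<theta> by (simp add: mult_nonneg_nonpos)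
      then show ?thesis by simp
    qed
    from exp_le_quadratic[OF this]
    show "exp (\<theta> * (r - d 0)) \<le> 1 + \<theta> * (r - d 0) + \<theta>\<^sup>2 * (r - d 0)\<^sup>2"
      by (simp add: power_mult_distrib)
  qed (use int1 int3 in simp_all)
  also have "\<dots> = 1 + \<theta> * (r - \<mu>) + \<theta>\<^sup>2 * Q"
  proof -
    have "(\<integral>d. (r - d 0)\<^sup>2 \<partial>S) = Q"
      unfolding Q_def by (rule integral_coordinate) simp
    then show ?thesis using int3 by simp
  qed
  also have "\<dots> \<le> \<rho>"
  proof -
    have "\<rho> - (1 + \<theta> * (r - \<mu>) + \<theta>\<^sup>2 * Q) = \<theta> * ((\<mu> - r) / 2) - \<theta> * (\<theta> * Q)"
      by (simp add: \<rho>_def power2_eq_square field_simps)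
    with \<theta>Q show ?thesis by linarith
  qed
  finally have le: "(\<integral>d. exp (\<theta> * (r - d 0)) \<partial>S) \<le> \<rho>" .
  have "0 \<le> (\<integral>d. exp (\<theta> * (r - d 0)) \<partial>S)"
    by (rule Bochner_Integration.integral_nonneg) simp
  with le have "0 \<le> \<rho>" by linarith
  moreover have "\<rho> < 1" using \<theta> assms by (simp add: \<rho>_def)
  ultimately show thesis using that \<theta> le by blast
qed

text \<open>
  The increments of the random walk behind the constant order system are bounded above and have
  negative mean, so that the inventory level has exponential moments.
\<close>

lemma exponential_moments:
  assumes "r < \<mu>"
  shows "\<exists>\<theta> \<rho>. 0 < \<theta> \<and> 0 \<le> \<rho> \<and> \<rho> < 1 \<and>
    (\<forall>n. (\<integral>d. exp (\<theta> * const_inventory r 0 d n) \<partial>S) \<le> 1 / (1 - \<rho>)) \<and>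
    (\<forall>n. integrable S (\<lambda>d. exp (\<theta> * const_inventory r 0 d n))) \<and>
    (\<forall>j n. (\<integral>d. exp (\<theta> * (j + (\<Sum>i<n. r - d i))) \<partial>S) \<le> exp (\<theta> * j) * \<rho> ^ n) \<and>
    (\<forall>j n. integrable S (\<lambda>d. exp (\<theta> * (j + (\<Sum>i<n. r - d i)))))"
proof -
  obtain \<theta> \<rho> where \<theta>: "0 < \<theta>" and \<rho>: "0 \<le> \<rho>" "\<rho> < 1"
    and drift: "(\<integral>d. exp (\<theta> * (r - d 0)) \<partial>S) \<le> \<rho>"
    using exponential_drift[OF assms] by blast
  let ?g = "\<lambda>d. exp (\<theta> * (r - d 0))"
  have int1: "integrable S (\<lambda>d. exp (\<theta> * const_inventory r 0 d n))" for n
  proof (rule integrable_bounded)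
    fix d assume "d \<in> space S"
    then have "\<bar>const_inventory r 0 d n\<bar> \<le> \<bar>0\<bar> + real n * \<bar>r\<bar>"
      by (intro const_inventory_abs_le S_nonneg)
    then show "\<bar>exp (\<theta> * const_inventory r 0 d n)\<bar> \<le> exp (\<theta> * (real n * \<bar>r\<bar>))"
      using \<theta> by simp
  qed measurable
  have walk: "(\<Sum>i<n. r - d i) \<le> real n * \<bar>r\<bar>" if "d \<in> space S" for d n
  proof -
    have "(\<Sum>i<n. r - d i) \<le> (\<Sum>i<n. \<bar>r\<bar>)"
    proof (rule sum_mono)
      fix i show "r - d i \<le> \<bar>r\<bar>" using S_nonneg[OF that, of i] by simp
    qed
    then show ?thesis by simp
  qed
  have int2: "integrable S (\<lambda>d. exp (\<theta> * (j + (\<Sum>i<n. r - d i))))" for j n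
  proof (rule integrable_bounded)
    fix d assume "d \<in> space S"
    then show "\<bar>exp (\<theta> * (j + (\<Sum>i<n. r - d i)))\<bar> \<le> exp (\<theta> * (j + real n * \<bar>r\<bar>))"
      using \<theta> walk by simp
  qed measurable
  have int3: "integrable S (\<lambda>d. exp (\<theta> * const_inventory r 0 d n) * ?g (\<lambda>k. d (n + k)))" for n
  proof (rule integrable_bounded)
    fix d assume d: "d \<in> space S"
    then have "\<bar>const_inventory r 0 d n\<bar> \<le> \<bar>0\<bar> + real n * \<bar>r\<bar>"
      by (intro const_inventory_abs_le S_nonneg)
    with S_nonneg[OF d, of n] \<theta>
    have "exp (\<theta> * const_inventory r 0 d n) * exp (\<theta> * (r - d n))
        \<le> exp (\<theta> * (real n * \<bar>r\<bar>)) * exp (\<theta> * r)"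
      by (intro mult_mono) auto
    then show "\<bar>exp (\<theta> * const_inventory r 0 d n) * ?g (\<lambda>k. d (n + k))\<bar>
        \<le> exp (\<theta> * (real n * \<bar>r\<bar>)) * exp (\<theta> * r)"
      by (simp add: abs_mult)
  qed measurable
  \<comment> \<open>The bound is the fixed point of x = 1 + \<rho> * x. This recursion comes from
    \<open>exp (\<theta> * max y 0) \<le> 1 + exp (\<theta> * y)\<close> and the independence of
    level and next demand.\<close>
  have 1: "(\<integral>d. exp (\<theta> * const_inventory r 0 d n) \<partial>S) \<le> 1 / (1 - \<rho>)" for n
  proof (induction n)
    case 0
    then show ?case using \<rho> by (simp add: field_simps)
  next
    case (Suc n)
    have "(\<integral>d. exp (\<theta> * const_inventory r 0 d (Suc n)) \<partial>S)
      \<le> (\<integral>d. 1 + exp (\<theta> * const_inventory r 0 d n) * ?g (\<lambda>k. d (n + k)) \<partial>S)"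
    proof (rule integral_mono)
      fix d
      have "exp (\<theta> * max y 0) \<le> 1 + exp (\<theta> * y)" for y
        by (auto simp: max_def)
      from this[of "const_inventory r 0 d n + r - d n"]
      show "exp (\<theta> * const_inventory r 0 d (Suc n))
          \<le> 1 + exp (\<theta> * const_inventory r 0 d n) * ?g (\<lambda>k. d (n + k))"
        by (simp add: algebra_simps flip: exp_add)
    next
      show "integrable S (\<lambda>d. 1 + exp (\<theta> * const_inventory r 0 d n) * ?g (\<lambda>k. d (n + k)))"
        by (intro Bochner_Integration.integrable_add int3) simp
    qed (rule int1)
    also have "\<dots> = 1 + (\<integral>d. exp (\<theta> * const_inventory r 0 d n) * ?g (\<lambda>k. d (n + k)) \<partial>S)"
      by (subst Bochner_Integration.integral_add) (use int3 in simp_all)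
    also have "\<dots> = 1 + (\<integral>d. exp (\<theta> * const_inventory r 0 d n) \<partial>S) * (\<integral>d. ?g d \<partial>S)"
    proof -
      have "const_inventory r 0 d n = const_inventory r 0 d' n" if "\<And>i. i < n \<Longrightarrow> d i = d' i" for d d'
        unfolding const_inventory_def by (rule pipeline_inventory_cong) (use that in auto)
      then have "exp (\<theta> * const_inventory r 0 d n) = exp (\<theta> * const_inventory r 0 d' n)"
        if "\<And>i. i < n \<Longrightarrow> d i = d' i" for d d' using that by metis
      from integral_indep[OF int3 this] show ?thesis by simp
    qed
    also have "\<dots> \<le> 1 + 1 / (1 - \<rho>) * \<rho>"
      using Suc drift \<rho> by (intro add_left_mono mult_mono) (auto intro!: Bochner_Integration.integral_nonneg)
    also have "\<dots> = 1 / (1 - \<rho>)" using \<rho> by (simp add: field_simps)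
    finally show ?case .
  qed
  have 2: "(\<integral>d. exp (\<theta> * (j + (\<Sum>i<n. r - d i))) \<partial>S) \<le> exp (\<theta> * j) * \<rho> ^ n" for j n
  proof (induction n)
    case (Suc n)
    have eq: "exp (\<theta> * (j + (\<Sum>i<Suc n. r - d i)))
      = exp (\<theta> * (j + (\<Sum>i<n. r - d i))) * ?g (\<lambda>k. d (n + k))" for d
      by (simp add: algebra_simps flip: exp_add)
    have "integrable S (\<lambda>d. exp (\<theta> * (j + (\<Sum>i<n. r - d i))) * ?g (\<lambda>k. d (n + k)))"
      using int2[of j "Suc n"] unfolding eq .
    moreover have "exp (\<theta> * (j + (\<Sum>i<n. r - d i))) = exp (\<theta> * (j + (\<Sum>i<n. r - d' i)))"
      if "\<And>i. i < n \<Longrightarrow> d i = d' i" for d d' using that by simp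
    ultimately have "(\<integral>d. exp (\<theta> * (j + (\<Sum>i<Suc n. r - d i))) \<partial>S)
      = (\<integral>d. exp (\<theta> * (j + (\<Sum>i<n. r - d i))) \<partial>S) * (\<integral>d. ?g d \<partial>S)"
      unfolding eq by (rule integral_indep)
    also have "\<dots> \<le> (exp (\<theta> * j) * \<rho> ^ n) * \<rho>"
      using Suc drift \<rho> by (intro mult_mono) (auto intro!: Bochner_Integration.integral_nonneg)
    finally show ?case by (simp add: algebra_simps)
  qed simp
  show ?thesis
    by (rule exI[of _ \<theta>], rule exI[of _ \<rho>]) (intro conjI allI \<theta> \<rho> 1 int1 2 int2)
qed


text \<open>The initial stock enters only through the free walk in
  \<open>const_inventory_initial\<close>, and max a y is at most a + exp (\<theta> * y) / \<theta>
  for a nonnegative a. The exponential moment of the walk decays geometrically.\<close>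

lemma mean_inventory_initial:
  assumes "r < \<mu>"
  shows "\<exists>\<theta> \<rho>. 0 < \<theta> \<and> 0 \<le> \<rho> \<and> \<rho> < 1 \<and>
    (\<forall>j n. 0 \<le> j \<longrightarrow> mean_inventory r j n \<le> mean_inventory r 0 n + exp (\<theta> * j) * \<rho> ^ n / \<theta>)"
proof -
  obtain \<theta> \<rho> where \<theta>: "0 < \<theta>" and \<rho>: "0 \<le> \<rho>" "\<rho> < 1"
    and le: "\<forall>j n. (\<integral>d. exp (\<theta> * (j + (\<Sum>i<n. r - d i))) \<partial>S) \<le> exp (\<theta> * j) * \<rho> ^ n"
    and int: "\<forall>j n. integrable S (\<lambda>d. exp (\<theta> * (j + (\<Sum>i<n. r - d i))))"
    using exponential_moments[OF assms] by (elim exE conjE) (rule that)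
  note le = le[rule_format] and int = int[rule_format]
  have "mean_inventory r j n \<le> mean_inventory r 0 n + exp (\<theta> * j) * \<rho> ^ n / \<theta>" if j: "0 \<le> j" for j n
  proof -
    have "mean_inventory r j n
      \<le> (\<integral>d. const_inventory r 0 d n + exp (\<theta> * (j + (\<Sum>i<n. r - d i))) / \<theta> \<partial>S)"
      unfolding mean_inventory_def
    proof (rule integral_mono)
      fix d
      let ?y = "j + (\<Sum>i<n. r - d i)"
      have "\<theta> * ?y \<le> exp (\<theta> * ?y)" using exp_ge_add_one_self[of "\<theta> * ?y"] by linarith
      then have "?y \<le> exp (\<theta> * ?y) / \<theta>" using \<theta> by (simp add: field_simps)
      moreover have "0 \<le> exp (\<theta> * ?y) / \<theta>" using \<theta> by simp
      moreover have "0 \<le> const_inventory r 0 d n" by (rule const_inventory_nonneg) simp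
      ultimately show "const_inventory r j d n \<le> const_inventory r 0 d n + exp (\<theta> * ?y) / \<theta>"
        unfolding const_inventory_initial[OF j] by linarith
    next
      show "integrable S (\<lambda>d. const_inventory r 0 d n + exp (\<theta> * (j + (\<Sum>i<n. r - d i))) / \<theta>)"
        by (intro Bochner_Integration.integrable_add integrable_divide int integrable_const_inventory)
    qed (rule integrable_const_inventory)
    also have "\<dots> = mean_inventory r 0 n + (\<integral>d. exp (\<theta> * (j + (\<Sum>i<n. r - d i))) \<partial>S) / \<theta>"
      using int[of j n]
      by (subst Bochner_Integration.integral_add) (simp_all add: mean_inventory_def)
    also have "\<dots> \<le> mean_inventory r 0 n + exp (\<theta> * j) * \<rho> ^ n / \<theta>"
      using le[of j n] \<theta> by (intro add_left_mono divide_right_mono) auto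
    finally show ?thesis .
  qed
  with \<theta> \<rho> show ?thesis by (intro exI[of _ \<theta>] exI[of _ \<rho>]) simp
qed

lemma mean_inventory_bdd: "r < \<mu> \<Longrightarrow> bdd_above (range (mean_inventory r 0))"
proof -
  assume r: "r < \<mu>"
  obtain \<theta> \<rho> where \<theta>: "0 < \<theta>" "0 \<le> \<rho>" "\<rho> < 1"
    and le: "\<forall>n. (\<integral>d. exp (\<theta> * const_inventory r 0 d n) \<partial>S) \<le> 1 / (1 - \<rho>)"
    and int: "\<forall>n. integrable S (\<lambda>d. exp (\<theta> * const_inventory r 0 d n))"
    using exponential_moments[OF r] by (elim exE conjE) (rule that)
  note le = le[rule_format] and int = int[rule_format]
  have "mean_inventory r 0 n \<le> 1 / (1 - \<rho>) / \<theta>" for n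
  proof -
    have "mean_inventory r 0 n \<le> (\<integral>d. exp (\<theta> * const_inventory r 0 d n) / \<theta> \<partial>S)"
      unfolding mean_inventory_def
    proof (rule integral_mono)
      fix d
      have "\<theta> * const_inventory r 0 d n \<le> exp (\<theta> * const_inventory r 0 d n)"
        using exp_ge_add_one_self[of "\<theta> * const_inventory r 0 d n"] by linarith
      then show "const_inventory r 0 d n \<le> exp (\<theta> * const_inventory r 0 d n) / \<theta>"
        using \<theta> by (simp add: field_simps)
    qed (intro integrable_divide int integrable_const_inventory)+
    also have "\<dots> \<le> 1 / (1 - \<rho>) / \<theta>"
      using divide_right_mono[OF le[of n], of \<theta>] \<theta> by simp
    finally show ?thesis .
  qed
  then show ?thesis by (rule bdd_aboveI2)
qed

text \<open>The mean of the stationary level, taken as the monotone limit of the means from an empty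
  start so that no stationary distribution has to be constructed. It is meant for
  \<open>r < \<mu>\<close>, where the means are bounded.\<close>

definition limit_inventory :: "real \<Rightarrow> real" where
  "limit_inventory r = (SUP n. mean_inventory r 0 n)"

lemma mean_inventory_le_limit: "r < \<mu> \<Longrightarrow> mean_inventory r 0 n \<le> limit_inventory r"
  unfolding limit_inventory_def by (rule cSUP_upper[OF UNIV_I mean_inventory_bdd])

lemma mean_inventory_LIMSEQ:
  assumes "r < \<mu>"
  shows "mean_inventory r 0 \<longlonglongrightarrow> limit_inventory r"
  unfolding limit_inventory_def
  by (rule LIMSEQ_incseq_SUP[OF mean_inventory_bdd[OF assms] incseq_mean_inventory])

lemma mean_inventory_initial_LIMSEQ:
  assumes "r < \<mu>" "0 \<le> j"
  shows "mean_inventory r j \<longlonglongrightarrow> limit_inventory r"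
proof -
  obtain \<theta> \<rho> where \<theta>: "0 < \<theta>" and \<rho>: "0 \<le> \<rho>" "\<rho> < 1"
    and le: "\<forall>j n. 0 \<le> j \<longrightarrow> mean_inventory r j n \<le> mean_inventory r 0 n + exp (\<theta> * j) * \<rho> ^ n / \<theta>"
    using mean_inventory_initial[OF assms(1)] apply (elim exE conjE) subgoal for \<theta> \<rho> by (rule that[of \<theta> \<rho>]) done
  note le = le[rule_format]
  have "(\<lambda>n. mean_inventory r 0 n + exp (\<theta> * j) * \<rho> ^ n / \<theta>)
      \<longlonglongrightarrow> limit_inventory r + exp (\<theta> * j) * 0 / \<theta>"
    using \<rho> \<theta> by (intro tendsto_intros mean_inventory_LIMSEQ assms(1) LIMSEQ_power_zero) auto
  then have up: "(\<lambda>n. mean_inventory r 0 n + exp (\<theta> * j) * \<rho> ^ n / \<theta>) \<longlonglongrightarrow> limit_inventory r"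
    by simp
  show ?thesis
    by (rule tendsto_sandwich[OF _ _ mean_inventory_LIMSEQ[OF assms(1)] up])
      (use assms le mean_inventory_mono[of r r 0 j] in auto)
qed

lemma limit_inventory_nonneg: "r < \<mu> \<Longrightarrow> 0 \<le> limit_inventory r"
  using mean_inventory_le_limit[of r 0] mean_inventory_nonneg[of 0 r 0] by linarith

lemma limit_inventory_0: "limit_inventory 0 = 0"
  by (simp add: limit_inventory_def mean_inventory_0_0)

text \<open>Convexity passes to the limit of the means. On an open interval it yields continuity,
  without any uniformity of the convergence near \<mu>.\<close>

lemma convex_limit_inventory: "convex_on {..<\<mu>} limit_inventory"
proof (rule convex_onI)
  fix t r r' :: real
  assume t: "0 < t" "t < 1" and r: "r \<in> {..<\<mu>}" "r' \<in> {..<\<mu>}"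
  have mean: "mean_inventory ((1 - t) * r + t * r') 0 n
      \<le> (1 - t) * mean_inventory r 0 n + t * mean_inventory r' 0 n" for n
  proof -
    have "mean_inventory ((1 - t) * r + t * r') 0 n
        \<le> (\<integral>d. (1 - t) * const_inventory r 0 d n + t * const_inventory r' 0 d n \<partial>S)"
      unfolding mean_inventory_def
    proof (rule integral_mono)
      show "const_inventory ((1 - t) * r + t * r') 0 d n
          \<le> (1 - t) * const_inventory r 0 d n + t * const_inventory r' 0 d n" for d
        using t by (intro const_inventory_convex) auto
    qed simp_all
    then show ?thesis by (simp add: mean_inventory_def)
  qed
  have "(1 - t) * r + t * r' < \<mu>"
    using convexD[OF convex_real_interval(4)[of \<mu>] r, of "1 - t" t] t by simp
  then show "limit_inventory ((1 - t) *\<^sub>R r + t *\<^sub>R r')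
      \<le> (1 - t) * limit_inventory r + t * limit_inventory r'"
    unfolding real_scaleR_def
  proof (rule LIMSEQ_le[OF mean_inventory_LIMSEQ])
    show "(\<lambda>n. (1 - t) * mean_inventory r 0 n + t * mean_inventory r' 0 n)
        \<longlonglongrightarrow> (1 - t) * limit_inventory r + t * limit_inventory r'"
      using r by (intro tendsto_intros mean_inventory_LIMSEQ) auto
  qed (use mean in blast)
qed (rule convex_real_interval)

section \<open>Divergence of the mean level at the critical rate\<close>

lemma indep_vars_coordinates: "P.indep_vars (\<lambda>_. borel) (\<lambda>k d. d k - \<mu>) UNIV"
proof -
  have "P.indep_vars (\<lambda>_. F) (\<lambda>k d. d k) UNIV"
  proof (subst P.indep_vars_iff_distr_eq_PiM)
    show "distr S S (\<lambda>x. \<lambda>i\<in>UNIV. x i) = Pi\<^sub>M UNIV (\<lambda>i. distr S F (\<lambda>d. d i))"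
      unfolding distr_coordinate restrict_UNIV by (rule distr_id)
  qed (simp, rule measurable_component_singleton, simp)
  then show ?thesis
    by (rule P.indep_vars_compose2) (rule borel_measurable_diff[OF measurable_F borel_measurable_const])
qed

text \<open>
  At the critical rate the inventory level dominates the positive part of a centred random walk,
  whose mean grows like the square root of the time by the central limit theorem.
\<close>

lemma mean_inventory_unbounded: "\<exists>n. C < mean_inventory \<mu> 0 n"
proof (rule ccontr)
  assume "\<not> ?thesis"
  then have le: "mean_inventory \<mu> 0 n \<le> C" for n by (simp add: not_less)
  define W where "W n d = (\<Sum>i<n. d i - \<mu>)" for n and d :: "nat \<Rightarrow> real"
  have [measurable]: "W n \<in> borel_measurable S" for n
    unfolding W_def by measurable
  have intW: "integrable S (W n)" for n
    unfolding W_def by simp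
  \<comment> \<open>The level dominates the negative part of \<open>W n\<close>, and |x| is x plus
    twice its negative part. As \<open>W n\<close> is centred, bounded mean levels would bound its
    first absolute moments.\<close>
  have absW: "(\<integral>d. \<bar>W n d\<bar> \<partial>S) \<le> 2 * C" for n
  proof -
    have "(\<integral>d. \<bar>W n d\<bar> \<partial>S) \<le> (\<integral>d. 2 * const_inventory \<mu> 0 d n + W n d \<partial>S)"
    proof (rule integral_mono)
      fix d
      have "0 + (\<Sum>i<n. \<mu> - d i) \<le> const_inventory \<mu> 0 d n" "0 \<le> const_inventory \<mu> 0 d n"
        by (rule const_inventory_lower) (simp add: const_inventory_nonneg)
      moreover have "(\<Sum>i<n. \<mu> - d i) = - W n d"
        by (simp add: W_def flip: sum_negf)
      ultimately show "\<bar>W n d\<bar> \<le> 2 * const_inventory \<mu> 0 d n + W n d" by linarith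
    qed (use intW in auto)
    also have "\<dots> = 2 * mean_inventory \<mu> 0 n + (\<integral>d. W n d \<partial>S)"
      using intW by (simp add: mean_inventory_def)
    also have "(\<integral>d. W n d \<partial>S) = 0" by (simp add: W_def)
    finally show ?thesis using le[of n] by simp
  qed
  define \<sigma> where "\<sigma> = sqrt (\<integral>x. (x - \<mu>)\<^sup>2 \<partial>F)"
  have \<sigma>: "0 < \<sigma>" "\<sigma>\<^sup>2 = (\<integral>x. (x - \<mu>)\<^sup>2 \<partial>F)"
    using variance_pos by (simp_all add: \<sigma>_def)
  have int2: "integrable F (\<lambda>x. (x - \<mu>)\<^sup>2)"
  proof -
    have "(\<lambda>x. (x - \<mu>)\<^sup>2) = (\<lambda>x. \<mu>\<^sup>2 - 2 * \<mu> * x + x\<^sup>2)"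
      by (auto simp: power2_diff)
    then show ?thesis using integrable_F integrable_F_sq by simp
  qed
  have mean0: "(\<integral>d. d k - \<mu> \<partial>S) = 0" for k by simp
  have clt: "weak_conv_m (\<lambda>n. distr S borel (\<lambda>d. (\<Sum>i<n. d i - \<mu>) / sqrt (n * \<sigma>\<^sup>2))) std_normal_distribution"
  proof (rule P.central_limit_theorem_zero_mean[OF indep_vars_coordinates mean0 \<sigma>(1)])
    fix k
    show "integrable S (\<lambda>d. (d k - \<mu>)\<^sup>2)"
      by (rule integrable_coordinate[of "\<lambda>x. (x - \<mu>)\<^sup>2", THEN iffD2]) (simp, rule int2)
    show "P.variance (\<lambda>d. d k - \<mu>) = \<sigma>\<^sup>2"
      unfolding mean0 \<sigma>(2) diff_zero by (rule integral_coordinate) simp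
    have m: "(\<lambda>d. d k) \<in> measurable S F"
      by (rule measurable_component_singleton) simp
    have "(\<lambda>x. x - \<mu>) \<in> borel_measurable F"
      by (rule borel_measurable_diff[OF measurable_F borel_measurable_const])
    from distr_distr[OF this m]
    show "distr S borel (\<lambda>d. d k - \<mu>) = distr F borel (\<lambda>x. x - \<mu>)"
      unfolding distr_coordinate comp_def ..
  qed
  define Z where "Z n = distr S borel (\<lambda>d. W n d / sqrt (n * \<sigma>\<^sup>2))" for n
  have "weak_conv_m Z std_normal_distribution"
    using clt unfolding Z_def[abs_def] W_def .
  then have lim: "(\<lambda>n. char (Z n) 1) \<longlonglongrightarrow> char std_normal_distribution 1"
  proof (rule levy_continuity1[rotated 2])
    show "real_distribution (Z n)" for n
      unfolding Z_def by (rule P.real_distribution_distr) measurable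
  qed (rule real_dist_normal_dist)
  \<comment> \<open>A single value of the characteristic function suffices. Since |exp (i y) - 1| is
    at most |y|, bounded absolute moments of \<open>W n\<close> force convergence to 1, while the
    normal law has the value exp (-1/2).\<close>
  have bnd: "cmod (char (Z n) 1 - 1) \<le> 2 * C / (\<sigma> * sqrt n)" if "0 < n" for n
  proof -
    let ?Y = "\<lambda>d. W n d / sqrt (n * \<sigma>\<^sup>2)"
    have sq: "sqrt (n * \<sigma>\<^sup>2) = \<sigma> * sqrt n" using \<sigma>(1) by (simp add: real_sqrt_mult)
    have i: "complex_integrable S (\<lambda>d. iexp (?Y d))"
      by (rule P.integrable_const_bound[of _ 1]) auto
    have "char (Z n) 1 = (CLINT d|S. iexp (?Y d))"
      unfolding char_def Z_def by (subst integral_distr) auto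
    then have "char (Z n) 1 - 1 = (CLINT d|S. iexp (?Y d) - 1)"
      using i by (simp add: P.prob_space)
    also have "cmod \<dots> \<le> (\<integral>d. \<bar>?Y d\<bar> \<partial>S)"
    proof (rule order_trans[OF integral_norm_bound integral_mono])
      show "cmod (iexp (?Y d) - 1) \<le> \<bar>?Y d\<bar>" for d
        using iexp_approx1[of "?Y d" 0] by simp
    qed (use i intW in auto)
    also have "\<dots> = (\<integral>d. \<bar>W n d\<bar> \<partial>S) / (\<sigma> * sqrt n)"
      using \<sigma>(1) by (simp add: sq abs_mult)
    also have "\<dots> \<le> 2 * C / (\<sigma> * sqrt n)"
      using absW \<sigma>(1) by (intro divide_right_mono) auto
    finally show ?thesis .
  qed
  have "(\<lambda>n. char (Z n) 1 - 1) \<longlonglongrightarrow> 0"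
  proof (rule Lim_null_comparison)
    show "\<forall>\<^sub>F n in sequentially. cmod (char (Z n) 1 - 1) \<le> 2 * C / (\<sigma> * sqrt n)"
      using bnd by (intro eventually_sequentiallyI[of 1]) simp
    have "filterlim (\<lambda>n. \<sigma> * sqrt (real n)) at_top sequentially"
      by (intro filterlim_tendsto_pos_mult_at_top[OF tendsto_const \<sigma>(1)]
          filterlim_compose[OF sqrt_at_top filterlim_real_sequentially])
    then show "(\<lambda>n. 2 * C / (\<sigma> * sqrt (real n))) \<longlonglongrightarrow> 0"
      by (rule real_tendsto_divide_at_top[OF tendsto_const])
  qed
  then have "(\<lambda>n. char (Z n) 1) \<longlonglongrightarrow> 1"
    by (rule LIM_zero_cancel)
  from LIMSEQ_unique[OF lim this] have "exp (- (1\<^sup>2) / 2) = (1::real)"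
    unfolding char_std_normal_distribution of_real_eq_1_iff .
  then show False by simp
qed

text \<open>Intermediate values: the sum is 0 at \<open>r = 0\<close>, continuous, and exceeds any
  level near \<mu>. This turns every PIL level into one given by a constant order.\<close>

lemma limit_inventory_onto:
  assumes "0 \<le> \<xi>"
  obtains r where "0 \<le> r" "r < \<mu>" "r + limit_inventory r = \<xi>"
proof -
  obtain n where n: "\<xi> + 1 < mean_inventory \<mu> 0 n" using mean_inventory_unbounded by blast
  \<comment> \<open>So close to \<mu> that the Lipschitz bound with constant \<open>n\<close> loses
    at most 1, which is the surplus in the choice of \<open>n\<close>.\<close>
  define r1 where "r1 = max 0 (\<mu> - 1 / (real n + 1))"
  have r1: "0 \<le> r1" "r1 < \<mu>" using mean_pos by (auto simp: r1_def)
  have "real n * (\<mu> - r1) \<le> real n * (1 / (real n + 1))"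
    by (intro mult_left_mono) (auto simp: r1_def)
  also have "\<dots> \<le> 1" by (simp add: field_simps)
  finally have "\<xi> \<le> mean_inventory r1 0 n"
    using mean_inventory_Lipschitz[of r1 \<mu> 0 n] n r1 by linarith
  then have up: "\<xi> \<le> r1 + limit_inventory r1"
    using mean_inventory_le_limit[OF r1(2), of n] r1 by linarith
  have "continuous_on {..<\<mu>} limit_inventory"
    by (rule convex_on_continuous) (auto intro: convex_limit_inventory)
  then have "continuous_on {0..r1} (\<lambda>r. r + limit_inventory r)"
    using r1 by (intro continuous_intros) (auto elim: continuous_on_subset)
  with IVT'[of "\<lambda>r. r + limit_inventory r" 0 \<xi> r1] up assms r1 obtain r
    where "0 \<le> r" "r \<le> r1" "r + limit_inventory r = \<xi>"
    by (auto simp: limit_inventory_0)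
  with r1 that show thesis by simp
qed

end

section \<open>Processes under a policy\<close>

text \<open>The errors need not be small one by one: the potential \<open>w\<close> telescopes, and
  what remains of it together with the errors before \<open>t0\<close> is a constant, which the
  growing number of periods makes at most \<epsilon> per period. This is the second \<epsilon> in
  the conclusion.\<close>

lemma cesaro_eventually_near:
  fixes c w :: "nat \<Rightarrow> real"
  assumes c: "\<And>t. t0 \<le> t \<Longrightarrow> \<bar>c t - \<phi>\<bar> \<le> w t - w (Suc t) + \<epsilon>"
    and w: "\<And>t. 0 \<le> w t" and \<epsilon>: "0 < \<epsilon>"
  shows "\<forall>\<^sub>F T in sequentially. \<bar>(\<Sum>t=L..T. c t) / (real T - real L + 1) - \<phi>\<bar> \<le> 2 * \<epsilon>"
proof -
  define s where "s = max t0 L"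
  define K where "K = (\<Sum>t=L..<s. \<bar>c t - \<phi>\<bar>) + w s"
  have sum: "(\<Sum>t=L..<s + n. \<bar>c t - \<phi>\<bar>) \<le> K - w (s + n) + real n * \<epsilon>" for n
  proof (induction n)
    case (Suc n)
    have "\<bar>c (s + n) - \<phi>\<bar> \<le> w (s + n) - w (Suc (s + n)) + \<epsilon>"
      by (rule c) (simp add: s_def)
    moreover have "L \<le> s + n" by (simp add: s_def)
    ultimately show ?case using Suc by (simp add: algebra_simps)
  qed (simp add: K_def)
  obtain m :: nat where m: "K / \<epsilon> < real m" using reals_Archimedean2 by blast
  have "\<bar>(\<Sum>t=L..T. c t) / (real T - real L + 1) - \<phi>\<bar> \<le> 2 * \<epsilon>" if T: "s + L + m \<le> T" for T
  proof -
    define n where "n = Suc T - s"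
    define N where "N = real T - real L + 1"
    have sn: "s + n = Suc T" and nN: "real n \<le> N" and mN: "real m \<le> N" and N: "0 < N"
      using T by (auto simp: n_def N_def s_def)
    have NL: "real (card {L..T}) = N" using T by (simp add: N_def)
    have "\<bar>(\<Sum>t=L..T. c t) - N * \<phi>\<bar> = \<bar>\<Sum>t=L..T. c t - \<phi>\<bar>"
      unfolding NL[symmetric] by (simp add: sum_subtractf)
    also have "\<dots> \<le> (\<Sum>t=L..<s + n. \<bar>c t - \<phi>\<bar>)"
      unfolding sn atLeastLessThanSuc_atLeastAtMost by (rule sum_abs)
    also have "\<dots> \<le> K + real n * \<epsilon>" using sum[of n] w[of "s + n"] by linarith
    also have "\<dots> \<le> N * \<epsilon> + N * \<epsilon>"
    proof (rule add_mono)
      have "K \<le> real m * \<epsilon>" using m \<epsilon> by (simp add: field_simps)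
      also have "\<dots> \<le> N * \<epsilon>" using mN \<epsilon> by simp
      finally show "K \<le> N * \<epsilon>" .
      show "real n * \<epsilon> \<le> N * \<epsilon>" using nN \<epsilon> by simp
    qed
    finally have "\<bar>(\<Sum>t=L..T. c t) - N * \<phi>\<bar> / N \<le> 2 * \<epsilon>" using N by (simp add: field_simps)
    moreover have "(\<Sum>t=L..T. c t) / N - \<phi> = ((\<Sum>t=L..T. c t) - N * \<phi>) / N"
      using N by (simp add: field_simps)
    then have "\<bar>(\<Sum>t=L..T. c t) / N - \<phi>\<bar> = \<bar>(\<Sum>t=L..T. c t) - N * \<phi>\<bar> / N"
      using N by simp
    ultimately show ?thesis by (simp add: N_def)
  qed
  then show ?thesis by (rule eventually_sequentiallyI)
qed

lemma ereal_eq_if_near: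
  fixes x :: ereal
  assumes "\<And>\<epsilon>. 0 < \<epsilon> \<Longrightarrow> ereal (\<phi> - \<epsilon>) \<le> x \<and> x \<le> ereal (\<phi> + \<epsilon>)"
  shows "x = ereal \<phi>"
proof (rule antisym)
  show "x \<le> ereal \<phi>"
  proof (rule ereal_le_epsilon2)
    fix e :: real assume "0 < e"
    then show "x \<le> ereal \<phi> + ereal e" using assms[of e] by simp
  qed
  show "ereal \<phi> \<le> x"
  proof (rule ereal_le_epsilon2)
    fix e :: real assume "0 < e"
    then have "ereal (\<phi> - e) \<le> x" using assms[of e] by simp
    then have "ereal (\<phi> - e) + ereal e \<le> x + ereal e" by (rule add_right_mono)
    then show "ereal \<phi> \<le> x + ereal e" by simp
  qed
qed

lemma LIMSEQ_ereal_if_near: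
  fixes x :: "nat \<Rightarrow> ereal"
  assumes "\<And>\<epsilon>. 0 < \<epsilon> \<Longrightarrow> \<forall>\<^sub>F n in sequentially. ereal (\<phi> - \<epsilon>) \<le> x n \<and> x n \<le> ereal (\<phi> + \<epsilon>)"
  shows "x \<longlonglongrightarrow> ereal \<phi>"
proof (rule order_tendstoI)
  fix a assume "a < ereal \<phi>"
  then obtain y where y: "a < ereal y" "ereal y < ereal \<phi>" using ereal_dense2 by blast
  then have "0 < \<phi> - y" by simp
  from assms[OF this] show "\<forall>\<^sub>F n in sequentially. a < x n"
    by eventually_elim (use y in \<open>auto intro: less_le_trans\<close>)
next
  fix a assume "ereal \<phi> < a"
  then obtain y where y: "ereal \<phi> < ereal y" "ereal y < a" using ereal_dense2 by blast
  then have "0 < y - \<phi>" by simp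
  from assms[OF this] show "\<forall>\<^sub>F n in sequentially. x n < a"
    by eventually_elim (use y in \<open>auto intro: le_less_trans\<close>)
qed

lemma state_space_nonneg: "x \<in> space (state_space L) \<Longrightarrow> i \<le> L \<Longrightarrow> 0 \<le> x i"
  by (auto simp: state_space_def space_PiM space_restrict_space PiE_iff)

lemma measurable_state_space_component:
  "i \<le> L \<Longrightarrow> (\<lambda>x. x i) \<in> borel_measurable (state_space L)"
proof -
  assume "i \<le> L"
  then have "(\<lambda>x. x i) \<in> measurable (state_space L) (restrict_space borel {0..})"
    unfolding state_space_def by (intro measurable_component_singleton) simp
  then show ?thesis by (simp add: measurable_restrict_space2_iff)
qed

section \<open>Measurability and integrability of the processes\<close>

locale policy_process = demand_process +
  fixes L :: nat and \<pi> :: policy and x0 :: "nat \<Rightarrow> real"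
  assumes policy: "\<pi> \<in> policies L"
    and initial: "x0 \<in> space (state_space L)"
begin

abbreviation "X d t \<equiv> state L \<pi> x0 d t"
abbreviation "J d t \<equiv> inventory L \<pi> x0 d t"
abbreviation "q d t \<equiv> received_order L \<pi> x0 d t"

lemma policy_measurable: "\<pi> t \<in> borel_measurable (state_space L)"
  and policy_nonneg: "x \<in> space (state_space L) \<Longrightarrow> 0 \<le> \<pi> t x"
  using policy by (auto simp: policies_def measurable_restrict_space2_iff)

lemma measurable_state: "(\<lambda>d. X d t) \<in> measurable S (state_space L)"
proof (induction t)
  case 0
  then show ?case using initial by simp
next
  case (Suc t)
  define y where "y d = place_order L (X d t) (\<pi> t (X d t))" for d
  have nonneg: "0 \<le> y d i" if "d \<in> space S" "i \<le> Suc L" for d i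
    using measurable_space[OF Suc that(1)] that(2) state_space_nonneg[of "X d t" L i]
      policy_nonneg[of "X d t" t]
    by (auto simp: y_def place_order_def le_Suc_eq)
  have y: "(\<lambda>d. y d i) \<in> borel_measurable S" if "i \<le> Suc L" for i
  proof (cases "i = Suc L")
    case True
    then show ?thesis
      using measurable_compose[OF Suc policy_measurable[of t]] by (simp add: y_def place_order_def)
  next
    case False
    with that have "i \<le> L" by simp
    from measurable_compose[OF Suc measurable_state_space_component[OF this]] False
    show ?thesis by (simp add: y_def place_order_def)
  qed
  have [measurable]: "(\<lambda>d. y d 0) \<in> borel_measurable S" "(\<lambda>d. y d 1) \<in> borel_measurable S"
    by (rule y, simp)+
  have "(\<lambda>d. \<lambda>i\<in>{..L}. if i = 0 then max (y d 0 + y d 1 - d t) 0 else y d (Suc i))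
      \<in> measurable S (state_space L)"
    unfolding state_space_def
  proof (rule measurable_restrict)
    fix i assume i: "i \<in> {..L}"
    show "(\<lambda>d. if i = 0 then max (y d 0 + y d 1 - d t) 0 else y d (Suc i))
        \<in> measurable S (restrict_space borel {0..})"
      using i nonneg y[of "Suc i"] by (intro measurable_restrict_space2) auto
  qed
  then show ?case
    unfolding state.simps next_state_def Let_def y_def .
qed

lemma state_in_space: "d \<in> space S \<Longrightarrow> X d t \<in> space (state_space L)"
  by (rule measurable_space[OF measurable_state])

lemma measurable_inventory [measurable (raw)]: "(\<lambda>d. J d t) \<in> borel_measurable S"
  unfolding inventory_def
  by (rule measurable_compose[OF measurable_state measurable_state_space_component]) simp

lemma inventory_nonneg: "d \<in> space S \<Longrightarrow> 0 \<le> J d t"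
  unfolding inventory_def by (rule state_space_nonneg[OF state_in_space]) auto

lemma measurable_received_order [measurable (raw)]: "(\<lambda>d. q d t) \<in> borel_measurable S"
proof (cases L)
  case 0
  then show ?thesis
    using measurable_compose[OF measurable_state policy_measurable]
    by (simp add: received_order_def place_order_def)
next
  case (Suc l)
  then show ?thesis
    using measurable_compose[OF measurable_state measurable_state_space_component, of 1 t]
    by (simp add: received_order_def place_order_def)
qed

lemma received_order_nonneg: "d \<in> space S \<Longrightarrow> 0 \<le> q d t"
proof (cases L)
  case 0
  then show "d \<in> space S \<Longrightarrow> 0 \<le> q d t"
    using policy_nonneg[OF state_in_space]
    by (simp add: received_order_def place_order_def)
next
  case (Suc l)
  then show "d \<in> space S \<Longrightarrow> 0 \<le> q d t"
    using state_space_nonneg[OF state_in_space, of d 1 t]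
    by (simp add: received_order_def place_order_def)
qed

text \<open>The state in period \<open>s\<close> is decided by the past \<open>d\<close>, the
  following \<open>L\<close> demands come from \<open>d'\<close>. Integrating over \<open>d'\<close>
  therefore gives the projected level.\<close>

lemma inventory_split:
  "J (comb_seq s d d') (s + L) = pipeline_inventory (X d s) d' L"
proof -
  have "X (comb_seq s d d') s = X d s"
    by (rule state_cong) (simp add: comb_seq_def)
  then show ?thesis by (simp add: inventory_eq_pipeline_inventory)
qed

lemma inventory_initial_bound:
  assumes "d \<in> space S"
  shows "J d L \<le> (\<Sum>i\<le>L. x0 i)"
  using inventory_eq_pipeline_inventory[of L \<pi> x0 d 0]
    pipeline_inventory_upper[of L x0 d] state_space_nonneg[OF initial] S_nonneg[OF assms]
  by simp

end

text \<open>Bounded orders make levels bounded in each period and all costs integrable. Constant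
  order and PIL policies are of this kind; an arbitrary policy is not, and its costs may have
  infinite mean.\<close>

locale bounded_policy_process = policy_process +
  fixes b :: real
  assumes policy_bounded: "x \<in> space (state_space L) \<Longrightarrow> \<pi> t x \<le> b"
begin

lemma state_bounded: "\<exists>c. \<forall>d\<in>space S. \<forall>i\<le>L. X d t i \<le> c"
proof (induction t)
  case 0
  show ?case by (intro exI[of _ "Max (x0 ` {..L})"]) auto
next
  case (Suc t)
  then obtain c where c: "\<And>d i. d \<in> space S \<Longrightarrow> i \<le> L \<Longrightarrow> X d t i \<le> c" by blast
  define c' where "c' = max 0 (max b c)"
  have "X d (Suc t) i \<le> 2 * c'" if d: "d \<in> space S" and i: "i \<le> L" for d i
  proof -
    define y where "y = place_order L (X d t) (\<pi> t (X d t))"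
    have y: "y i \<le> c'" if "i \<le> Suc L" for i
      using that c[OF d, of i] policy_bounded[OF state_in_space[OF d], of t t]
      by (auto simp: y_def place_order_def c'_def le_Suc_eq)
    have "X d (Suc t) i = (if i = 0 then max (y 0 + y 1 - d t) 0 else y (Suc i))"
      using i by (simp add: next_state_def y_def Let_def)
    moreover have "0 \<le> c'" by (simp add: c'_def)
    ultimately show ?thesis
      using y[of 0] y[of 1] y[of "Suc i"] i S_nonneg[OF d, of t] by auto
  qed
  then show ?case by blast
qed

lemma echelon_bounded: "\<exists>c. \<forall>d\<in>space S. J d t \<le> c \<and> q d t \<le> c"
proof -
  obtain c where c: "\<And>d i. d \<in> space S \<Longrightarrow> i \<le> L \<Longrightarrow> X d t i \<le> c" using state_bounded by blast
  have "q d t \<le> max b c" if d: "d \<in> space S" for d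
    using c[OF d, of 1] policy_bounded[OF state_in_space[OF d], of t t]
    by (auto simp: received_order_def place_order_def)
  moreover have "J d t \<le> max b c" if d: "d \<in> space S" for d
    using c[OF d, of 0] by (simp add: inventory_def)
  ultimately show ?thesis by blast
qed

lemma integrable_inventory [simp]: "integrable S (\<lambda>d. J d t)"
proof -
  obtain c where "\<And>d. d \<in> space S \<Longrightarrow> J d t \<le> c" using echelon_bounded by blast
  then show ?thesis
    using inventory_nonneg by (intro integrable_bounded[of _ c] measurable_inventory) auto
qed

lemma integrable_received_order [simp]: "integrable S (\<lambda>d. q d t)"
proof -
  obtain c where "\<And>d. d \<in> space S \<Longrightarrow> q d t \<le> c" using echelon_bounded by blast
  then show ?thesis
    using received_order_nonneg by (intro integrable_bounded[of _ c] measurable_received_order) auto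
qed

definition mean_cost :: "real \<Rightarrow> real \<Rightarrow> nat \<Rightarrow> real" where
  "mean_cost h p t = (\<integral>d. period_cost h p L \<pi> x0 d t \<partial>S)"

lemma integrable_period_cost [simp]: "integrable S (\<lambda>d. period_cost h p L \<pi> x0 d t)"
  unfolding period_cost_eq by simp

lemma mean_cost_eq:
  "mean_cost h p t = h * (\<integral>d. J d (Suc t) \<partial>S)
     + p * (\<mu> - ((\<integral>d. J d t \<partial>S) + (\<integral>d. q d t \<partial>S)) + (\<integral>d. J d (Suc t) \<partial>S))"
  unfolding mean_cost_def period_cost_eq by simp

lemma cost_rate_near:
  assumes "0 \<le> h" "0 \<le> p"
    and near: "\<forall>\<^sub>F T in sequentially.
      \<bar>(\<Sum>t=L..T. mean_cost h p t) / (real T - real L + 1) - \<phi>\<bar> \<le> \<epsilon>"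
  shows "ereal (\<phi> - \<epsilon>) \<le> cost_rate S (\<lambda>k d. d k) h x0 p L \<pi> \<and>
    cost_rate S (\<lambda>k d. d k) h x0 p L \<pi> \<le> ereal (\<phi> + \<epsilon>)"
proof -
  let ?u = "\<lambda>T. enn2ereal (\<integral>\<^sup>+ d. ennreal
      ((\<Sum>t=L..T. period_cost h p L \<pi> x0 (\<lambda>s. d s) t) / (real T - real L + 1)) \<partial>S)"
  have nonneg: "0 \<le> period_cost h p L \<pi> x0 d t" for d t
    using assms(1,2) by (simp add: period_cost_def Let_def)
  have eq: "?u T = ereal ((\<Sum>t=L..T. mean_cost h p t) / (real T - real L + 1))" if "L \<le> T" for T
  proof -
    have pos: "0 < real T - real L + 1" using that by simp
    have "(\<integral>\<^sup>+ d. ennreal ((\<Sum>t=L..T. period_cost h p L \<pi> x0 (\<lambda>s. d s) t) / (real T - real L + 1)) \<partial>S)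
      = ennreal (\<integral> d. ((\<Sum>t=L..T. period_cost h p L \<pi> x0 (\<lambda>s. d s) t) / (real T - real L + 1)) \<partial>S)"
      using pos nonneg by (intro nn_integral_eq_integral AE_I2 divide_nonneg_pos sum_nonneg) auto
    also have "\<dots> = ennreal ((\<Sum>t=L..T. mean_cost h p t) / (real T - real L + 1))"
      by (simp add: mean_cost_def)
    also have "enn2ereal \<dots> = ereal ((\<Sum>t=L..T. mean_cost h p t) / (real T - real L + 1))"
      using pos nonneg
      by (intro enn2ereal_ennreal divide_nonneg_pos sum_nonneg)
        (auto simp: mean_cost_def intro!: Bochner_Integration.integral_nonneg)
    finally show ?thesis .
  qed
  have ev: "\<forall>\<^sub>F T in sequentially. ereal (\<phi> - \<epsilon>) \<le> ?u T \<and> ?u T \<le> ereal (\<phi> + \<epsilon>)"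
    using near eventually_ge_at_top[of L]
    by eventually_elim (auto simp: eq abs_le_iff)
  have "ereal (\<phi> - \<epsilon>) \<le> liminf ?u"
    by (rule Liminf_bounded) (use ev in \<open>auto elim: eventually_mono\<close>)
  also have "\<dots> \<le> limsup ?u" by (rule Liminf_le_Limsup) simp
  finally have "ereal (\<phi> - \<epsilon>) \<le> limsup ?u" .
  moreover have "limsup ?u \<le> ereal (\<phi> + \<epsilon>)"
    by (rule Limsup_bounded) (use ev in \<open>auto elim: eventually_mono\<close>)
  ultimately show ?thesis unfolding cost_rate_def by (rule conjI)
qed

end

section \<open>The cost-rate of constant order policies\<close>

context demand_process
begin

lemma const_policy_process:
  assumes "0 \<le> r" "x0 \<in> space (state_space L)"
  shows "bounded_policy_process F \<mu> L (const_policy r) x0 r"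
proof -
  have "const_policy r \<in> policies L"
    using assms(1) by (auto simp: policies_def const_policy_def[abs_def] measurable_restrict_space2_iff)
  then show ?thesis
    using assms by unfold_locales (auto simp: const_policy_def)
qed

text \<open>The orders of the initial pipeline arrive before period \<open>L\<close>. Afterwards
  every delivery is \<open>r\<close>, so the initial state survives only in the level of period
  \<open>L\<close>.\<close>

lemma const_policy_inventory:
  "inventory L (const_policy r) x0 d (L + n)
    = const_inventory r (inventory L (const_policy r) x0 d L) (\<lambda>k. d (L + k)) n"
proof (induction n)
  case (Suc n)
  have "received_order L (const_policy r) x0 d (L + n) = r"
    using received_order_add[of L "const_policy r" x0 d n]
    by (simp add: const_policy_def add.commute)
  with Suc show ?case by (simp add: inventory_Suc)
qed simp

text \<open>The level of period \<open>L\<close> lies between 0 and the total initial stock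
  \<open>c\<close>, and the mean levels from both starting points have the same limit.\<close>

lemma const_policy_mean_inventory_LIMSEQ:
  assumes r: "0 \<le> r" "r < \<mu>" and x0: "x0 \<in> space (state_space L)"
  shows "(\<lambda>t. \<integral>d. inventory L (const_policy r) x0 d t \<partial>S) \<longlonglongrightarrow> limit_inventory r"
proof -
  interpret bounded_policy_process F \<mu> L "const_policy r" x0 r
    by (rule const_policy_process[OF r(1) x0])
  define c where "c = (\<Sum>i\<le>L. x0 i)"
  have c: "0 \<le> c" unfolding c_def by (rule sum_nonneg) (simp add: state_space_nonneg[OF x0])
  have low: "mean_inventory r 0 n \<le> (\<integral>d. J d (L + n) \<partial>S)" for n
    unfolding mean_inventory_shift[of r 0 L n, symmetric] const_policy_inventory
    by (intro integral_mono const_inventory_mono integrable_const_inventory_shift)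
      (simp_all add: inventory_nonneg flip: const_policy_inventory)
  have up: "(\<integral>d. J d (L + n) \<partial>S) \<le> mean_inventory r c n" for n
    unfolding mean_inventory_shift[of r c L n, symmetric] const_policy_inventory
    by (intro integral_mono const_inventory_mono integrable_const_inventory_shift)
      (simp_all add: inventory_initial_bound c_def flip: const_policy_inventory)
  have "(\<lambda>n. \<integral>d. J d (L + n) \<partial>S) \<longlonglongrightarrow> limit_inventory r"
    by (rule tendsto_sandwich[OF _ _ mean_inventory_LIMSEQ[OF r(2)] mean_inventory_initial_LIMSEQ[OF r(2) c]])
      (use low up in auto)
  then show ?thesis by (subst LIMSEQ_offset[of _ L]) (simp_all add: add.commute)
qed

text \<open>In the long run mean sales equal the mean supply \<open>r\<close>, which leaves
  \<open>\<mu> - r\<close> as mean lost sales.\<close>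

definition limit_cost :: "real \<Rightarrow> real \<Rightarrow> real \<Rightarrow> real" where
  "limit_cost h p r = h * limit_inventory r + p * (\<mu> - r)"

lemma cost_rate_const_policy:
  assumes r: "0 \<le> r" "r < \<mu>" and x0: "x0 \<in> space (state_space L)" and "0 \<le> h" "0 \<le> p"
  shows "cost_rate S (\<lambda>k d. d k) h x0 p L (const_policy r) = ereal (limit_cost h p r)"
proof (rule ereal_eq_if_near)
  interpret bounded_policy_process F \<mu> L "const_policy r" x0 r
    by (rule const_policy_process[OF r(1) x0])
  fix \<epsilon> :: real assume \<epsilon>: "0 < \<epsilon>"
  have q: "q d t = r" if "L \<le> t" for d t
    using received_order_add[of L "const_policy r" x0 d "t - L"] that
    by (simp add: const_policy_def)
  have EJ: "(\<lambda>t. \<integral>d. J d t \<partial>S) \<longlonglongrightarrow> limit_inventory r"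
    by (rule const_policy_mean_inventory_LIMSEQ[OF r x0])
  let ?c = "\<lambda>t. h * (\<integral>d. J d (Suc t) \<partial>S) + p * (\<mu> - ((\<integral>d. J d t \<partial>S) + r) + (\<integral>d. J d (Suc t) \<partial>S))"
  have "?c \<longlonglongrightarrow> h * limit_inventory r + p * (\<mu> - (limit_inventory r + r) + limit_inventory r)"
    by (intro tendsto_intros EJ LIMSEQ_Suc[OF EJ])
  then have "?c \<longlonglongrightarrow> limit_cost h p r"
    by (simp add: limit_cost_def)
  from tendstoD[OF this, of "\<epsilon> / 2"] \<epsilon> have "\<forall>\<^sub>F t in sequentially. \<bar>?c t - limit_cost h p r\<bar> < \<epsilon> / 2"
    by (simp add: dist_real_def)
  with eventually_ge_at_top[of L]
  have "\<forall>\<^sub>F t in sequentially. \<bar>mean_cost h p t - limit_cost h p r\<bar> \<le> \<epsilon> / 2"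
    by eventually_elim (simp add: mean_cost_eq q)
  then obtain t0 where "\<And>t. t0 \<le> t \<Longrightarrow> \<bar>mean_cost h p t - limit_cost h p r\<bar> \<le> \<epsilon> / 2"
    by (auto simp: eventually_sequentially)
  with cesaro_eventually_near[of t0 "mean_cost h p" "limit_cost h p r" "\<lambda>_. 0" "\<epsilon> / 2" L] \<epsilon>
  have "\<forall>\<^sub>F T in sequentially.
      \<bar>(\<Sum>t=L..T. mean_cost h p t) / (real T - real L + 1) - limit_cost h p r\<bar> \<le> \<epsilon>"
    by simp
  then show "ereal (limit_cost h p r - \<epsilon>) \<le> cost_rate S (\<lambda>k d. d k) h x0 p L (const_policy r) \<and>
      cost_rate S (\<lambda>k d. d k) h x0 p L (const_policy r) \<le> ereal (limit_cost h p r + \<epsilon>)"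
    by (rule cost_rate_near[OF assms(4,5)])
qed

end

section \<open>Projected inventory level policies\<close>

lemma const_inventory_initial_le: "0 \<le> j \<Longrightarrow> const_inventory r j d n \<le> const_inventory r 0 d n + j"
  by (induction n) auto

text \<open>The difference \<open>a - b\<close> is the difference of the leftovers plus the
  difference of the sales. Both have the same sign because leftover and sales are monotone in the
  stock, so their squares add up to at most the square of the sum.\<close>

lemma square_split_at_demand:
  fixes a b x :: real
  shows "(max (a - x) 0 - max (b - x) 0)\<^sup>2 \<le> (a - b)\<^sup>2 - (min a x - min b x)\<^sup>2"
proof -
  define P where "P = max (a - x) 0 - max (b - x) 0"
  define Q where "Q = min a x - min b x"
  have "a - b = P + Q" unfolding P_def Q_def by auto
  moreover have "0 \<le> P * Q"
    unfolding P_def Q_def by (cases "a \<le> b") (auto intro!: mult_nonneg_nonneg mult_nonpos_nonpos)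
  ultimately have "P\<^sup>2 \<le> (a - b)\<^sup>2 - Q\<^sup>2" by (simp add: power2_sum)
  then show ?thesis by (simp add: P_def Q_def)
qed

context demand_process
begin

text \<open>The cross term with the constant \<open>c\<close> vanishes after centring, and centring
  itself subtracts the squared mean.\<close>

lemma integral_sq_shift_mean:
  fixes f :: "(nat \<Rightarrow> real) \<Rightarrow> real"
  assumes f: "integrable S f" "integrable S (\<lambda>d. (f d)\<^sup>2)"
  shows "(\<integral>d. (f d - (\<integral>d. f d \<partial>S) + c)\<^sup>2 \<partial>S) \<le> (\<integral>d. (f d)\<^sup>2 \<partial>S) + c\<^sup>2"
proof -
  let ?m = "\<integral>d. f d \<partial>S"
  have eq: "(f d - ?m + c)\<^sup>2 = (f d)\<^sup>2 + 2 * (c - ?m) * f d + (c - ?m)\<^sup>2" for d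
    by (simp add: power2_eq_square algebra_simps)
  have "(\<integral>d. (f d - ?m + c)\<^sup>2 \<partial>S) = (\<integral>d. (f d)\<^sup>2 \<partial>S) + 2 * (c - ?m) * ?m + (c - ?m)\<^sup>2"
    unfolding eq using f by simp
  also have "\<dots> = (\<integral>d. (f d)\<^sup>2 \<partial>S) + c\<^sup>2 - ?m\<^sup>2"
    by (simp add: power2_eq_square algebra_simps)
  also have "\<dots> \<le> (\<integral>d. (f d)\<^sup>2 \<partial>S) + c\<^sup>2" by simp
  finally show ?thesis .
qed

lemma const_inventory_split:
  "const_inventory r j (comb_seq s d d') (s + n) = const_inventory r (const_inventory r j d s) d' n"
proof -
  have "const_inventory r j (comb_seq s d d') s = const_inventory r j d s"
    unfolding const_inventory_def by (rule pipeline_inventory_cong) (simp_all add: comb_seq_def)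
  then show ?thesis by (simp add: const_inventory_add)
qed

lemma integral_mean_inventory_split:
  "(\<integral>d. mean_inventory r (const_inventory r j d s) n \<partial>S) = mean_inventory r j (s + n)"
  using integral_split[of "\<lambda>d. const_inventory r j d (s + n)" s]
  by (simp add: const_inventory_split mean_inventory_def)

lemma integrable_mean_inventory_split [simp]:
  "integrable S (\<lambda>d. mean_inventory r (const_inventory r j d s) n)"
  using integrable_split[of "\<lambda>d. const_inventory r j d (s + n)" s]
  by (simp add: const_inventory_split mean_inventory_def)

lemma mean_inventory_initial_le: "0 \<le> j \<Longrightarrow> mean_inventory r j n \<le> mean_inventory r 0 n + j"
proof -
  assume "0 \<le> j"
  then have "mean_inventory r j n \<le> (\<integral>d. const_inventory r 0 d n + j \<partial>S)"
    unfolding mean_inventory_def by (intro integral_mono const_inventory_initial_le) simp_all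
  then show ?thesis by (simp add: mean_inventory_def)
qed

text \<open>One moment beyond the second, bounded uniformly in time, is what the truncation of the
  squares in \<open>mean_inventory_forgets\<close> consumes.\<close>

lemma const_inventory_third_moment:
  assumes "r < \<mu>"
  shows "\<exists>C. \<forall>s. integrable S (\<lambda>d. const_inventory r 0 d s ^ 3)
    \<and> (\<integral>d. const_inventory r 0 d s ^ 3 \<partial>S) \<le> C"
proof -
  obtain \<theta> \<rho> where \<theta>: "0 < \<theta>" "0 \<le> \<rho>" "\<rho> < 1"
    and le: "\<forall>n. (\<integral>d. exp (\<theta> * const_inventory r 0 d n) \<partial>S) \<le> 1 / (1 - \<rho>)"
    and int: "\<forall>n. integrable S (\<lambda>d. exp (\<theta> * const_inventory r 0 d n))"
    using exponential_moments[OF assms] by (elim exE conjE) (rule that)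
  note le = le[rule_format] and int = int[rule_format]
  have pt: "const_inventory r 0 d s ^ 3 \<le> 27 / \<theta> ^ 3 * exp (\<theta> * const_inventory r 0 d s)" for d s
  proof -
    have "(\<theta> * const_inventory r 0 d s) ^ 3 \<le> 27 * exp (\<theta> * const_inventory r 0 d s)"
      using \<theta> by (intro cube_le_exp mult_nonneg_nonneg const_inventory_nonneg) auto
    then show ?thesis using \<theta> by (simp add: power_mult_distrib field_simps)
  qed
  have int3: "integrable S (\<lambda>d. const_inventory r 0 d s ^ 3)" for s
  proof (rule Bochner_Integration.integrable_bound)
    show "integrable S (\<lambda>d. 27 / \<theta> ^ 3 * exp (\<theta> * const_inventory r 0 d s))"
      by (intro integrable_mult_right int)
    show "AE d in S. norm (const_inventory r 0 d s ^ 3)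
        \<le> norm (27 / \<theta> ^ 3 * exp (\<theta> * const_inventory r 0 d s))"
    proof (rule AE_I2)
      fix d
      have "0 \<le> const_inventory r 0 d s ^ 3" by (simp add: const_inventory_nonneg)
      with pt[of d s] show "norm (const_inventory r 0 d s ^ 3)
          \<le> norm (27 / \<theta> ^ 3 * exp (\<theta> * const_inventory r 0 d s))"
        unfolding real_norm_def by linarith
    qed
  qed measurable
  have "(\<integral>d. const_inventory r 0 d s ^ 3 \<partial>S) \<le> 27 / \<theta> ^ 3 * (1 / (1 - \<rho>))" for s
  proof -
    have "(\<integral>d. const_inventory r 0 d s ^ 3 \<partial>S)
        \<le> (\<integral>d. 27 / \<theta> ^ 3 * exp (\<theta> * const_inventory r 0 d s) \<partial>S)"
      by (intro integral_mono int3 pt integrable_mult_right int)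
    also have "\<dots> = 27 / \<theta> ^ 3 * (\<integral>d. exp (\<theta> * const_inventory r 0 d s) \<partial>S)"
      by simp
    also have "\<dots> \<le> 27 / \<theta> ^ 3 * (1 / (1 - \<rho>))"
      using \<theta> by (intro mult_left_mono le) auto
    finally show ?thesis .
  qed
  with int3 show ?thesis by blast
qed

text \<open>
  The conditional mean of the inventory level \<open>L\<close> periods ahead forgets the present level, in
  mean square and uniformly in time: it exceeds its value for an empty system by at most the
  present level, and on average by at most \<open>limit_inventory r - mean_inventory r 0 L\<close>.
\<close>

lemma mean_inventory_forgets:
  assumes r: "0 \<le> r" "r < \<mu>" and \<epsilon>: "0 < \<epsilon>"
  shows "\<forall>\<^sub>F L in sequentially. \<forall>s.
    (\<integral>d. (limit_inventory r - mean_inventory r (const_inventory r 0 d s) L)\<^sup>2 \<partial>S) \<le> \<epsilon>"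
proof -
  obtain C where C: "\<And>s. integrable S (\<lambda>d. const_inventory r 0 d s ^ 3)"
      "\<And>s. (\<integral>d. const_inventory r 0 d s ^ 3 \<partial>S) \<le> C"
    using const_inventory_third_moment[OF r(2)] by blast
  \<comment> \<open>Truncation level for the present stock, chosen so that the third-moment term is
    at most \<epsilon> / 2.\<close>
  define c where "c = 2 * \<bar>C\<bar> / \<epsilon> + 1"
  have c: "0 < c" "C / c \<le> \<epsilon> / 2"
  proof -
    show "0 < c" using \<epsilon> by (simp add: c_def add_nonneg_pos)
    have "\<epsilon> / 2 * c = \<bar>C\<bar> + \<epsilon> / 2" using \<epsilon> by (simp add: c_def field_simps)
    then have "C \<le> \<epsilon> / 2 * c" using \<epsilon> by linarith
    with \<open>0 < c\<close> show "C / c \<le> \<epsilon> / 2" by (simp add: field_simps)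
  qed
  define g where "g L = limit_inventory r - mean_inventory r 0 L" for L
  have g0: "0 \<le> g L" for L using mean_inventory_le_limit[OF r(2)] by (simp add: g_def)
  have "g \<longlonglongrightarrow> limit_inventory r - limit_inventory r"
    unfolding g_def[abs_def] by (intro tendsto_intros mean_inventory_LIMSEQ r)
  then have "(\<lambda>L. (g L)\<^sup>2 + c * g L) \<longlonglongrightarrow> (limit_inventory r - limit_inventory r)\<^sup>2
      + c * (limit_inventory r - limit_inventory r)"
    by (intro tendsto_intros)
  then have "(\<lambda>L. (g L)\<^sup>2 + c * g L) \<longlonglongrightarrow> 0" by simp
  from order_tendstoD(2)[OF this, of "\<epsilon> / 2"] \<epsilon>
  have "\<forall>\<^sub>F L in sequentially. (g L)\<^sup>2 + c * g L < \<epsilon> / 2" by simp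
  then show ?thesis
  proof (rule eventually_mono, intro allI)
    fix L s assume L: "(g L)\<^sup>2 + c * g L < \<epsilon> / 2"
    let ?K = "\<lambda>d. const_inventory r 0 d s"
    let ?u = "\<lambda>d. mean_inventory r (?K d) L - mean_inventory r 0 L"
    have K: "0 \<le> ?K d" for d by (simp add: const_inventory_nonneg)
    have u: "0 \<le> ?u d" "?u d \<le> ?K d" for d
      using mean_inventory_mono[of r r 0 "?K d" L] mean_inventory_initial_le[OF K, of r d L] K[of d]
      by auto
    \<comment> \<open>Here \<open>g L\<close> is the deficit for an empty system and
      \<open>?u d\<close> the gain from the present stock \<open>?K d\<close>. Only the mean of
      \<open>?u\<close> is small, so its square, at most \<open>?u d * ?K d\<close>, is bounded by
      \<open>c * ?u d\<close> for stock up to \<open>c\<close> and by a cubic term beyond.\<close>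
    have pt: "(limit_inventory r - mean_inventory r (?K d) L)\<^sup>2
        \<le> (g L)\<^sup>2 + (c * ?u d + ?K d ^ 3 / c)" for d
    proof -
      have 1: "(g L - ?u d)\<^sup>2 \<le> (g L)\<^sup>2 + (?u d)\<^sup>2"
        using mult_nonneg_nonneg[OF g0 u(1), of L d] by (simp add: power2_diff)
      have 2: "(?u d)\<^sup>2 \<le> ?u d * ?K d"
        using u[of d] by (simp add: power2_eq_square mult_left_mono)
      have 3: "?u d * ?K d \<le> c * ?u d + ?K d ^ 3 / c"
      proof (cases "?K d \<le> c")
        case True
        then have "?u d * ?K d \<le> ?u d * c" using u by (intro mult_left_mono) auto
        moreover have "0 \<le> ?K d ^ 3 / c" using K c by simp
        ultimately show ?thesis by (simp add: mult.commute)
      next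
        case False
        have "?u d * ?K d \<le> ?K d * ?K d" using u K by (intro mult_right_mono) auto
        also have "\<dots> \<le> ?K d * ?K d * (?K d / c)"
          using False K c mult_left_mono[of 1 "?K d / c" "?K d * ?K d"] by simp
        also have "\<dots> = ?K d ^ 3 / c" by (simp add: power3_eq_cube)
        finally have "?u d * ?K d \<le> ?K d ^ 3 / c" .
        moreover have "0 \<le> c * ?u d" using c u[of d] by (intro mult_nonneg_nonneg) linarith+
        ultimately show ?thesis by linarith
      qed
      have "limit_inventory r - mean_inventory r (?K d) L = g L - ?u d"
        by (simp add: g_def)
      then show ?thesis
        using order_trans[OF 1 add_left_mono[OF order_trans[OF 2 3]]] by (simp only:)
    qed
    have "(\<integral>d. (limit_inventory r - mean_inventory r (?K d) L)\<^sup>2 \<partial>S)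
        \<le> (\<integral>d. (g L)\<^sup>2 + (c * ?u d + ?K d ^ 3 / c) \<partial>S)"
    proof (rule integral_mono_AE')
      show "integrable S (\<lambda>d. (g L)\<^sup>2 + (c * ?u d + ?K d ^ 3 / c))" using C(1) by simp
      show "AE d in S. 0 \<le> (g L)\<^sup>2 + (c * ?u d + ?K d ^ 3 / c)"
        by (intro AE_I2 order_trans[OF zero_le_power2 pt])
    qed (intro AE_I2 pt)
    \<comment> \<open>Averaging over the past turns the mean of \<open>?u\<close> into an increment
      of the monotone sequence of mean levels. It is at most \<open>g L\<close> for every
      \<open>s\<close>, hence the uniformity in time.\<close>
    also have "\<dots> = (g L)\<^sup>2 + (c * (mean_inventory r 0 (s + L) - mean_inventory r 0 L)
        + (\<integral>d. ?K d ^ 3 \<partial>S) / c)"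
      using C(1) by (simp add: integral_mean_inventory_split)
    also have "\<dots> \<le> (g L)\<^sup>2 + (c * g L + C / c)"
      using C(2)[of s] c mean_inventory_le_limit[OF r(2), of "s + L"]
      by (intro add_left_mono add_mono mult_left_mono divide_right_mono) (auto simp: g_def)
    also have "\<dots> \<le> \<epsilon>" using L c by linarith
    finally show "(\<integral>d. (limit_inventory r - mean_inventory r (?K d) L)\<^sup>2 \<partial>S) \<le> \<epsilon>" .
  qed
qed

section \<open>The projected inventory level and the PIL policy as a process\<close>

definition projection :: "nat \<Rightarrow> (nat \<Rightarrow> real) \<Rightarrow> real" where
  "projection L x = (\<integral>d. pipeline_inventory x d L \<partial>S)"

lemma projected_inventory_coordinates:
  "projected_inventory S (\<lambda>k d. d k) L t x = projection L x"
  unfolding projected_inventory_def projection_def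
  by (rule integral_shift) (rule measurable_pipeline_inventory, auto)

lemma integrable_pipeline_inventory:
  assumes "x \<in> space (state_space L)"
  shows "integrable S (\<lambda>d. pipeline_inventory x d L)"
proof (rule integrable_bounded)
  show "(\<lambda>d. pipeline_inventory x d L) \<in> borel_measurable S"
    by (rule measurable_pipeline_inventory) auto
  fix d assume "d \<in> space S"
  then show "\<bar>pipeline_inventory x d L\<bar> \<le> (\<Sum>i\<le>L. x i)"
    using pipeline_inventory_upper[of L x d] pipeline_inventory_nonneg[of x d L]
      state_space_nonneg[OF assms] S_nonneg by auto
qed

lemma projection_nonneg: "x \<in> space (state_space L) \<Longrightarrow> 0 \<le> projection L x"
  unfolding projection_def
  by (intro Bochner_Integration.integral_nonneg pipeline_inventory_nonneg) (auto intro: state_space_nonneg)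

lemma projection_next_state:
  assumes "x \<in> space (state_space L)" "next_state L x z y \<in> space (state_space L)" "0 \<le> z" "0 \<le> y"
  shows "projection L (next_state L x z y) \<le> projection L x + z"
proof -
  have "projection L (next_state L x z y) \<le> (\<integral>d. pipeline_inventory x d L + z \<partial>S)"
    unfolding projection_def
    using integrable_pipeline_inventory[OF assms(1)] integrable_pipeline_inventory[OF assms(2)]
    by (intro integral_mono pipeline_inventory_next_state) (auto simp: assms state_space_nonneg[OF assms(1)])
  then show ?thesis using integrable_pipeline_inventory[OF assms(1)] by (simp add: projection_def)
qed

lemma measurable_projection: "projection L \<in> borel_measurable (state_space L)"
proof -
  have "(\<lambda>p. pipeline_inventory (fst p) (snd p) L) \<in> borel_measurable (state_space L \<Otimes>\<^sub>M S)"
  proof (rule measurable_pipeline_inventory)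
    show "(\<lambda>p. fst p i) \<in> borel_measurable (state_space L \<Otimes>\<^sub>M S)" if "i \<le> L" for i
      by (rule measurable_compose[OF measurable_fst measurable_state_space_component[OF that]])
    show "(\<lambda>p. snd p k) \<in> borel_measurable (state_space L \<Otimes>\<^sub>M S)" for k
      by (rule measurable_compose[OF measurable_snd measurable_coordinate])
  qed
  then show ?thesis
    unfolding projection_def[abs_def]
    by (intro P.borel_measurable_lebesgue_integral) (simp add: case_prod_beta')
qed

lemma pil_policy_coordinates:
  "pil_policy S (\<lambda>k d. d k) L \<xi> t x = max (\<xi> - projection L x) 0"
  by (simp add: pil_policy_def projected_inventory_coordinates)

lemma pil_policy_process:
  assumes "0 \<le> \<xi>" "x0 \<in> space (state_space L)"
  shows "bounded_policy_process F \<mu> L (pil_policy S (\<lambda>k d. d k) L \<xi>) x0 \<xi>"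
proof -
  have "pil_policy S (\<lambda>k d. d k) L \<xi> t = (\<lambda>x. max (\<xi> - projection L x) 0)" for t
    by (rule ext) (rule pil_policy_coordinates)
  then have "pil_policy S (\<lambda>k d. d k) L \<xi> \<in> policies L"
    using measurable_projection[of L] by (auto simp: policies_def measurable_restrict_space2_iff)
  then show ?thesis
    using assms projection_nonneg[of _ L] by unfold_locales (auto simp: pil_policy_coordinates)
qed

end

context bounded_policy_process
begin

lemma integral_projection: "(\<integral>d. projection L (X d s) \<partial>S) = (\<integral>d. J d (s + L) \<partial>S)"
  using integral_split[of "\<lambda>d. J d (s + L)" s] by (simp add: inventory_split projection_def)

lemma integrable_projection [simp]: "integrable S (\<lambda>d. projection L (X d s))"
  using integrable_split[of "\<lambda>d. J d (s + L)" s] by (simp add: inventory_split projection_def)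

end

text \<open>Parametrised by the constant order of the system to be coupled with; the PIL level \<xi>
  is derived from it.\<close>

locale pil_process = demand_process +
  fixes L :: nat and x0 :: "nat \<Rightarrow> real" and r :: real
  assumes x0: "x0 \<in> space (state_space L)" and r: "0 \<le> r" "r < \<mu>"
begin

definition \<xi> :: real where "\<xi> = r + limit_inventory r"

lemma \<xi>_nonneg: "0 \<le> \<xi>"
  using r limit_inventory_nonneg[of r] by (simp add: \<xi>_def)

sublocale bounded_policy_process F \<mu> L "pil_policy S (\<lambda>k d. d k) L \<xi>" x0 \<xi>
  by (rule pil_policy_process[OF \<xi>_nonneg x0])

text \<open>The amount by which the projected level overshoots \<xi>. Orders cannot be negative, so
  the policy cannot correct it; it can only be a remnant of the initial state.\<close>

definition excess :: "nat \<Rightarrow> (nat \<Rightarrow> real) \<Rightarrow> real" where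
  "excess s d = max (projection L (X d s) - \<xi>) 0"

lemma excess_nonneg: "0 \<le> excess s d"
  by (simp add: excess_def)

lemma q_eq: "q d (s + L) = \<xi> - projection L (X d s) + excess s d"
  by (simp add: received_order_add pil_policy_coordinates excess_def)

text \<open>The projection grows by at most the order placed. A positive order lifts it exactly to
  \<xi>, which leaves no excess, and a zero order does not lift it at all.\<close>

lemma excess_Suc:
  assumes d: "d \<in> space S"
  shows "excess (Suc s) d \<le> excess s d"
proof -
  have "projection L (X d (Suc s)) \<le> projection L (X d s) + pil_policy S (\<lambda>k d. d k) L \<xi> s (X d s)"
    using projection_next_state[OF state_in_space[OF d], of s "pil_policy S (\<lambda>k d. d k) L \<xi> s (X d s)" "d s"]
      state_in_space[OF d, of "Suc s"] policy_nonneg[OF state_in_space[OF d]] S_nonneg[OF d]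
    by simp
  then show ?thesis by (auto simp: excess_def pil_policy_coordinates)
qed

text \<open>As the excess never grows, a positive excess now was positive in all earlier periods,
  and nothing has been ordered so far.\<close>

lemma state_eq_no_orders:
  assumes d: "d \<in> space S"
  shows "0 < excess s d \<Longrightarrow> X d s = state L (const_policy 0) x0 d s"
proof (induction s)
  case (Suc s)
  then have "0 < excess s d" using excess_Suc[OF d, of s] by linarith
  moreover from this have "pil_policy S (\<lambda>k d. d k) L \<xi> s (X d s) = 0"
    by (auto simp: excess_def pil_policy_coordinates)
  ultimately show ?case using Suc.IH by (simp add: const_policy_def)
qed simp

lemma excess_le_initial: "d \<in> space S \<Longrightarrow> excess s d \<le> projection L x0"
proof (induction s)
  case 0
  then show ?case using \<xi>_nonneg projection_nonneg[OF x0] by (simp add: excess_def)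
next
  case (Suc s)
  then show ?case using excess_Suc[of d s] by linarith
qed

lemma integrable_excess [simp]: "integrable S (excess s)"
  unfolding excess_def[abs_def] by simp

lemma integrable_excess_sq [simp]: "integrable S (\<lambda>d. (excess s d)\<^sup>2)"
proof (rule integrable_bounded)
  show "(\<lambda>d. (excess s d)\<^sup>2) \<in> borel_measurable S"
    using borel_measurable_integrable[OF integrable_excess] by (rule borel_measurable_power)
  show "\<bar>(excess s d)\<^sup>2\<bar> \<le> (projection L x0)\<^sup>2" if "d \<in> space S" for d
    using power_mono[OF excess_le_initial[OF that] excess_nonneg, of s 2] by simp
qed

text \<open>Where the excess is positive the system has behaved like one that never orders, so the
  excess is at most the projected level of the latter. That system runs empty in the mean, since
  \<open>limit_inventory 0 = 0\<close>.\<close>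

lemma mean_excess_LIMSEQ: "(\<lambda>s. \<integral>d. excess s d \<partial>S) \<longlonglongrightarrow> 0"
proof -
  interpret Z: bounded_policy_process F \<mu> L "const_policy 0" x0 0
    by (rule const_policy_process) (simp_all add: x0)
  have "(\<lambda>t. \<integral>d. Z.J d t \<partial>S) \<longlonglongrightarrow> limit_inventory 0"
    using mean_pos by (intro const_policy_mean_inventory_LIMSEQ x0) auto
  then have 1: "(\<lambda>s. \<integral>d. Z.J d (s + L) \<partial>S) \<longlonglongrightarrow> 0"
    unfolding limit_inventory_0 by (rule LIMSEQ_ignore_initial_segment)
  have 2: "\<forall>\<^sub>F s in sequentially. (\<integral>d. excess s d \<partial>S) \<le> (\<integral>d. Z.J d (s + L) \<partial>S)"
  proof (rule always_eventually, rule allI)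
    fix s
    have "excess s d \<le> projection L (Z.X d s)" if d: "d \<in> space S" for d
    proof (cases "0 < excess s d")
      case True
      with state_eq_no_orders[OF d True] \<xi>_nonneg show ?thesis by (simp add: excess_def)
    next
      case False
      then show ?thesis using projection_nonneg[OF Z.state_in_space[OF d]] by (simp add: not_less order_trans)
    qed
    then show "(\<integral>d. excess s d \<partial>S) \<le> (\<integral>d. Z.J d (s + L) \<partial>S)"
      unfolding Z.integral_projection[symmetric] by (intro integral_mono) simp_all
  qed
  have 3: "\<forall>\<^sub>F s in sequentially. 0 \<le> (\<integral>d. excess s d \<partial>S)"
    by (intro always_eventually allI Bochner_Integration.integral_nonneg excess_nonneg)
  show ?thesis by (rule tendsto_sandwich[OF 3 2 tendsto_const 1])
qed

lemma mean_excess_sq_le: "(\<integral>d. (excess s d)\<^sup>2 \<partial>S) \<le> projection L x0 * (\<integral>d. excess s d \<partial>S)"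
proof -
  have "(\<integral>d. (excess s d)\<^sup>2 \<partial>S) \<le> (\<integral>d. projection L x0 * excess s d \<partial>S)"
  proof (rule integral_mono)
    show "(excess s d)\<^sup>2 \<le> projection L x0 * excess s d" if "d \<in> space S" for d
      using mult_right_mono[OF excess_le_initial[OF that, of s] excess_nonneg[of s d]]
      by (simp add: power2_eq_square)
  qed simp_all
  then show ?thesis by simp
qed

text \<open>
  The quantities of the coupling argument: \<open>gap\<close> is \<open>\<Delta>\<close>, the square of \<open>sales_gap\<close> is \<open>b\<close>, and
  \<open>shock\<close> is the error made by centring at the conditional mean.
\<close>

abbreviation K :: "(nat \<Rightarrow> real) \<Rightarrow> nat \<Rightarrow> real" where
  "K d t \<equiv> const_inventory r 0 d t"

definition gap :: "nat \<Rightarrow> (nat \<Rightarrow> real) \<Rightarrow> real" where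
  "gap t d = (J d t + q d t) - (K d t + r)"

definition sales_gap :: "nat \<Rightarrow> (nat \<Rightarrow> real) \<Rightarrow> real" where
  "sales_gap t d = min (J d t + q d t) (d t) - min (K d t + r) (d t)"

definition shock :: "nat \<Rightarrow> (nat \<Rightarrow> real) \<Rightarrow> real" where
  "shock s d = (limit_inventory r - mean_inventory r (K d s) L) + excess s d"

lemma K_bounds: "d \<in> space S \<Longrightarrow> 0 \<le> K d t \<and> K d t \<le> real t * r"
  using const_inventory_upper[of r 0 d t] r by (simp add: const_inventory_nonneg S_nonneg)

lemma levels_bounded:
  "\<exists>c. \<forall>d\<in>space S. \<bar>J d t\<bar> \<le> c \<and> \<bar>q d t\<bar> \<le> c \<and> \<bar>K d t\<bar> \<le> c"
proof -
  obtain c where c: "\<And>d. d \<in> space S \<Longrightarrow> J d t \<le> c \<and> q d t \<le> c"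
    using echelon_bounded by blast
  define c' where "c' = max c (real t * r)"
  have "\<bar>J d t\<bar> \<le> c'" "\<bar>q d t\<bar> \<le> c'" "\<bar>K d t\<bar> \<le> c'" if d: "d \<in> space S" for d
    using c[OF d] K_bounds[OF d, of t] inventory_nonneg[OF d, of t] received_order_nonneg[OF d, of t]
    unfolding c'_def by linarith+
  then show ?thesis by blast
qed

lemma measurable_gap: "gap t \<in> borel_measurable S"
  unfolding gap_def[abs_def] by measurable

lemma measurable_sales_gap: "sales_gap t \<in> borel_measurable S"
  unfolding sales_gap_def[abs_def] by measurable

lemma integrable_gap_sq: "integrable S (\<lambda>d. (gap t d)\<^sup>2)"
proof -
  obtain c where c: "\<And>d. d \<in> space S \<Longrightarrow> \<bar>J d t\<bar> \<le> c" "\<And>d. d \<in> space S \<Longrightarrow> \<bar>q d t\<bar> \<le> c"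
    "\<And>d. d \<in> space S \<Longrightarrow> \<bar>K d t\<bar> \<le> c" using levels_bounded[of t] by blast
  show ?thesis
  proof (rule integrable_sq_bounded[OF measurable_gap])
    show "\<bar>gap t d\<bar> \<le> 3 * c + r" if d: "d \<in> space S" for d
      using c(1)[OF d] c(2)[OF d] c(3)[OF d] r unfolding gap_def by linarith
  qed
qed

lemma sales_gap_le: "\<bar>sales_gap t d\<bar> \<le> \<bar>gap t d\<bar>"
  unfolding sales_gap_def gap_def by linarith

lemma integrable_sales_gap_sq: "integrable S (\<lambda>d. (sales_gap t d)\<^sup>2)"
proof (rule Bochner_Integration.integrable_bound[OF integrable_gap_sq])
  show "(\<lambda>d. (sales_gap t d)\<^sup>2) \<in> borel_measurable S"
    using measurable_sales_gap by (rule borel_measurable_power)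
  show "AE d in S. norm ((sales_gap t d)\<^sup>2) \<le> norm ((gap t d)\<^sup>2)"
    using sales_gap_le by (intro AE_I2) (simp add: abs_le_square_iff)
qed

lemma inventory_gap_sq_le: "(J d (Suc t) - K d (Suc t))\<^sup>2 \<le> (gap t d)\<^sup>2 - (sales_gap t d)\<^sup>2"
  unfolding gap_def sales_gap_def inventory_Suc const_inventory_Suc
  by (rule square_split_at_demand)

lemma integrable_inventory_gap_sq: "integrable S (\<lambda>d. (J d t - K d t)\<^sup>2)"
proof -
  obtain c where c: "\<And>d. d \<in> space S \<Longrightarrow> \<bar>J d t\<bar> \<le> c" "\<And>d. d \<in> space S \<Longrightarrow> \<bar>K d t\<bar> \<le> c"
    using levels_bounded[of t] by blast
  show ?thesis
  proof (rule integrable_sq_bounded)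
    show "\<bar>J d t - K d t\<bar> \<le> 2 * c" if d: "d \<in> space S" for d
      using c(1)[OF d] c(2)[OF d] by linarith
  qed measurable
qed

lemma integrable_forget_sq [simp]:
  "integrable S (\<lambda>d. (limit_inventory r - mean_inventory r (K d s) L)\<^sup>2)"
proof (rule integrable_sq_bounded)
  show "(\<lambda>d. limit_inventory r - mean_inventory r (K d s) L) \<in> borel_measurable S"
    by (intro borel_measurable_diff borel_measurable_const
        borel_measurable_integrable[OF integrable_mean_inventory_split])
  fix d assume d: "d \<in> space S"
  have "0 \<le> mean_inventory r (K d s) L"
    by (rule mean_inventory_nonneg) (simp add: const_inventory_nonneg)
  moreover have "mean_inventory r (K d s) L \<le> mean_inventory r 0 L + real s * r"
    using mean_inventory_initial_le[of "K d s" r L] K_bounds[OF d, of s] by simp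
  ultimately show "\<bar>limit_inventory r - mean_inventory r (K d s) L\<bar>
      \<le> limit_inventory r + (mean_inventory r 0 L + real s * r)"
    using limit_inventory_nonneg[OF r(2)] by linarith
qed

lemma shock_sq_le:
  "(shock s d)\<^sup>2 \<le> 2 * (limit_inventory r - mean_inventory r (K d s) L)\<^sup>2 + 2 * (excess s d)\<^sup>2"
  unfolding shock_def using sum_squares_bound[of "limit_inventory r - mean_inventory r (K d s) L" "excess s d"]
  by (simp add: power2_sum)

lemma integrable_shock_sq: "integrable S (\<lambda>d. (shock s d)\<^sup>2)"
proof (rule Bochner_Integration.integrable_bound)
  show "integrable S (\<lambda>d. 2 * (limit_inventory r - mean_inventory r (K d s) L)\<^sup>2 + 2 * (excess s d)\<^sup>2)"
    by simp
  show "(\<lambda>d. (shock s d)\<^sup>2) \<in> borel_measurable S"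
    unfolding shock_def
    by (intro borel_measurable_power borel_measurable_add borel_measurable_diff borel_measurable_const
        borel_measurable_integrable[OF integrable_mean_inventory_split]
        borel_measurable_integrable[OF integrable_excess])
  show "AE d in S. norm ((shock s d)\<^sup>2)
      \<le> norm (2 * (limit_inventory r - mean_inventory r (K d s) L)\<^sup>2 + 2 * (excess s d)\<^sup>2)"
    using shock_sq_le by (intro AE_I2) simp
qed

text \<open>
  Up to the shock, the gap is the inventory gap centred at its conditional mean \<open>L\<close> periods
  earlier, and centring does not increase the mean square.
\<close>

lemma mean_gap_sq_le:
  "(\<integral>d. (gap (s + L) d)\<^sup>2 \<partial>S)
    \<le> (\<integral>d. (J d (s + L) - K d (s + L))\<^sup>2 \<partial>S) + (\<integral>d. (shock s d)\<^sup>2 \<partial>S)"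
proof -
  define V where "V d d' = pipeline_inventory (X d s) d' L - const_inventory r (K d s) d' L" for d d'
  have V: "J (comb_seq s d d') (s + L) - K (comb_seq s d d') (s + L) = V d d'" for d d'
    by (simp add: V_def inventory_split const_inventory_split)
  define v where "v d = projection L (X d s) - mean_inventory r (K d s) L" for d
  \<comment> \<open>The stationary mean in \<open>\<xi> = r + limit_inventory r\<close> takes the
    place of the conditional mean of the constant order system; their difference is the forgetting
    part of the shock.\<close>
  have gap: "gap (s + L) d = (J d (s + L) - K d (s + L)) - v d + shock s d" for d
    unfolding gap_def q_eq v_def shock_def using \<xi>_def by linarith
  have "X (comb_seq s d d') s = X d s" for d d'
    by (rule state_cong) (simp add: comb_seq_def)
  moreover have "K (comb_seq s d d') s = K d s" for d d'
    using const_inventory_split[of r 0 s d d' 0] by simp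
  ultimately have past: "v (comb_seq s d d') = v d" "shock s (comb_seq s d d') = shock s d" for d d'
    by (simp_all add: v_def shock_def excess_def)
  \<comment> \<open>For a fixed past, \<open>v d\<close> is the mean of \<open>V d\<close> and the
    shock is a constant, so the variance estimate applies.\<close>
  have inner: "(\<integral>d'. (V d d' - v d + shock s d)\<^sup>2 \<partial>S) \<le> (\<integral>d'. (V d d')\<^sup>2 \<partial>S) + (shock s d)\<^sup>2"
    if d: "d \<in> space S" for d
  proof -
    have int: "integrable S (V d)"
      unfolding V_def[abs_def] using integrable_pipeline_inventory[OF state_in_space[OF d]] by simp
    have "v d = (\<integral>d'. V d d' \<partial>S)"
      using integrable_pipeline_inventory[OF state_in_space[OF d]]
      by (simp add: V_def v_def projection_def mean_inventory_def)
    moreover have "integrable S (\<lambda>d'. (V d d')\<^sup>2)"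
    proof (rule integrable_sq_bounded)
      show "V d \<in> borel_measurable S" using int by (rule borel_measurable_integrable)
      fix d' assume d': "d' \<in> space S"
      have "0 \<le> pipeline_inventory (X d s) d' L"
        by (rule pipeline_inventory_nonneg) (rule state_space_nonneg[OF state_in_space[OF d]], simp)
      moreover have "pipeline_inventory (X d s) d' L \<le> (\<Sum>i\<le>L. X d s i)"
        by (rule pipeline_inventory_upper)
          (simp_all add: state_space_nonneg[OF state_in_space[OF d]] S_nonneg[OF d'])
      moreover have "0 \<le> const_inventory r (K d s) d' L"
        using K_bounds[OF d] by (intro const_inventory_nonneg) auto
      moreover have "const_inventory r (K d s) d' L \<le> K d s + real L * r"
        using K_bounds[OF d] r by (intro const_inventory_upper S_nonneg[OF d']) auto
      ultimately show "\<bar>V d d'\<bar> \<le> (\<Sum>i\<le>L. X d s i) + (K d s + real L * r)"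
        unfolding V_def by linarith
    qed
    ultimately show ?thesis using integral_sq_shift_mean[OF int, of "shock s d"] by simp
  qed
  have int1: "integrable S (\<lambda>d. \<integral>d'. (V d d' - v d + shock s d)\<^sup>2 \<partial>S)"
    using integrable_split[OF integrable_gap_sq[of "s + L"], of s] unfolding gap V past .
  have int2: "integrable S (\<lambda>d. \<integral>d'. (V d d')\<^sup>2 \<partial>S)"
    using integrable_split[OF integrable_inventory_gap_sq[of "s + L"], of s] unfolding V .
  have "(\<integral>d. (gap (s + L) d)\<^sup>2 \<partial>S) = (\<integral>d. \<integral>d'. (V d d' - v d + shock s d)\<^sup>2 \<partial>S \<partial>S)"
    using integral_split[OF integrable_gap_sq[of "s + L"], of s] unfolding gap V past .
  also have "\<dots> \<le> (\<integral>d. (\<integral>d'. (V d d')\<^sup>2 \<partial>S) + (shock s d)\<^sup>2 \<partial>S)"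
    by (intro integral_mono int1 Bochner_Integration.integrable_add int2 integrable_shock_sq inner)
  also have "\<dots> = (\<integral>d. (\<integral>d'. (V d d')\<^sup>2 \<partial>S) \<partial>S) + (\<integral>d. (shock s d)\<^sup>2 \<partial>S)"
    by (rule Bochner_Integration.integral_add[OF int2 integrable_shock_sq])
  also have "(\<integral>d. (\<integral>d'. (V d d')\<^sup>2 \<partial>S) \<partial>S) = (\<integral>d. (J d (s + L) - K d (s + L))\<^sup>2 \<partial>S)"
    using integral_split[OF integrable_inventory_gap_sq[of "s + L"], of s, symmetric] unfolding V .
  finally show ?thesis .
qed

text \<open>Energy balance of one period: meeting the demand removes at least the squared sales gap
  from the squared gap, and the next order adds at most the squared shock.\<close>

lemma mean_sales_gap_sq_le:
  assumes "L \<le> t"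
  shows "(\<integral>d. (sales_gap t d)\<^sup>2 \<partial>S) \<le> (\<integral>d. (gap t d)\<^sup>2 \<partial>S) - (\<integral>d. (gap (Suc t) d)\<^sup>2 \<partial>S)
    + (\<integral>d. (shock (Suc t - L) d)\<^sup>2 \<partial>S)"
proof -
  have "Suc t - L + L = Suc t" using assms by simp
  then have "(\<integral>d. (gap (Suc t) d)\<^sup>2 \<partial>S)
      \<le> (\<integral>d. (J d (Suc t) - K d (Suc t))\<^sup>2 \<partial>S) + (\<integral>d. (shock (Suc t - L) d)\<^sup>2 \<partial>S)"
    using mean_gap_sq_le[of "Suc t - L"] by simp
  moreover have "(\<integral>d. (J d (Suc t) - K d (Suc t))\<^sup>2 \<partial>S) \<le> (\<integral>d. (gap t d)\<^sup>2 - (sales_gap t d)\<^sup>2 \<partial>S)"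
    by (intro integral_mono integrable_inventory_gap_sq Bochner_Integration.integrable_diff
        integrable_gap_sq integrable_sales_gap_sq inventory_gap_sq_le)
  moreover have "\<dots> = (\<integral>d. (gap t d)\<^sup>2 \<partial>S) - (\<integral>d. (sales_gap t d)\<^sup>2 \<partial>S)"
    by (rule Bochner_Integration.integral_diff[OF integrable_gap_sq integrable_sales_gap_sq])
  ultimately show ?thesis by linarith
qed

text \<open>Once the mean stock after receipt is known, the cost depends on mean sales only, with
  slope \<open>- (h + p)\<close>: a further unit sold saves its holding cost and its penalty. The
  constant order system sells \<open>r\<close> minus the growth of its mean level.\<close>

lemma mean_cost_near:
  assumes "L \<le> t" "0 \<le> h" "0 \<le> p" "0 < \<delta>"
  shows "\<bar>mean_cost h p t - limit_cost h p r\<bar> \<le> h * (\<integral>d. excess (t - L) d \<partial>S)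
    + (h + p) * ((\<integral>d. (sales_gap t d)\<^sup>2 \<partial>S) / \<delta> + \<delta>
      + (mean_inventory r 0 (Suc t) - mean_inventory r 0 t))"
proof -
  let ?B = "\<integral>d. (sales_gap t d)\<^sup>2 \<partial>S" and ?dm = "mean_inventory r 0 (Suc t) - mean_inventory r 0 t"
  define sales where "sales = (\<integral>d. min (J d t + q d t) (d t) \<partial>S)"
  have int_min: "integrable S (\<lambda>d. min (J d t + q d t) (d t))" by simp
  have int_minK: "integrable S (\<lambda>d. min (K d t + r) (d t))" by simp
  have "J d (Suc t) = J d t + q d t - min (J d t + q d t) (d t)" for d
    by (simp add: inventory_Suc)
  then have EJ: "(\<integral>d. J d (Suc t) \<partial>S) = (\<integral>d. J d t \<partial>S) + (\<integral>d. q d t \<partial>S) - sales"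
    using int_min by (simp add: sales_def)
  have "(\<integral>d. q d t \<partial>S) = \<xi> - (\<integral>d. projection L (X d (t - L)) \<partial>S) + (\<integral>d. excess (t - L) d \<partial>S)"
    using q_eq[of _ "t - L"] assms(1) by simp
  \<comment> \<open>Ordering the projected deficit fixes the mean stock after receipt at \<xi>, up
    to the excess.\<close>
  then have EY: "(\<integral>d. J d t \<partial>S) + (\<integral>d. q d t \<partial>S) = \<xi> + (\<integral>d. excess (t - L) d \<partial>S)"
    using assms(1) by (simp add: integral_projection)
  have "min (K d t + r) (d t) = K d t + r - K d (Suc t)" for d by simp
  then have EK: "(\<integral>d. min (K d t + r) (d t) \<partial>S) = r - ?dm"
    by (simp add: mean_inventory_def del: const_inventory_Suc)
  have int_gap: "integrable S (sales_gap t)"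
    unfolding sales_gap_def[abs_def] using int_min int_minK by simp
  have "sales - (r - ?dm) = (\<integral>d. sales_gap t d \<partial>S)"
    unfolding sales_def EK[symmetric] sales_gap_def using int_min int_minK by simp
  also have "\<bar>\<dots>\<bar> \<le> (\<integral>d. \<bar>sales_gap t d\<bar> \<partial>S)"
    by (rule integral_abs_bound)
  also have "\<dots> \<le> (\<integral>d. (sales_gap t d)\<^sup>2 / \<delta> + \<delta> \<partial>S)"
  proof (rule integral_mono)
    fix d
    \<comment> \<open>Passes from first to second moments: |x| is at most \<delta>, or else at most
      x^2 / \<delta>.\<close>
    show "\<bar>sales_gap t d\<bar> \<le> (sales_gap t d)\<^sup>2 / \<delta> + \<delta>"
    proof (cases "\<bar>sales_gap t d\<bar> \<le> \<delta>")
      case True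
      moreover have "0 \<le> (sales_gap t d)\<^sup>2 / \<delta>" using assms by simp
      ultimately show ?thesis by linarith
    next
      case False
      then have "\<bar>sales_gap t d\<bar> * \<delta> \<le> \<bar>sales_gap t d\<bar> * \<bar>sales_gap t d\<bar>"
        by (intro mult_left_mono) auto
      then have "\<bar>sales_gap t d\<bar> \<le> (sales_gap t d)\<^sup>2 / \<delta>"
        using assms by (simp add: field_simps power2_eq_square)
      then show ?thesis using assms by linarith
    qed
  qed (use int_gap integrable_sales_gap_sq in simp_all)
  also have "\<dots> = ?B / \<delta> + \<delta>" using integrable_sales_gap_sq by simp
  finally have sales: "\<bar>sales - (r - ?dm)\<bar> \<le> ?B / \<delta> + \<delta>" .
  have dm: "0 \<le> ?dm" using mean_inventory_Suc[of r t] by simp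
  have "mean_cost h p t - limit_cost h p r = h * (\<integral>d. excess (t - L) d \<partial>S) - (h + p) * (sales - r)"
  proof -
    have lr: "limit_inventory r = \<xi> - r" by (simp add: \<xi>_def)
    show ?thesis
      unfolding mean_cost_eq EJ EY limit_cost_def lr by (simp add: algebra_simps)
  qed
  also have "\<bar>\<dots>\<bar> \<le> \<bar>h * (\<integral>d. excess (t - L) d \<partial>S)\<bar> + \<bar>(h + p) * (sales - r)\<bar>"
    by (rule abs_triangle_ineq4)
  also have "\<bar>h * (\<integral>d. excess (t - L) d \<partial>S)\<bar> = h * (\<integral>d. excess (t - L) d \<partial>S)"
    using assms excess_nonneg by (intro abs_of_nonneg mult_nonneg_nonneg Bochner_Integration.integral_nonneg)
  also have "\<bar>(h + p) * (sales - r)\<bar> = (h + p) * \<bar>sales - r\<bar>"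
    using assms by (simp add: abs_mult)
  also have "\<dots> \<le> (h + p) * (?B / \<delta> + \<delta> + ?dm)"
    using sales dm assms by (intro mult_left_mono) linarith+
  finally show ?thesis by simp
qed

lemma pil_cost_rate_near:
  assumes hp: "0 \<le> h" "0 \<le> p" and \<epsilon>: "0 < \<epsilon>"
    and forgets: "\<And>s. (\<integral>d. (limit_inventory r - mean_inventory r (K d s) L)\<^sup>2 \<partial>S)
      \<le> (\<epsilon> / (10 * (h + p + 1)))\<^sup>2"
  shows "ereal (limit_cost h p r - \<epsilon>) \<le> cost_rate S (\<lambda>k d. d k) h x0 p L (pil_policy S (\<lambda>k d. d k) L \<xi>) \<and>
    cost_rate S (\<lambda>k d. d k) h x0 p L (pil_policy S (\<lambda>k d. d k) L \<xi>) \<le> ereal (limit_cost h p r + \<epsilon>)"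
proof (rule cost_rate_near[OF hp])
  define G where "G = h + p + 1"
  \<comment> \<open>The budget per period is \<epsilon> / 2, because averaging doubles it. The term
    \<delta> and the quotient \<open>2 * \<delta>\<^sup>2 / \<delta>\<close> use
    \<open>3 * (G * \<delta>)\<close>, that is 3/10 of \<epsilon>; the terms that vanish with time
    use another tenth.\<close>
  define \<delta> where "\<delta> = \<epsilon> / (10 * G)"
  have G: "0 < G" "h + p \<le> G" "h \<le> G" using hp by (auto simp: G_def)
  have \<delta>: "0 < \<delta>" "G * \<delta> = \<epsilon> / 10" using \<epsilon> G by (auto simp: \<delta>_def)
  define u where "u t = (\<integral>d. (gap t d)\<^sup>2 \<partial>S)" for t
  define E where "E s = (\<integral>d. excess s d \<partial>S)" for s
  define c where "c = projection L x0"
  have c: "0 \<le> c" unfolding c_def by (rule projection_nonneg[OF x0])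
  have E: "0 \<le> E s" for s unfolding E_def by (rule Bochner_Integration.integral_nonneg) (rule excess_nonneg)
  have shock: "(\<integral>d. (shock s d)\<^sup>2 \<partial>S) \<le> 2 * \<delta>\<^sup>2 + 2 * (c * E s)" for s
  proof -
    have "(\<integral>d. (shock s d)\<^sup>2 \<partial>S)
        \<le> (\<integral>d. 2 * (limit_inventory r - mean_inventory r (K d s) L)\<^sup>2 + 2 * (excess s d)\<^sup>2 \<partial>S)"
      by (intro integral_mono integrable_shock_sq shock_sq_le) simp
    also have "\<dots> = 2 * (\<integral>d. (limit_inventory r - mean_inventory r (K d s) L)\<^sup>2 \<partial>S)
        + 2 * (\<integral>d. (excess s d)\<^sup>2 \<partial>S)" by simp
    also have "\<dots> \<le> 2 * \<delta>\<^sup>2 + 2 * (c * E s)"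
      using forgets[of s] mean_excess_sq_le[of s] by (simp add: \<delta>_def G_def E_def c_def)
    finally show ?thesis .
  qed
  have lim1: "(\<lambda>t. E (t - L)) \<longlonglongrightarrow> 0"
    using filterlim_compose[OF mean_excess_LIMSEQ filterlim_minus_const_nat_at_top[of L]]
    unfolding E_def .
  have "(\<lambda>t. G * (E (t - L) + 2 * c / \<delta> * E (Suc t - L)
      + (mean_inventory r 0 (Suc t) - mean_inventory r 0 t))) \<longlonglongrightarrow> G * (0 + 2 * c / \<delta> * 0
      + (limit_inventory r - limit_inventory r))"
    by (intro tendsto_mult tendsto_add tendsto_diff tendsto_const lim1 LIMSEQ_Suc[OF lim1]
        LIMSEQ_Suc[OF mean_inventory_LIMSEQ] mean_inventory_LIMSEQ r)
  then have lim: "(\<lambda>t. G * (E (t - L) + 2 * c / \<delta> * E (Suc t - L)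
      + (mean_inventory r 0 (Suc t) - mean_inventory r 0 t))) \<longlonglongrightarrow> 0"
    by simp
  have "\<forall>\<^sub>F t in sequentially. G * (E (t - L) + 2 * c / \<delta> * E (Suc t - L)
      + (mean_inventory r 0 (Suc t) - mean_inventory r 0 t)) < \<epsilon> / 10"
    using order_tendstoD(2)[OF lim, of "\<epsilon> / 10"] \<epsilon> by simp
  with eventually_ge_at_top[of L]
  have "\<forall>\<^sub>F t in sequentially. \<bar>mean_cost h p t - limit_cost h p r\<bar>
      \<le> G / \<delta> * u t - G / \<delta> * u (Suc t) + \<epsilon> / 2"
  proof eventually_elim
    fix t assume t: "L \<le> t" and small: "G * (E (t - L) + 2 * c / \<delta> * E (Suc t - L)
      + (mean_inventory r 0 (Suc t) - mean_inventory r 0 t)) < \<epsilon> / 10"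
    let ?B = "\<integral>d. (sales_gap t d)\<^sup>2 \<partial>S" and ?dm = "mean_inventory r 0 (Suc t) - mean_inventory r 0 t"
    have B: "0 \<le> ?B" by (rule Bochner_Integration.integral_nonneg) simp
    have dm: "0 \<le> ?dm" using mean_inventory_Suc[of r t] by simp
    have "\<bar>mean_cost h p t - limit_cost h p r\<bar> \<le> h * E (t - L) + (h + p) * (?B / \<delta> + \<delta> + ?dm)"
      unfolding E_def by (rule mean_cost_near[OF t hp \<delta>(1)])
    also have "\<dots> \<le> G * E (t - L) + G * (?B / \<delta> + \<delta> + ?dm)"
      using G E B dm \<delta> by (intro add_mono mult_right_mono) auto
    also have "\<dots> \<le> G * E (t - L) + G * ((u t - u (Suc t) + (2 * \<delta>\<^sup>2 + 2 * (c * E (Suc t - L)))) / \<delta> + \<delta> + ?dm)"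
      using mean_sales_gap_sq_le[OF t] shock[of "Suc t - L"] G \<delta>
      by (intro add_left_mono mult_left_mono add_right_mono divide_right_mono) (auto simp: u_def)
    also have "\<dots> = (G / \<delta> * u t - G / \<delta> * u (Suc t)) + 3 * (G * \<delta>)
        + G * (E (t - L) + 2 * c / \<delta> * E (Suc t - L) + ?dm)"
      using \<delta>(1) by (simp add: field_simps power2_eq_square)
    also have "\<dots> \<le> G / \<delta> * u t - G / \<delta> * u (Suc t) + \<epsilon> / 2"
    proof -
      have "x + 3 * (G * \<delta>) + z \<le> x + \<epsilon> / 2" if "z \<le> \<epsilon> / 10" for x z
        using that \<epsilon> unfolding \<delta>(2) by linarith
      from this[OF less_imp_le[OF small]] show ?thesis .
    qed
    finally show "\<bar>mean_cost h p t - limit_cost h p r\<bar> \<le> G / \<delta> * u t - G / \<delta> * u (Suc t) + \<epsilon> / 2" .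
  qed
  then obtain t0 where "\<And>t. t0 \<le> t \<Longrightarrow>
      \<bar>mean_cost h p t - limit_cost h p r\<bar> \<le> G / \<delta> * u t - G / \<delta> * u (Suc t) + \<epsilon> / 2"
    by (auto simp: eventually_sequentially)
  moreover have "0 \<le> G / \<delta> * u t" for t
    unfolding u_def using G \<delta> by (intro mult_nonneg_nonneg Bochner_Integration.integral_nonneg) auto
  ultimately have "\<forall>\<^sub>F T in sequentially.
      \<bar>(\<Sum>t=L..T. mean_cost h p t) / (real T - real L + 1) - limit_cost h p r\<bar> \<le> 2 * (\<epsilon> / 2)"
    using \<epsilon> by (intro cesaro_eventually_near[where w = "\<lambda>t. G / \<delta> * u t"]) auto
  then show "\<forall>\<^sub>F T in sequentially.
      \<bar>(\<Sum>t=L..T. mean_cost h p t) / (real T - real L + 1) - limit_cost h p r\<bar> \<le> \<epsilon>" by simp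
qed

end

context demand_process
begin

lemma cost_rate_pil_policy_LIMSEQ:
  assumes r: "0 \<le> r" "r < \<mu>" and x0: "\<And>L. x0 L \<in> space (state_space L)" and hp: "0 \<le> h" "0 \<le> p"
  shows "(\<lambda>L. cost_rate S (\<lambda>k d. d k) h (x0 L) p L
      (pil_policy S (\<lambda>k d. d k) L (r + limit_inventory r))) \<longlonglongrightarrow> ereal (limit_cost h p r)"
proof (rule LIMSEQ_ereal_if_near)
  fix \<epsilon> :: real assume \<epsilon>: "0 < \<epsilon>"
  then have "0 < (\<epsilon> / (10 * (h + p + 1)))\<^sup>2" using hp by simp
  from mean_inventory_forgets[OF r this]
  show "\<forall>\<^sub>F L in sequentially. ereal (limit_cost h p r - \<epsilon>)
      \<le> cost_rate S (\<lambda>k d. d k) h (x0 L) p L (pil_policy S (\<lambda>k d. d k) L (r + limit_inventory r))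
    \<and> cost_rate S (\<lambda>k d. d k) h (x0 L) p L (pil_policy S (\<lambda>k d. d k) L (r + limit_inventory r))
      \<le> ereal (limit_cost h p r + \<epsilon>)"
  proof eventually_elim
    fix L
    assume *: "\<forall>s. (\<integral>d. (limit_inventory r - mean_inventory r (const_inventory r 0 d s) L)\<^sup>2 \<partial>S)
      \<le> (\<epsilon> / (10 * (h + p + 1)))\<^sup>2"
    interpret pil_process F \<mu> L "x0 L" r by unfold_locales (rule x0 r)+
    show "ereal (limit_cost h p r - \<epsilon>)
      \<le> cost_rate S (\<lambda>k d. d k) h (x0 L) p L (pil_policy S (\<lambda>k d. d k) L (r + limit_inventory r))
    \<and> cost_rate S (\<lambda>k d. d k) h (x0 L) p L (pil_policy S (\<lambda>k d. d k) L (r + limit_inventory r))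
      \<le> ereal (limit_cost h p r + \<epsilon>)"
      using pil_cost_rate_near[OF hp \<epsilon> *[rule_format]] unfolding \<xi>_def .
  qed
qed

end

section \<open>Asymptotic optimality of constant orders\<close>

context demand_process
begin

text \<open>The finite-horizon version of \<open>limit_cost\<close>: it increases to the latter with
  \<open>n\<close> when \<open>r < \<mu>\<close> and, unlike it, is also meaningful for orders at or
  above \<mu>, which an average order may reach.\<close>

definition horizon_cost :: "real \<Rightarrow> real \<Rightarrow> nat \<Rightarrow> real \<Rightarrow> real" where
  "horizon_cost h p n r = h * mean_inventory r 0 n + p * (\<mu> - r)"

lemma horizon_cost_mono: "0 \<le> h \<Longrightarrow> m \<le> n \<Longrightarrow> horizon_cost h p m r \<le> horizon_cost h p n r"
  using incseqD[OF incseq_mean_inventory[of r], of m n] by (simp add: horizon_cost_def mult_left_mono)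

lemma continuous_mean_inventory: "continuous_on A (\<lambda>r. mean_inventory r 0 n)"
proof (rule continuous_on_subset[OF _ subset_UNIV], rule uniformly_continuous_imp_continuous)
  show "uniformly_continuous_on UNIV (\<lambda>r. mean_inventory r 0 n)"
    unfolding uniformly_continuous_on_def
  proof (intro allI impI)
    fix e :: real assume e: "0 < e"
    have "\<bar>mean_inventory r' 0 n - mean_inventory r 0 n\<bar> < e" if "\<bar>r' - r\<bar> < e / (real n + 1)" for r r'
    proof -
      have "\<bar>mean_inventory r' 0 n - mean_inventory r 0 n\<bar> \<le> real n * \<bar>r' - r\<bar>"
      proof (cases "r \<le> r'")
        case True
        then show ?thesis
          using mean_inventory_Lipschitz[OF True, of 0 n] mean_inventory_mono[OF True, of 0 0 n] by simp
      next
        case False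
        then have "r' \<le> r" by simp
        from mean_inventory_Lipschitz[OF this, of 0 n] mean_inventory_mono[OF this, of 0 0 n] this
        show ?thesis by simp
      qed
      also have "\<dots> \<le> (real n + 1) * \<bar>r' - r\<bar>" by (intro mult_right_mono) auto
      also have "\<dots> < e" using that by (simp add: field_simps)
      finally show ?thesis .
    qed
    with e show "\<exists>d>0. \<forall>x\<in>UNIV. \<forall>x'\<in>UNIV. dist x' x < d \<longrightarrow>
        dist (mean_inventory x' 0 n) (mean_inventory x 0 n) < e"
      by (intro exI[of _ "e / (real n + 1)"]) (auto simp: dist_real_def)
  qed
qed

lemma open_horizon_cost: "open {r. a < horizon_cost h p n r}"
  unfolding horizon_cost_def
  by (intro open_Collect_less continuous_intros continuous_mean_inventory)

text \<open>Dini's argument on the compact interval from 0 to \<mu>: the open sets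
  \<open>?U n\<close> increase with \<open>n\<close> and cover it, the end point \<mu> being reached
  because the mean level diverges there. Larger orders are excluded by their holding cost.\<close>

lemma horizon_cost_near_min:
  assumes h: "0 < h" and p: "0 \<le> p" and \<epsilon>: "0 < \<epsilon>"
    and min: "\<And>z. 0 \<le> z \<Longrightarrow> z < \<mu> \<Longrightarrow> v \<le> limit_cost h p z"
  shows "\<forall>\<^sub>F n in sequentially. \<forall>z\<ge>0. v - \<epsilon> \<le> horizon_cost h p n z"
proof -
  let ?U = "\<lambda>n. {z. v - \<epsilon> < horizon_cost h p n z}"
  have cover: "{0..\<mu>} \<subseteq> (\<Union>n\<in>UNIV. ?U n)"
  proof
    fix z assume z: "z \<in> {0..\<mu>}"
    show "z \<in> (\<Union>n\<in>UNIV. ?U n)"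
    proof (cases "z < \<mu>")
      case True
      have "(\<lambda>n. horizon_cost h p n z) \<longlonglongrightarrow> limit_cost h p z"
        unfolding horizon_cost_def limit_cost_def
        by (intro tendsto_intros mean_inventory_LIMSEQ True)
      moreover have "v - \<epsilon> < limit_cost h p z" using min[of z] z True \<epsilon> by simp
      ultimately have "\<forall>\<^sub>F n in sequentially. v - \<epsilon> < horizon_cost h p n z"
        by (rule order_tendstoD)
      then obtain n where "v - \<epsilon> < horizon_cost h p n z"
        by (auto simp: eventually_sequentially)
      then have "z \<in> ?U n" by simp
      then show ?thesis by (rule UN_I[OF UNIV_I])
    next
      case False
      with z have "z = \<mu>" by simp
      obtain n where "v / h < mean_inventory \<mu> 0 n" using mean_inventory_unbounded by blast
      then have "v - \<epsilon> < horizon_cost h p n \<mu>"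
        using h \<epsilon> by (simp add: horizon_cost_def field_simps)
      then have "z \<in> ?U n" unfolding \<open>z = \<mu>\<close> by simp
      then show ?thesis by (rule UN_I[OF UNIV_I])
    qed
  qed
  have "open (?U n)" for n by (rule open_horizon_cost)
  from compactE_image[OF compact_Icc this cover]
  obtain N where N: "finite N" "{0..\<mu>} \<subseteq> (\<Union>n\<in>N. ?U n)" .
  obtain n1 where n1: "\<forall>n\<in>N. n \<le> n1"
    using N(1) unfolding finite_nat_set_iff_bounded_le ..
  \<comment> \<open>Beyond \<mu>, half of the holding cost has to pay for \<open>v\<close> and the
    other half for the negative penalty term \<open>p * (\<mu> - z)\<close>; this explains both
    factors 2. The second half uses the linear growth of the level at rate
    \<open>z - \<mu>\<close>.\<close>
  obtain n2 where n2: "2 * v / h < mean_inventory \<mu> 0 n2" using mean_inventory_unbounded by blast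
  obtain n3 :: nat where n3: "2 * p / h < real n3" using reals_Archimedean2 by blast
  have "v - \<epsilon> \<le> horizon_cost h p n z" if n: "n1 + n2 + n3 \<le> n" and z: "0 \<le> z" for n z
  proof (cases "z \<le> \<mu>")
    case True
    with z have "z \<in> (\<Union>n\<in>N. ?U n)" by (intro subsetD[OF N(2)]) simp
    then obtain m where "m \<in> N" "v - \<epsilon> < horizon_cost h p m z" by auto
    moreover have "horizon_cost h p m z \<le> horizon_cost h p n z"
      using bspec[OF n1 \<open>m \<in> N\<close>] n h by (intro horizon_cost_mono) auto
    ultimately show ?thesis by linarith
  next
    case False
    then have z: "\<mu> \<le> z" by simp
    have "mean_inventory \<mu> 0 n2 \<le> mean_inventory z 0 n"
      using order_trans[OF incseqD[OF incseq_mean_inventory] mean_inventory_mono[OF z order_refl]] n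
      by simp
    then have "2 * v / h \<le> mean_inventory z 0 n" using n2 by linarith
    then have 1: "2 * v \<le> h * mean_inventory z 0 n" using h by (simp add: field_simps)
    have "2 * p / h \<le> real n" using n3 n by linarith
    then have "2 * p \<le> h * real n" using h by (simp add: field_simps)
    then have "2 * p * (z - \<mu>) \<le> h * real n * (z - \<mu>)" using z by (intro mult_right_mono) auto
    also have "\<dots> \<le> h * mean_inventory z 0 n"
      using mean_inventory_lower[of n z] h by (simp add: mult.assoc)
    finally have "v \<le> horizon_cost h p n z"
      using 1 by (simp add: horizon_cost_def algebra_simps)
    with \<epsilon> show ?thesis by linarith
  qed
  then show ?thesis by (intro eventually_sequentiallyI[of "n1 + n2 + n3"]) blast
qed

definition mean_no_stockout :: "real \<Rightarrow> nat \<Rightarrow> nat \<Rightarrow> real" where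
  "mean_no_stockout r i n = (\<integral>d. of_bool (no_stockout r d i n) \<partial>S)"

lemma measurable_no_stockout: "(\<lambda>d. of_bool (no_stockout r d i n) :: real) \<in> borel_measurable S"
proof -
  have "(\<lambda>d. of_bool (no_stockout r d i n) :: real)
    = (\<lambda>d. \<Prod>k\<in>{i<..n}. if 0 < const_inventory r 0 d k then 1 else 0)"
    by (rule ext) (auto simp: no_stockout_def)
  moreover have "\<dots> \<in> borel_measurable S" by measurable
  ultimately show ?thesis by (simp only:)
qed

lemma integrable_no_stockout: "integrable S (\<lambda>d. of_bool (no_stockout r d i n) :: real)"
  by (rule integrable_bounded[of _ 1]) (simp_all add: measurable_no_stockout)

end

section \<open>Lower bound on the cost of an arbitrary policy\<close>

context policy_process
begin

lemma integrable_inventory_L: "integrable S (\<lambda>d. J d L)"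
  using inventory_initial_bound inventory_nonneg
  by (intro integrable_bounded[of _ "\<Sum>i\<le>L. x0 i"] measurable_inventory) simp

lemma measurable_period_cost: "(\<lambda>d. period_cost h p L \<pi> x0 d t) \<in> borel_measurable S"
  unfolding period_cost_eq by measurable

text \<open>The orders received in periods \<open>t\<close> to \<open>t + L - 1\<close> are already
  in the state of period \<open>t\<close>, so they depend on demands before \<open>t\<close>,
  whereas the weights depend on demands from \<open>t\<close> on. By independence the mean of each
  product factorises, and only the mean orders of the policy remain.\<close>

lemma mean_inventory_lower_subgradient:
  assumes q: "\<And>i. i < L \<Longrightarrow> integrable S (\<lambda>d. q d (t + i))" and J: "integrable S (\<lambda>d. J d (t + L))"
  shows "mean_inventory r 0 L + (\<Sum>i<L. ((\<integral>d. q d (t + i) \<partial>S) - r) * mean_no_stockout r i L)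
    \<le> (\<integral>d. J d (t + L) \<partial>S)"
proof -
  define w where "w i d = (of_bool (no_stockout r d i L) :: real)" for i d
  have w: "0 \<le> w i d" "w i d \<le> 1" for i d by (simp_all add: w_def)
  have [measurable]: "w i \<in> borel_measurable S" for i
    unfolding w_def[abs_def] by (rule measurable_no_stockout)
  have ws: "integrable S (\<lambda>d. w i (\<lambda>k. d (t + k)))" for i
    unfolding w_def by (rule integrable_shift[OF integrable_no_stockout])
  have ws': "(\<integral>d. w i (\<lambda>k. d (t + k)) \<partial>S) = mean_no_stockout r i L" for i
    using integral_shift[of "w i" t] by (simp add: w_def mean_no_stockout_def measurable_no_stockout)
  have int: "integrable S (\<lambda>d. q d (t + i) * w i (\<lambda>k. d (t + k)))" if "i < L" for i
  proof (rule Bochner_Integration.integrable_bound[OF q[OF that]])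
    show "(\<lambda>d. q d (t + i) * w i (\<lambda>k. d (t + k))) \<in> borel_measurable S"
      by (intro borel_measurable_times measurable_received_order borel_measurable_integrable[OF ws])
    show "AE d in S. norm (q d (t + i) * w i (\<lambda>k. d (t + k))) \<le> norm (q d (t + i))"
      using w by (intro AE_I2) (simp add: abs_mult mult_left_le)
  qed
  have prod: "(\<integral>d. q d (t + i) * w i (\<lambda>k. d (t + k)) \<partial>S) = (\<integral>d. q d (t + i) \<partial>S) * mean_no_stockout r i L"
    if "i < L" for i
  proof -
    have "q d (t + i) = q d' (t + i)" if "\<And>k. k < t \<Longrightarrow> d k = d' k" for d d'
      using state_cong[of t d d' L \<pi> x0] that \<open>i < L\<close> by (simp add: received_order_pipeline)
    from integral_indep[OF int[OF that] this]
    show ?thesis by (simp add: w_def mean_no_stockout_def)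
  qed
  have "mean_inventory r 0 L + (\<Sum>i<L. ((\<integral>d. q d (t + i) \<partial>S) - r) * mean_no_stockout r i L)
      = (\<integral>d. const_inventory r 0 (\<lambda>k. d (t + k)) L
          + (\<Sum>i<L. q d (t + i) * w i (\<lambda>k. d (t + k)) - r * w i (\<lambda>k. d (t + k))) \<partial>S)"
  proof -
    have "(\<integral>d. (\<Sum>i<L. q d (t + i) * w i (\<lambda>k. d (t + k)) - r * w i (\<lambda>k. d (t + k))) \<partial>S)
        = (\<Sum>i<L. \<integral>d. q d (t + i) * w i (\<lambda>k. d (t + k)) - r * w i (\<lambda>k. d (t + k)) \<partial>S)"
      by (intro Bochner_Integration.integral_sum Bochner_Integration.integrable_diff int integrable_mult_right ws) simp
    also have "\<dots> = (\<Sum>i<L. ((\<integral>d. q d (t + i) \<partial>S) - r) * mean_no_stockout r i L)"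
    proof (rule sum.cong[OF refl])
      fix i assume "i \<in> {..<L}"
      then have i: "i < L" by simp
      have "(\<integral>d. q d (t + i) * w i (\<lambda>k. d (t + k)) - r * w i (\<lambda>k. d (t + k)) \<partial>S)
          = (\<integral>d. q d (t + i) * w i (\<lambda>k. d (t + k)) \<partial>S) - (\<integral>d. r * w i (\<lambda>k. d (t + k)) \<partial>S)"
        by (rule Bochner_Integration.integral_diff[OF int[OF i] integrable_mult_right[OF ws]])
      then show "(\<integral>d. q d (t + i) * w i (\<lambda>k. d (t + k)) - r * w i (\<lambda>k. d (t + k)) \<partial>S)
          = ((\<integral>d. q d (t + i) \<partial>S) - r) * mean_no_stockout r i L"
        by (simp add: prod[OF i] ws' left_diff_distrib)
    qed
    finally have eq: "(\<integral>d. (\<Sum>i<L. q d (t + i) * w i (\<lambda>k. d (t + k)) - r * w i (\<lambda>k. d (t + k))) \<partial>S)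
        = (\<Sum>i<L. ((\<integral>d. q d (t + i) \<partial>S) - r) * mean_no_stockout r i L)" .
    show ?thesis
      by (subst Bochner_Integration.integral_add)
        (auto simp: eq mean_inventory_shift
          intro!: integrable_const_inventory_shift Bochner_Integration.integrable_sum
            Bochner_Integration.integrable_diff int integrable_mult_right ws)
  qed
  also have "\<dots> \<le> (\<integral>d. J d (t + L) \<partial>S)"
  proof (rule integral_mono)
    show "integrable S (\<lambda>d. const_inventory r 0 (\<lambda>k. d (t + k)) L
          + (\<Sum>i<L. q d (t + i) * w i (\<lambda>k. d (t + k)) - r * w i (\<lambda>k. d (t + k))))"
      by (auto intro!: integrable_const_inventory_shift Bochner_Integration.integrable_sum
            Bochner_Integration.integrable_add Bochner_Integration.integrable_diff int integrable_mult_right ws)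
    fix d assume d: "d \<in> space S"
    have "0 \<le> X d t 0" by (rule state_space_nonneg[OF state_in_space[OF d]]) simp
    from pipeline_inventory_subgradient[of "X d t", OF this, of r "\<lambda>k. d (t + k)" L]
    show "const_inventory r 0 (\<lambda>k. d (t + k)) L
          + (\<Sum>i<L. q d (t + i) * w i (\<lambda>k. d (t + k)) - r * w i (\<lambda>k. d (t + k))) \<le> J d (t + L)"
      by (simp add: inventory_eq_pipeline_inventory received_order_pipeline w_def left_diff_distrib)
  qed (rule J)
  finally show ?thesis .
qed

text \<open>
  Averaging the subgradient inequality over time at the average order \<open>\<rho>\<close> cancels the linear
  terms: each of the \<open>L\<close> shifted sums of orders dominates the sum that defines \<open>\<rho>\<close>.
\<close>

lemma finite_horizon_cost_lower:
  assumes h: "0 < h" and p: "0 \<le> p" and L: "0 < L" and T: "2 * L \<le> T"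
    and fin: "\<And>t. L \<le> t \<Longrightarrow> t \<le> T \<Longrightarrow> integrable S (\<lambda>d. period_cost h p L \<pi> x0 d t)"
  shows "\<exists>\<rho>\<ge>0. (real T - real L + 1) * horizon_cost h p L \<rho> - p * (real L * \<mu> + (\<Sum>i\<le>L. x0 i))
    \<le> (\<Sum>t=L..T. \<integral>d. period_cost h p L \<pi> x0 d t \<partial>S)"
proof -
  \<comment> \<open>As \<open>h\<close> is positive, finite mean costs bound the mean levels; the
    orders are bounded in turn by leftover stock plus demand.\<close>
  have intJ: "integrable S (\<lambda>d. J d (Suc t))" if t: "L \<le> t" "t \<le> T" for t
  proof (rule Bochner_Integration.integrable_bound)
    show "integrable S (\<lambda>d. period_cost h p L \<pi> x0 d t / h)" using fin[OF t] by simp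
    show "AE d in S. norm (J d (Suc t)) \<le> norm (period_cost h p L \<pi> x0 d t / h)"
    proof (rule AE_I2)
      fix d assume d: "d \<in> space S"
      have "h * J d (Suc t) \<le> period_cost h p L \<pi> x0 d t"
        using p by (simp add: period_cost_eq inventory_Suc)
      then have "J d (Suc t) \<le> period_cost h p L \<pi> x0 d t / h" using h by (simp add: field_simps)
      then show "norm (J d (Suc t)) \<le> norm (period_cost h p L \<pi> x0 d t / h)"
        using inventory_nonneg[OF d, of "Suc t"] unfolding real_norm_def by linarith
    qed
  qed (rule measurable_inventory)
  have intJ': "integrable S (\<lambda>d. J d t)" if t: "L \<le> t" "t \<le> Suc T" for t
  proof (cases "t = L")
    case True
    then show ?thesis by (simp add: integrable_inventory_L)
  next
    case False
    with t obtain s where "t = Suc s" "L \<le> s" "s \<le> T" by (cases t) auto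
    then show ?thesis using intJ by simp
  qed
  have intq: "integrable S (\<lambda>d. q d t)" if t: "t \<le> T" for t
  proof (cases "t < L")
    case True
    then have "q d t = x0 (Suc t)" for d using received_order_pipeline[of t L \<pi> x0 d 0] by simp
    then show ?thesis by simp
  next
    case False
    show ?thesis
    proof (rule Bochner_Integration.integrable_bound)
      show "integrable S (\<lambda>d. J d (Suc t) + d t)" using intJ[of t] False t by simp
      show "AE d in S. norm (q d t) \<le> norm (J d (Suc t) + d t)"
      proof (rule AE_I2)
        fix d assume d: "d \<in> space S"
        show "norm (q d t) \<le> norm (J d (Suc t) + d t)"
          using inventory_nonneg[OF d, of t] received_order_nonneg[OF d, of t] S_nonneg[OF d, of t]
          by (auto simp: inventory_Suc)
      qed
    qed (rule measurable_received_order)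
  qed
  define EJ where "EJ t = (\<integral>d. J d t \<partial>S)" for t
  define Eq where "Eq t = (\<integral>d. q d t \<partial>S)" for t
  define lost where "lost t = \<mu> - (EJ t + Eq t) + EJ (Suc t)" for t
  have Eq: "0 \<le> Eq t" for t
    unfolding Eq_def by (rule Bochner_Integration.integral_nonneg) (rule received_order_nonneg)
  have EJ: "0 \<le> EJ t" for t
    unfolding EJ_def by (rule Bochner_Integration.integral_nonneg) (rule inventory_nonneg)
  have EJL: "EJ L \<le> (\<Sum>i\<le>L. x0 i)"
  proof -
    have "EJ L \<le> (\<integral>d. (\<Sum>i\<le>L. x0 i) \<partial>S)"
      unfolding EJ_def by (intro integral_mono integrable_inventory_L inventory_initial_bound) simp_all
    then show ?thesis by simp
  qed
  have lost_int: "(\<integral>d. d t - echelon L \<pi> x0 d t + J d (Suc t) \<partial>S) = lost t" if "L \<le> t" "t \<le> T" for t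
    using intJ[OF that] intJ'[of t] intq[of t] that by (simp add: lost_def EJ_def Eq_def)
  have lost: "0 \<le> lost t" if t: "L \<le> t" "t \<le> T" for t
    unfolding lost_int[OF t, symmetric]
    by (rule Bochner_Integration.integral_nonneg) (simp add: inventory_Suc)
  have cost: "(\<integral>d. period_cost h p L \<pi> x0 d t \<partial>S) = h * EJ (Suc t) + p * lost t"
    if t: "L \<le> t" "t \<le> T" for t
    using intJ[OF t] intJ'[of t] intq[of t] t
    by (simp add: period_cost_eq lost_def EJ_def Eq_def)
  define N where "N = T - L + 1"
  have N: "real N = real T - real L + 1" "0 < real N" "L \<le> N" "N \<le> T" "Suc T = L + N"
    using T L by (auto simp: N_def)
  \<comment> \<open>The range from \<open>L\<close> to \<open>N\<close> is the intersection of the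
    shifted windows from \<open>1 + i\<close> to \<open>N + i\<close> over \<open>i < L\<close>. As
    orders are nonnegative, no window sum falls below \<open>Q\<close>.\<close>
  define Q where "Q = (\<Sum>u=L..N. Eq u)"
  define \<rho> where "\<rho> = Q / real N"
  have \<rho>: "0 \<le> \<rho>" "real N * \<rho> = Q"
    using Eq N by (auto simp: \<rho>_def Q_def intro!: divide_nonneg_pos sum_nonneg)
  have window: "Q \<le> (\<Sum>t=1..N. Eq (t + i))" if i: "i < L" for i
  proof -
    have "Q \<le> (\<Sum>u=1 + i..N + i. Eq u)"
      unfolding Q_def using i Eq by (intro sum_mono2) auto
    also have "\<dots> = (\<Sum>t=1..N. Eq (t + i))" by (rule sum.shift_bounds_cl_nat_ivl)
    finally show ?thesis .
  qed
  have w: "0 \<le> mean_no_stockout \<rho> i L" for i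
    unfolding mean_no_stockout_def by (rule Bochner_Integration.integral_nonneg) simp
  have "real N * mean_inventory \<rho> 0 L
      \<le> (\<Sum>t=1..N. mean_inventory \<rho> 0 L + (\<Sum>i<L. (Eq (t + i) - \<rho>) * mean_no_stockout \<rho> i L))"
  proof -
    have "0 \<le> (\<Sum>i<L. ((\<Sum>t=1..N. Eq (t + i)) - real N * \<rho>) * mean_no_stockout \<rho> i L)"
      using window w by (intro sum_nonneg mult_nonneg_nonneg) (auto simp: \<rho>)
    also have "\<dots> = (\<Sum>i<L. \<Sum>t=1..N. (Eq (t + i) - \<rho>) * mean_no_stockout \<rho> i L)"
      by (intro sum.cong refl) (simp add: sum_subtractf flip: sum_distrib_right)
    also have "\<dots> = (\<Sum>t=1..N. \<Sum>i<L. (Eq (t + i) - \<rho>) * mean_no_stockout \<rho> i L)"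
      by (rule sum.swap)
    finally show ?thesis by (simp add: sum.distrib)
  qed
  also have "\<dots> \<le> (\<Sum>t=1..N. EJ (t + L))"
  proof (rule sum_mono)
    fix t assume t: "t \<in> {1..N}"
    show "mean_inventory \<rho> 0 L + (\<Sum>i<L. (Eq (t + i) - \<rho>) * mean_no_stockout \<rho> i L) \<le> EJ (t + L)"
      unfolding Eq_def EJ_def
      using t N by (intro mean_inventory_lower_subgradient intq intJ') auto
  qed
  also have "\<dots> = (\<Sum>t=L..T. EJ (Suc t))"
  proof -
    have "(\<Sum>t=1..N. EJ (t + L)) = (\<Sum>t=1 + L..N + L. EJ t)"
      by (rule sum.shift_bounds_cl_nat_ivl[symmetric])
    also have "{1 + L..N + L} = {Suc L..Suc T}" using N by auto
    also have "(\<Sum>t=Suc L..Suc T. EJ t) = (\<Sum>t=L..T. EJ (Suc t))"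
      by (rule sum.shift_bounds_cl_Suc_ivl)
    finally show ?thesis .
  qed
  finally have J: "real N * mean_inventory \<rho> 0 L \<le> (\<Sum>t=L..T. EJ (Suc t))" .
  \<comment> \<open>The lost sales are summed just over the range of \<open>Q\<close>. The periods
    left out account for at most \<open>real L * \<mu>\<close>, and the level of period
    \<open>L\<close> for at most the initial stock; neither depends on \<open>T\<close>.\<close>
  have "real N * (\<mu> - \<rho>) - (real L * \<mu> + (\<Sum>i\<le>L. x0 i)) \<le> (\<Sum>t=L..N. lost t)"
  proof -
    have "(\<Sum>t=L..N. lost t) = (\<Sum>t=L..N. \<mu>) - Q + (\<Sum>t=L..N. EJ (Suc t) - EJ t)"
      by (simp add: lost_def Q_def sum_subtractf sum.distrib)
    also have "(\<Sum>t=L..N. EJ (Suc t) - EJ t) = EJ (Suc N) - EJ L"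
      using N by (intro sum_Suc_diff) simp
    also have "(\<Sum>t=L..N. \<mu>) = (real N - real L + 1) * \<mu>"
      using N by simp
    finally have "(\<Sum>t=L..N. lost t) = (real N - real L + 1) * \<mu> - Q + (EJ (Suc N) - EJ L)" .
    then show ?thesis using EJL EJ[of "Suc N"] mean_pos \<rho>(2) by (simp add: algebra_simps)
  qed
  also have "\<dots> \<le> (\<Sum>t=L..T. lost t)"
    using lost N by (intro sum_mono2) auto
  finally have "p * (real N * (\<mu> - \<rho>) - (real L * \<mu> + (\<Sum>i\<le>L. x0 i))) \<le> p * (\<Sum>t=L..T. lost t)"
    using p by (intro mult_left_mono)
  moreover have "h * (real N * mean_inventory \<rho> 0 L) \<le> h * (\<Sum>t=L..T. EJ (Suc t))"
    using J h by (intro mult_left_mono) auto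
  moreover have "(\<Sum>t=L..T. \<integral>d. period_cost h p L \<pi> x0 d t \<partial>S)
      = h * (\<Sum>t=L..T. EJ (Suc t)) + p * (\<Sum>t=L..T. lost t)"
    by (simp add: cost sum.distrib sum_distrib_left)
  moreover have "real N * horizon_cost h p L \<rho> - p * (real L * \<mu> + (\<Sum>i\<le>L. x0 i))
      = h * (real N * mean_inventory \<rho> 0 L) + p * (real N * (\<mu> - \<rho>) - (real L * \<mu> + (\<Sum>i\<le>L. x0 i)))"
    by (simp add: horizon_cost_def algebra_simps)
  ultimately show ?thesis using \<rho>(1) N(1) by (intro exI[of _ \<rho>]) simp
qed

text \<open>For horizons with infinite mean cost nothing is to be shown; otherwise all costs up to
  \<open>T\<close> are integrable. The correction \<kappa> is fixed while the horizon grows, so it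
  drops out of the average.\<close>

lemma cost_rate_lower:
  assumes h: "0 < h" and p: "0 \<le> p" and L: "0 < L"
    and v: "\<And>\<rho>. 0 \<le> \<rho> \<Longrightarrow> v \<le> horizon_cost h p L \<rho>"
  shows "ereal v \<le> cost_rate S (\<lambda>k d. d k) h x0 p L \<pi>"
proof -
  define \<kappa> where "\<kappa> = p * (real L * \<mu> + (\<Sum>i\<le>L. x0 i))"
  let ?u = "\<lambda>T. enn2ereal (\<integral>\<^sup>+ d. ennreal
      ((\<Sum>t=L..T. period_cost h p L \<pi> x0 (\<lambda>s. d s) t) / (real T - real L + 1)) \<partial>S)"
  have nonneg: "0 \<le> period_cost h p L \<pi> x0 d t" for d t
    using h p by (simp add: period_cost_def Let_def)
  have le: "ereal (v - \<kappa> / (real T - real L + 1)) \<le> ?u T" if T: "2 * L \<le> T" for T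
  proof (cases "?u T = \<infinity>")
    case False
    let ?N = "real T - real L + 1"
    have N: "0 < ?N" using T by simp
    let ?f = "\<lambda>d. (\<Sum>t=L..T. period_cost h p L \<pi> x0 d t) / ?N"
    have fm: "?f \<in> borel_measurable S" using measurable_period_cost by simp
    have f0: "0 \<le> ?f d" for d using nonneg N by (intro divide_nonneg_pos sum_nonneg)
    have "(\<integral>\<^sup>+ d. ennreal (?f d) \<partial>S) < \<infinity>"
      using False by (simp add: top.not_eq_extremum)
    with fm f0 have intf: "integrable S ?f" by (intro integrableI_nonneg) auto
    have fin: "integrable S (\<lambda>d. period_cost h p L \<pi> x0 d t)" if t: "L \<le> t" "t \<le> T" for t
    proof (rule Bochner_Integration.integrable_bound)
      show "integrable S (\<lambda>d. ?N * ?f d)" by (rule integrable_mult_right[OF intf])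
      show "AE d in S. norm (period_cost h p L \<pi> x0 d t) \<le> norm (?N * ?f d)"
      proof (rule AE_I2)
        fix d
        have "period_cost h p L \<pi> x0 d t \<le> (\<Sum>t=L..T. period_cost h p L \<pi> x0 d t)"
          using t nonneg by (intro member_le_sum) auto
        then show "norm (period_cost h p L \<pi> x0 d t) \<le> norm (?N * ?f d)"
          using nonneg N by (simp add: sum_nonneg)
      qed
    qed (rule measurable_period_cost)
    obtain \<rho> where \<rho>: "0 \<le> \<rho>" and le: "?N * horizon_cost h p L \<rho> - \<kappa>
        \<le> (\<Sum>t=L..T. \<integral>d. period_cost h p L \<pi> x0 d t \<partial>S)"
      using finite_horizon_cost_lower[OF h p L T fin] unfolding \<kappa>_def by blast
    have "(\<integral>d. ?f d \<partial>S) = (\<Sum>t=L..T. \<integral>d. period_cost h p L \<pi> x0 d t \<partial>S) / ?N"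
      using fin by simp
    with divide_right_mono[OF le less_imp_le[OF N]]
    have "(?N * horizon_cost h p L \<rho> - \<kappa>) / ?N \<le> (\<integral>d. ?f d \<partial>S)" by linarith
    moreover have "(?N * horizon_cost h p L \<rho> - \<kappa>) / ?N = horizon_cost h p L \<rho> - \<kappa> / ?N"
      using N by (simp add: diff_divide_distrib)
    ultimately have "horizon_cost h p L \<rho> - \<kappa> / ?N \<le> (\<integral>d. ?f d \<partial>S)" by linarith
    then have "v - \<kappa> / ?N \<le> (\<integral>d. ?f d \<partial>S)" using v[OF \<rho>] by linarith
    moreover have "?u T = ereal (\<integral>d. ?f d \<partial>S)"
      using intf f0 by (subst nn_integral_eq_integral)
        (auto intro!: enn2ereal_ennreal Bochner_Integration.integral_nonneg simp del: integral_divide_zero)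
    ultimately show ?thesis by simp
  qed simp
  have lim: "(\<lambda>T. ereal (v - \<kappa> / (real T - real L + 1))) \<longlonglongrightarrow> ereal v"
  proof -
    have "filterlim (\<lambda>T. (1 - real L) + real T) at_top sequentially"
      by (rule filterlim_tendsto_add_at_top[OF tendsto_const filterlim_real_sequentially])
    then have "(\<lambda>T. v - \<kappa> / ((1 - real L) + real T)) \<longlonglongrightarrow> v - 0"
      by (intro tendsto_diff tendsto_const real_tendsto_divide_at_top[OF tendsto_const])
    then show ?thesis by (simp add: algebra_simps)
  qed
  have "ereal v = liminf (\<lambda>T. ereal (v - \<kappa> / (real T - real L + 1)))"
    using lim_imp_Liminf[OF _ lim] by simp
  also have "\<dots> \<le> liminf ?u"
    by (rule Liminf_mono) (use le in \<open>auto intro: eventually_sequentiallyI\<close>)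
  also have "\<dots> \<le> limsup ?u" by (rule Liminf_le_Limsup) simp
  finally show ?thesis unfolding cost_rate_def .
qed

end

context demand_process
begin

lemma optimal_cost_rate_LIMSEQ:
  assumes h: "0 < h" and p: "0 \<le> p" and r: "0 \<le> r" "r < \<mu>"
    and x0: "\<And>L. x0 L \<in> space (state_space L)"
    and min: "\<And>z. 0 \<le> z \<Longrightarrow> z < \<mu> \<Longrightarrow> limit_cost h p r \<le> limit_cost h p z"
  shows "(\<lambda>L. optimal_cost_rate S (\<lambda>k d. d k) h (x0 L) p L) \<longlonglongrightarrow> ereal (limit_cost h p r)"
proof (rule LIMSEQ_ereal_if_near)
  fix \<epsilon> :: real assume \<epsilon>: "0 < \<epsilon>"
  have "\<forall>\<^sub>F L in sequentially. \<forall>z\<ge>0. limit_cost h p r - \<epsilon> \<le> horizon_cost h p L z"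
    by (rule horizon_cost_near_min[OF h p \<epsilon>]) (rule min)
  then show "\<forall>\<^sub>F L in sequentially. ereal (limit_cost h p r - \<epsilon>) \<le> optimal_cost_rate S (\<lambda>k d. d k) h (x0 L) p L
    \<and> optimal_cost_rate S (\<lambda>k d. d k) h (x0 L) p L \<le> ereal (limit_cost h p r + \<epsilon>)"
    using eventually_gt_at_top[of 0]
  proof eventually_elim
    fix L :: nat
    assume low: "\<forall>z\<ge>0. limit_cost h p r - \<epsilon> \<le> horizon_cost h p L z" and L: "0 < L"
    have "ereal (limit_cost h p r - \<epsilon>) \<le> cost_rate S (\<lambda>k d. d k) h (x0 L) p L \<pi>" if "\<pi> \<in> policies L" for \<pi>
    proof -
      interpret policy_process F \<mu> L \<pi> "x0 L" by unfold_locales (rule that x0)+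
      show ?thesis using low by (intro cost_rate_lower[OF h p L]) blast
    qed
    then have "ereal (limit_cost h p r - \<epsilon>) \<le> optimal_cost_rate S (\<lambda>k d. d k) h (x0 L) p L"
      unfolding optimal_cost_rate_def by (rule INF_greatest)
    moreover have "optimal_cost_rate S (\<lambda>k d. d k) h (x0 L) p L \<le> ereal (limit_cost h p r + \<epsilon>)"
    proof -
      interpret bounded_policy_process F \<mu> L "const_policy r" "x0 L" r
        by (rule const_policy_process[OF r(1) x0])
      have "optimal_cost_rate S (\<lambda>k d. d k) h (x0 L) p L \<le> cost_rate S (\<lambda>k d. d k) h (x0 L) p L (const_policy r)"
        unfolding optimal_cost_rate_def by (rule INF_lower[OF policy])
      also have "\<dots> = ereal (limit_cost h p r)"
        using h by (intro cost_rate_const_policy[OF r x0 _ p]) simp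
      also have "\<dots> \<le> ereal (limit_cost h p r + \<epsilon>)" using \<epsilon> by simp
      finally show ?thesis .
    qed
    ultimately show "ereal (limit_cost h p r - \<epsilon>) \<le> optimal_cost_rate S (\<lambda>k d. d k) h (x0 L) p L
      \<and> optimal_cost_rate S (\<lambda>k d. d k) h (x0 L) p L \<le> ereal (limit_cost h p r + \<epsilon>)" ..
  qed
qed

end

section \<open>The given demand process\<close>

locale iid_demand = prob_space M
  for M :: "'a measure" and D :: "nat \<Rightarrow> 'a \<Rightarrow> real" and F\<^sub>D :: "real measure" and \<mu> :: real +
  assumes indep: "indep_vars (\<lambda>_. borel) D UNIV"
    and distr_D: "\<And>t. distr M borel (D t) = F\<^sub>D"
    and nonneg: "AE d in F\<^sub>D. 0 \<le> d"
    and cdf_0: "cdf F\<^sub>D 0 = 0"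
    and integrable: "integrable F\<^sub>D (\<lambda>d. d)"
    and mean: "\<mu> = (\<integral>d. d \<partial>F\<^sub>D)"
    and integrable_sq: "integrable F\<^sub>D (\<lambda>d. (d - \<mu>)\<^sup>2)"
    and variance: "0 < (\<integral>d. (d - \<mu>)\<^sup>2 \<partial>F\<^sub>D)"
begin

text \<open>The given law lives on the whole line and is nonnegative only almost everywhere.
  Clipping moves it to the half-line without changing any integral.\<close>

definition F :: "real measure" where
  "F = distr F\<^sub>D (restrict_space borel {0..}) (\<lambda>x. max x 0)"

lemma measurable_D: "D t \<in> borel_measurable M"
  using indep by (auto simp: indep_vars_def)

lemma sets_F\<^sub>D: "sets F\<^sub>D = sets borel"
  using distr_D[of 0, symmetric] by simp

lemma measurable_clip: "(\<lambda>x. max x 0) \<in> measurable F\<^sub>D (restrict_space borel {0..})"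
  by (subst measurable_cong_sets[OF sets_F\<^sub>D refl]) (auto intro!: measurable_restrict_space2)

lemma
  fixes f :: "real \<Rightarrow> real"
  assumes f: "f \<in> borel_measurable borel"
  shows integral_F: "(\<integral>x. f x \<partial>F) = (\<integral>x. f x \<partial>F\<^sub>D)"
    and integrable_F: "integrable F f \<longleftrightarrow> integrable F\<^sub>D f"
proof -
  have f': "f \<in> borel_measurable (restrict_space borel {0..})"
    using f by (rule measurable_restrict_space1)
  have fF: "f \<in> borel_measurable F\<^sub>D"
    by (subst measurable_cong_sets[OF sets_F\<^sub>D refl]) (rule f)
  have fm: "(\<lambda>x. f (max x 0)) \<in> borel_measurable F\<^sub>D"
    using measurable_compose[OF measurable_clip f'] .
  have ae: "AE x in F\<^sub>D. f (max x 0) = f x"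
    using nonneg by eventually_elim (simp add: max_def)
  show "(\<integral>x. f x \<partial>F) = (\<integral>x. f x \<partial>F\<^sub>D)"
    unfolding F_def integral_distr[OF measurable_clip f'] by (rule integral_cong_AE[OF fm fF ae])
  show "integrable F f \<longleftrightarrow> integrable F\<^sub>D f"
    unfolding F_def integrable_distr_eq[OF measurable_clip f'] by (rule integrable_cong_AE[OF fm fF ae])
qed

lemma prob_space_F\<^sub>D: "prob_space F\<^sub>D"
  using prob_space_distr[OF measurable_D[of 0]] by (simp add: distr_D)

text \<open>A nonnegative demand of mean 0 would vanish almost surely, and the distribution function
  would be 1 at 0.\<close>

lemma mean_pos: "0 < \<mu>"
proof -
  interpret D: prob_space F\<^sub>D by (rule prob_space_F\<^sub>D)
  have "0 \<le> \<mu>" unfolding mean using nonneg by (rule integral_nonneg_AE)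
  moreover have "\<mu> \<noteq> 0"
  proof
    assume "\<mu> = 0"
    then have "AE x in F\<^sub>D. x = 0"
      using integral_nonneg_eq_0_iff_AE[OF integrable nonneg] mean by simp
    then have "AE x in F\<^sub>D. x \<in> {..0}" by eventually_elim simp
    then have "measure F\<^sub>D {..0} = 1"
      by (subst D.prob_eq_1) (simp_all add: sets_F\<^sub>D)
    then show False using cdf_0 by (simp add: cdf_def)
  qed
  ultimately show ?thesis by simp
qed

sublocale dem: demand_process F \<mu>
proof -
  interpret D: prob_space F\<^sub>D by (rule prob_space_F\<^sub>D)
  interpret F: prob_space F
    unfolding F_def by (rule D.prob_space_distr[OF measurable_clip])
  have "integrable F\<^sub>D (\<lambda>x. (x - \<mu>)\<^sup>2 + (2 * \<mu> * x - \<mu>\<^sup>2))"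
    using integrable integrable_sq by simp
  moreover have "(\<lambda>x. (x - \<mu>)\<^sup>2 + (2 * \<mu> * x - \<mu>\<^sup>2)) = (\<lambda>x. x\<^sup>2)"
    by (auto simp: power2_diff)
  ultimately have sq: "integrable F\<^sub>D (\<lambda>x. x\<^sup>2)" by simp
  show "demand_process F \<mu>"
  proof
    show "sets F = sets (restrict_space borel {0..})" by (simp add: F_def)
    show "integrable F (\<lambda>x. x)" by (subst integrable_F) (simp_all add: integrable)
    show "(\<integral>x. x \<partial>F) = \<mu>" by (subst integral_F) (simp_all add: mean)
    show "integrable F (\<lambda>x. x\<^sup>2)" by (subst integrable_F) (simp_all add: sq)
    show "0 < \<mu>" by (rule mean_pos)
    show "0 < (\<integral>x. (x - \<mu>)\<^sup>2 \<partial>F)" by (subst integral_F) (simp_all add: variance)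
  qed
qed

definition demands :: "'a \<Rightarrow> nat \<Rightarrow> real" where
  "demands \<omega> k = max (D k \<omega>) 0"

lemma measurable_demands: "demands \<in> measurable M dem.S"
  using measurable_D by (intro dem.measurable_S_I) (auto simp: demands_def)

lemma distr_demands: "distr M dem.S demands = dem.S"
proof -
  let ?N = "restrict_space borel {0::real..}"
  have clip: "(\<lambda>x. max x 0) \<in> measurable borel ?N"
    by (auto intro!: measurable_restrict_space2)
  have "indep_vars (\<lambda>_. ?N) (\<lambda>k \<omega>. max (D k \<omega>) 0) UNIV"
    by (rule indep_vars_compose2[OF indep]) (rule clip)
  then have "distr M (Pi\<^sub>M UNIV (\<lambda>_. ?N)) (\<lambda>\<omega>. \<lambda>k\<in>UNIV. max (D k \<omega>) 0)
      = Pi\<^sub>M UNIV (\<lambda>k. distr M ?N (\<lambda>\<omega>. max (D k \<omega>) 0))"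
    by (subst (asm) indep_vars_iff_distr_eq_PiM)
      (auto intro!: measurable_compose[OF measurable_D clip])
  moreover have "distr M ?N (\<lambda>\<omega>. max (D k \<omega>) 0) = F" for k
    using distr_distr[OF clip measurable_D[of k]] by (simp add: F_def distr_D comp_def)
  moreover have "distr M (Pi\<^sub>M UNIV (\<lambda>_. ?N)) (\<lambda>\<omega>. \<lambda>k\<in>UNIV. max (D k \<omega>) 0) = distr M dem.S demands"
    by (intro distr_cong refl sets_PiM_cong) (auto simp: dem.sets_F demands_def fun_eq_iff)
  ultimately show ?thesis by simp
qed

text \<open>One null set serves for all shifts \<open>t\<close>; the shifted sequences are what the
  projection in period \<open>t\<close> is evaluated at.\<close>

lemma AE_demands: "AE \<omega> in M. \<forall>t. (\<lambda>k. D (t + k) \<omega>) = (\<lambda>k. demands \<omega> (t + k))"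
proof -
  have "AE \<omega> in M. \<forall>k. 0 \<le> D k \<omega>"
  proof (subst AE_all_countable, rule allI)
    fix k
    show "AE \<omega> in M. 0 \<le> D k \<omega>"
      by (rule AE_distrD[OF measurable_D[of k]]) (unfold distr_D, rule nonneg)
  qed
  then show ?thesis by eventually_elim (simp add: demands_def max_absorb1)
qed

lemma nn_integral_demands:
  assumes "f \<in> borel_measurable dem.S"
  shows "(\<integral>\<^sup>+\<omega>. f (\<lambda>k. D k \<omega>) \<partial>M) = (\<integral>\<^sup>+d. f d \<partial>dem.S)"
proof -
  have "(\<integral>\<^sup>+\<omega>. f (\<lambda>k. D k \<omega>) \<partial>M) = (\<integral>\<^sup>+\<omega>. f (demands \<omega>) \<partial>M)"
  proof (rule nn_integral_cong_AE)
    show "AE \<omega> in M. f (\<lambda>k. D k \<omega>) = f (demands \<omega>)"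
      using AE_demands by eventually_elim (metis add_0)
  qed
  also have "\<dots> = (\<integral>\<^sup>+d. f d \<partial>dem.S)"
    using nn_integral_distr[OF measurable_demands, of f] assms by (simp add: distr_demands)
  finally show ?thesis .
qed

lemma cost_rate_demands:
  assumes "\<pi> \<in> policies L" "x0 \<in> space (state_space L)"
  shows "cost_rate M D h x0 p L \<pi> = cost_rate dem.S (\<lambda>k d. d k) h x0 p L \<pi>"
proof -
  interpret policy_process F \<mu> L \<pi> x0 by unfold_locales (rule assms)+
  have "(\<lambda>d. ennreal ((\<Sum>t=L..T. period_cost h p L \<pi> x0 d t) / (real T - real L + 1)))
      \<in> borel_measurable dem.S" for T
    using measurable_period_cost by simp
  from nn_integral_demands[OF this] show ?thesis
    unfolding cost_rate_def by (simp only:)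
qed

lemma optimal_cost_rate_demands:
  assumes "x0 \<in> space (state_space L)"
  shows "optimal_cost_rate M D h x0 p L = optimal_cost_rate dem.S (\<lambda>k d. d k) h x0 p L"
  unfolding optimal_cost_rate_def by (intro INF_cong refl cost_rate_demands assms)

text \<open>The policy is itself defined by an expectation under \<open>M\<close>, so it has to be
  carried over to the canonical space before its cost-rate can be.\<close>

lemma pil_policy_demands: "pil_policy M D L \<xi> = pil_policy dem.S (\<lambda>k d. d k) L \<xi>"
proof (intro ext)
  fix t x
  let ?f = "\<lambda>d. pipeline_inventory x d L"
  have f: "?f \<in> borel_measurable dem.S"
    by (rule measurable_pipeline_inventory) (auto intro: dem.measurable_coordinate)
  have f': "(\<lambda>d. ?f (\<lambda>k. d (t + k))) \<in> borel_measurable dem.S"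
    by (rule measurable_compose[OF dem.measurable_shift f])
  have "projected_inventory M D L t x = (\<integral>\<omega>. ?f (\<lambda>k. demands \<omega> (t + k)) \<partial>M)"
    unfolding projected_inventory_def
  proof (rule integral_cong_AE)
    show "AE \<omega> in M. ?f (\<lambda>k. D (t + k) \<omega>) = ?f (\<lambda>k. demands \<omega> (t + k))"
      using AE_demands by eventually_elim metis
    show "(\<lambda>\<omega>. ?f (\<lambda>k. D (t + k) \<omega>)) \<in> borel_measurable M"
      by (rule measurable_pipeline_inventory) (auto intro: measurable_D)
    show "(\<lambda>\<omega>. ?f (\<lambda>k. demands \<omega> (t + k))) \<in> borel_measurable M"
      by (rule measurable_compose[OF measurable_demands f'])
  qed
  also have "\<dots> = projected_inventory dem.S (\<lambda>k d. d k) L t x"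
    unfolding projected_inventory_def
    using integral_distr[OF measurable_demands f'] by (simp add: distr_demands)
  finally show "pil_policy M D L \<xi> t x = pil_policy dem.S (\<lambda>k d. d k) L \<xi> t x"
    by (simp add: pil_policy_def)
qed

section \<open>The three cost-rates for the given demands\<close>

lemma cost_rate_const:
  assumes "0 \<le> r" "r < \<mu>" "x0 \<in> space (state_space L)" "0 \<le> h" "0 \<le> p"
  shows "cost_rate M D h x0 p L (const_policy r) = ereal (dem.limit_cost h p r)"
proof -
  interpret bounded_policy_process F \<mu> L "const_policy r" x0 r
    by (rule dem.const_policy_process[OF assms(1,3)])
  show ?thesis
    unfolding cost_rate_demands[OF policy assms(3)] by (rule dem.cost_rate_const_policy[OF assms])
qed

lemma cost_rate_pil_LIMSEQ:
  assumes r: "0 \<le> r" "r < \<mu>" and x0: "\<And>L. x0 L \<in> space (state_space L)" and hp: "0 \<le> h" "0 \<le> p"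
  shows "(\<lambda>L. cost_rate M D h (x0 L) p L (pil_policy M D L (r + dem.limit_inventory r)))
    \<longlonglongrightarrow> ereal (dem.limit_cost h p r)"
proof -
  have "cost_rate M D h (x0 L) p L (pil_policy M D L (r + dem.limit_inventory r))
    = cost_rate dem.S (\<lambda>k d. d k) h (x0 L) p L (pil_policy dem.S (\<lambda>k d. d k) L (r + dem.limit_inventory r))" for L
  proof -
    have "0 \<le> r + dem.limit_inventory r" using r dem.limit_inventory_nonneg[of r] by simp
    then interpret bounded_policy_process F \<mu> L
        "pil_policy dem.S (\<lambda>k d. d k) L (r + dem.limit_inventory r)" "x0 L" "r + dem.limit_inventory r"
      by (rule dem.pil_policy_process[OF _ x0])
    show ?thesis unfolding pil_policy_demands by (rule cost_rate_demands[OF policy x0])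
  qed
  then show ?thesis using dem.cost_rate_pil_policy_LIMSEQ[OF r x0 hp] by (simp only:)
qed

lemma optimal_cost_rate_demands_LIMSEQ:
  assumes "0 < h" "0 \<le> p" "0 \<le> r" "r < \<mu>" and x0: "\<And>L. x0 L \<in> space (state_space L)"
    and "\<And>z. 0 \<le> z \<Longrightarrow> z < \<mu> \<Longrightarrow> dem.limit_cost h p r \<le> dem.limit_cost h p z"
  shows "(\<lambda>L. optimal_cost_rate M D h (x0 L) p L) \<longlonglongrightarrow> ereal (dem.limit_cost h p r)"
  unfolding optimal_cost_rate_demands[OF x0] by (rule dem.optimal_cost_rate_LIMSEQ[OF assms])

end

theorem theorem1:
  fixes M :: "'a measure" and D :: "nat \<Rightarrow> 'a \<Rightarrow> real" and F\<^sub>D :: "real measure"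
    and \<mu> h :: real and x0 :: "nat \<Rightarrow> nat \<Rightarrow> real" and \<xi> r :: "real \<Rightarrow> real"
  assumes "prob_space M"
    and "prob_space.indep_vars M (\<lambda>_. borel) D UNIV"
    and "\<And>t. distr M borel (D t) = F\<^sub>D"
    and "AE d in F\<^sub>D. 0 \<le> d"
    and "cdf F\<^sub>D 0 = 0"
    and "integrable F\<^sub>D (\<lambda>d. d)"
    and "\<mu> = (\<integral>d. d \<partial>F\<^sub>D)"
    and "integrable F\<^sub>D (\<lambda>d. (d - \<mu>)\<^sup>2)"
    and "0 < (\<integral>d. (d - \<mu>)\<^sup>2 \<partial>F\<^sub>D)"
    and "0 \<le> h"
    and "\<And>L. x0 L \<in> space (state_space L)"
    and "\<And>L. x0 L 0 = 0"
    and "\<And>p. 0 \<le> p \<Longrightarrow>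
      is_arg_min (\<lambda>z. lim (\<lambda>L. cost_rate M D h (x0 L) p L (pil_policy M D L z)))
        (\<lambda>z. 0 \<le> z) (\<xi> p)"
    and "\<And>p. 0 \<le> p \<Longrightarrow>
      is_arg_min (\<lambda>z. lim (\<lambda>L. cost_rate M D h (x0 L) p L (const_policy z)))
        (\<lambda>z. 0 \<le> z \<and> z < \<mu>) (r p)"
  shows "(\<exists>B::real. 0 \<le> B \<and> (\<forall>p\<ge>0. \<exists>l::ereal.
      (\<lambda>L. cost_rate M D h (x0 L) p L (pil_policy M D L (\<xi> p))
         - cost_rate M D h (x0 L) p L (const_policy (r p))) \<longlonglongrightarrow> l \<and>
      (\<lambda>L. cost_rate M D h (x0 L) p L (pil_policy M D L (\<xi> p))
         - optimal_cost_rate M D h (x0 L) p L) \<longlonglongrightarrow> l \<and>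
      l < ereal B)) \<and>
    (\<exists>R::real \<Rightarrow> ereal.
      (\<forall>p>0. (\<lambda>L. cost_rate M D h (x0 L) p L (pil_policy M D L (\<xi> p))
         / optimal_cost_rate M D h (x0 L) p L) \<longlonglongrightarrow> R p) \<and>
      (R \<longlongrightarrow> 1) at_top)"
proof -
  interpret iid_demand M D F\<^sub>D \<mu>
    by (intro iid_demand.intro iid_demand_axioms.intro assms(1-9))
  note x0 = assms(11)
  let ?v = "\<lambda>p. dem.limit_cost h p (r p)"
  have const: "cost_rate M D h (x0 L) p L (const_policy z) = ereal (dem.limit_cost h p z)"
    if "0 \<le> p" "0 \<le> z" "z < \<mu>" for L p z
    using that by (intro cost_rate_const x0 assms(10))
  have r: "0 \<le> r p" "r p < \<mu>" if "0 \<le> p" for p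
    using assms(14)[OF that] by (auto simp: is_arg_min_def)
  have min: "?v p \<le> dem.limit_cost h p z" if p: "0 \<le> p" and z: "0 \<le> z" "z < \<mu>" for p z
  proof -
    have "\<not> lim (\<lambda>L. cost_rate M D h (x0 L) p L (const_policy z))
        < lim (\<lambda>L. cost_rate M D h (x0 L) p L (const_policy (r p)))"
      using assms(14)[OF p] z unfolding is_arg_min_def by blast
    then show ?thesis by (simp add: const p z r)
  qed
  \<comment> \<open>With \<open>h = 0\<close> the limiting cost \<open>p * (\<mu> - r)\<close>
    strictly decreases on the half-open interval. For \<open>p = 1\<close> the midpoint between
    \<open>r 1\<close> and \<mu> would beat the assumed minimizer.\<close>
  have h: "0 < h"
  proof (rule ccontr)
    assume "\<not> 0 < h"
    with assms(10) have "h = 0" by simp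
    then show False
      using min[of 1 "(r 1 + \<mu>) / 2"] r[of 1] by (simp add: dem.limit_cost_def)
  qed
  have pil: "(\<lambda>L. cost_rate M D h (x0 L) p L (pil_policy M D L (\<xi> p))) \<longlonglongrightarrow> ereal (?v p)"
    if p: "0 \<le> p" for p
  proof -
    \<comment> \<open>The operator \<open>lim\<close> means something only where the sequence
      converges. As every level is of the form \<open>z + dem.limit_inventory z\<close>, it
      converges for all of them.\<close>
    let ?f = "\<lambda>z. lim (\<lambda>L. cost_rate M D h (x0 L) p L (pil_policy M D L z))"
    have lim: "(\<lambda>L. cost_rate M D h (x0 L) p L (pil_policy M D L (z + dem.limit_inventory z)))
        \<longlonglongrightarrow> ereal (dem.limit_cost h p z)" if "0 \<le> z" "z < \<mu>" for z
      by (rule cost_rate_pil_LIMSEQ[OF that x0 assms(10) p])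
    have \<xi>: "0 \<le> \<xi> p" "\<And>z. 0 \<le> z \<Longrightarrow> \<not> ?f z < ?f (\<xi> p)"
      using assms(13)[OF p] unfolding is_arg_min_def by blast+
    obtain z where z: "0 \<le> z" "z < \<mu>" "z + dem.limit_inventory z = \<xi> p"
      using dem.limit_inventory_onto[OF \<xi>(1)] .
    have fz: "?f (\<xi> p) = ereal (dem.limit_cost h p z)"
      using limI[OF lim[OF z(1,2)]] by (simp add: z(3))
    have fr: "?f (r p + dem.limit_inventory (r p)) = ereal (?v p)"
      by (rule limI[OF lim[OF r[OF p]]])
    have "\<not> ereal (?v p) < ereal (dem.limit_cost h p z)"
      using \<xi>(2)[of "r p + dem.limit_inventory (r p)"] r[OF p] dem.limit_inventory_nonneg[of "r p"]
      unfolding fz fr by simp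
    \<comment> \<open>The order \<open>z\<close> behind \<open>\<xi> p\<close> need not be
      \<open>r p\<close>, but both minimization problems have the same values, hence the same
      minimum.\<close>
    then have "dem.limit_cost h p z = ?v p" using min[OF p z(1,2)] by simp
    with lim[OF z(1,2)] show ?thesis by (simp add: z(3))
  qed
  have opt: "(\<lambda>L. optimal_cost_rate M D h (x0 L) p L) \<longlonglongrightarrow> ereal (?v p)" if p: "0 \<le> p" for p
    by (rule optimal_cost_rate_demands_LIMSEQ[OF h p r[OF p] x0]) (rule min[OF p])
  have diff: "(\<lambda>L. cost_rate M D h (x0 L) p L (pil_policy M D L (\<xi> p)) - c L) \<longlonglongrightarrow> 0"
    if p: "0 \<le> p" and c: "c \<longlonglongrightarrow> ereal (?v p)" for p c
    using tendsto_diff_ereal[OF _ _ pil[OF p] c] by (simp add: zero_ereal_def)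
  have ratio: "(\<lambda>L. cost_rate M D h (x0 L) p L (pil_policy M D L (\<xi> p))
      / optimal_cost_rate M D h (x0 L) p L) \<longlonglongrightarrow> 1" if p: "0 < p" for p
  proof -
    \<comment> \<open>A positive penalty makes the common limit positive, so the limit of the ratio
      is not of the form 0 / 0.\<close>
    have "0 < p * (\<mu> - r p)" using p r[of p] by simp
    moreover have "0 \<le> h * dem.limit_inventory (r p)"
      using h p r[of p] dem.limit_inventory_nonneg[of "r p"] by simp
    ultimately have v: "0 < ?v p" by (simp add: dem.limit_cost_def)
    have "(\<lambda>L. cost_rate M D h (x0 L) p L (pil_policy M D L (\<xi> p))
      / optimal_cost_rate M D h (x0 L) p L) \<longlonglongrightarrow> ereal (?v p) / ereal (?v p)"
      using p v by (intro tendsto_divide_ereal pil opt) auto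
    then show ?thesis using v by (simp add: one_ereal_def)
  qed
  show ?thesis
  proof (intro conjI)
    show "\<exists>B::real. 0 \<le> B \<and> (\<forall>p\<ge>0. \<exists>l::ereal.
      (\<lambda>L. cost_rate M D h (x0 L) p L (pil_policy M D L (\<xi> p))
         - cost_rate M D h (x0 L) p L (const_policy (r p))) \<longlonglongrightarrow> l \<and>
      (\<lambda>L. cost_rate M D h (x0 L) p L (pil_policy M D L (\<xi> p))
         - optimal_cost_rate M D h (x0 L) p L) \<longlonglongrightarrow> l \<and>
      l < ereal B)"
    \<comment> \<open>Both differences tend to 0, so 1 is a bound for all \<open>p\<close> at
      once.\<close>
    proof (rule exI[of _ 1], intro conjI allI impI)
      fix p :: real assume p: "0 \<le> p"
      have c: "(\<lambda>L. cost_rate M D h (x0 L) p L (const_policy (r p))) \<longlonglongrightarrow> ereal (?v p)"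
        by (simp add: const p r)
      show "\<exists>l::ereal.
        (\<lambda>L. cost_rate M D h (x0 L) p L (pil_policy M D L (\<xi> p))
           - cost_rate M D h (x0 L) p L (const_policy (r p))) \<longlonglongrightarrow> l \<and>
        (\<lambda>L. cost_rate M D h (x0 L) p L (pil_policy M D L (\<xi> p))
           - optimal_cost_rate M D h (x0 L) p L) \<longlonglongrightarrow> l \<and>
        l < ereal 1"
        by (intro exI[of _ 0] conjI diff p c opt) simp
    qed simp
    show "\<exists>R::real \<Rightarrow> ereal.
      (\<forall>p>0. (\<lambda>L. cost_rate M D h (x0 L) p L (pil_policy M D L (\<xi> p))
         / optimal_cost_rate M D h (x0 L) p L) \<longlonglongrightarrow> R p) \<and>
      (R \<longlongrightarrow> 1) at_top"
      by (intro exI[of _ "\<lambda>_. 1"] conjI allI impI ratio tendsto_const)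
  qed
qed

end
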